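(* For every non-trivial height 1 condition $\Sigma$ there exists a relational structure $\mathbb B$ such that: (i) $\mathbb B$ is a first-order reduct of a finitely bounded homogeneous structure; (ii) $\operatorname{Pol}(\mathbb B)$ does not satisfy $\Sigma$; (iii) $\operatorname{Pol}(\mathbb B)$ satisfies some other non-trivial height 1 condition (consequently, there is no minion homomorphism from $\operatorname{Pol}(\mathbb B)$ to $\mathscr P$); (iv) $\operatorname{CSP}(\mathbb B)$ is solvable in polynomial time.
   Context: A polymorphism of a relational structure $\mathbb A$ is a homomorphism $\mathbb A^n\to\mathbb A$ for some $n\ge 1$, where $\mathbb A^n$ carries the componentwise relations; $\operatorname{Pol}(\mathbb A)$ is the set (clone) of all polymorphisms. A clone is a set of finitary operations on a set containing all projections and closed under composition; $\mathscr P$ denotes the clone on $\{0,1\}$ consisting only of projections. A height 1 identity is a statement $\forall x_1,\dots,x_r.\ f(x_{\pi(1)},\dots,x_{\pi(n)})=g(x_{\rho(1)},\dots,x_{\rho(m)})$ with function symbols $f,g$ and arbitrary maps $\pi,\rho$; a height 1 condition is a finite set of height 1 identities (symbols may be shared). A set of operations $\mathscr A$ satisfies $\Sigma$ if the symbols can be interpreted by operations in $\mathscr A$ of the right arities making all identities true. $\Sigma$ is trivial if it is satisfied in every clone (equivalently in $\mathscr P$). A minion homomorphism $\xi:\mathscr A\to\mathscr B$ between clones is an arity-preserving map with $\xi(f(x_{\pi(1)},\dots,x_{\pi(n)}))=\xi(f)(x_{\pi(1)},\dots,x_{\pi(n)})$ for all $n$-ary $f$ and all $\pi:\{1,\dots,n\}\to\{1,\dots,k\}$.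 $\operatorname{CSP}(\mathbb B)$ is the problem of deciding whether a given finite conjunction of atomic formulas over the signature of $\mathbb B$ is satisfiable in $\mathbb B$. A structure $\mathbb A$ is homogeneous if every isomorphism between finite substructures extends to an automorphism of $\mathbb A$; it is finitely bounded if there is a finite set $\mathcal F$ of finite structures such that a finite structure of its signature embeds into $\mathbb A$ iff no member of $\mathcal F$ embeds into it. $\mathbb B$ is a first-order reduct of $\mathbb A$ if they have the same domain and every relation of $\mathbb B$ is first-order definable in $\mathbb A$. *)

theory Defs
  imports Main "HOL-Library.FuncSet"
begin

section \<open>Relational structures\<close>

definition tuples :: "'a set \<Rightarrow> nat \<Rightarrow> 'a list set" where
  "tuples D n = {xs. length xs = n \<and> set xs \<subseteq> D}"

record ('r, 'a) rel_struct =
  universe :: "'a set"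
  sig :: "'r set"
  arity :: "'r \<Rightarrow> nat"
  rel :: "'r \<Rightarrow> 'a list set"

definition is_structure :: "('r, 'a) rel_struct \<Rightarrow> bool" where
  "is_structure A \<longleftrightarrow> universe A \<noteq> {} \<and>
     (\<forall>r\<in>sig A. 1 \<le> arity A r \<and> rel A r \<subseteq> tuples (universe A) (arity A r))"

definition same_signature :: "('r, 'a) rel_struct \<Rightarrow> ('r, 'b) rel_struct \<Rightarrow> bool" where
  "same_signature A B \<longleftrightarrow> sig A = sig B \<and> (\<forall>r\<in>sig A. arity A r = arity B r)"

definition homomorphism ::
  "('r, 'a) rel_struct \<Rightarrow> ('r, 'b) rel_struct \<Rightarrow> ('a \<Rightarrow> 'b) \<Rightarrow> bool" where
  "homomorphism A B f \<longleftrightarrow> same_signature A B \<and>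
     f ` universe A \<subseteq> universe B \<and>
     (\<forall>r\<in>sig A. \<forall>t\<in>rel A r. map f t \<in> rel B r)"

definition embedding ::
  "('r, 'a) rel_struct \<Rightarrow> ('r, 'b) rel_struct \<Rightarrow> ('a \<Rightarrow> 'b) \<Rightarrow> bool" where
  "embedding A B f \<longleftrightarrow> same_signature A B \<and>
     f ` universe A \<subseteq> universe B \<and> inj_on f (universe A) \<and>
     (\<forall>r\<in>sig A. \<forall>t\<in>tuples (universe A) (arity A r). t \<in> rel A r \<longleftrightarrow> map f t \<in> rel B r)"

definition embeds :: "('r, 'a) rel_struct \<Rightarrow> ('r, 'b) rel_struct \<Rightarrow> bool" where
  "embeds A B \<longleftrightarrow> (\<exists>f. embedding A B f)"

definition isomorphism ::
  "('r, 'a) rel_struct \<Rightarrow> ('r, 'b) rel_struct \<Rightarrow> ('a \<Rightarrow> 'b) \<Rightarrow> bool" where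
  "isomorphism A B f \<longleftrightarrow> embedding A B f \<and> f ` universe A = universe B"

definition substructure :: "('r, 'a) rel_struct \<Rightarrow> 'a set \<Rightarrow> ('r, 'a) rel_struct" where
  "substructure A S =
     \<lparr>universe = S, sig = sig A, arity = arity A, rel = (\<lambda>r. rel A r \<inter> tuples S (arity A r))\<rparr>"

definition homogeneous :: "('r, 'a) rel_struct \<Rightarrow> bool" where
  "homogeneous A \<longleftrightarrow>
     (\<forall>S T f. finite S \<and> S \<subseteq> universe A \<and> finite T \<and> T \<subseteq> universe A \<and>
        isomorphism (substructure A S) (substructure A T) f \<longrightarrow>
        (\<exists>g. isomorphism A A g \<and> (\<forall>x\<in>S. g x = f x)))"

text \<open>Finite structures are taken with universe a finite set of natural numbers, which
  covers all of them up to isomorphism.\<close>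

definition finitely_bounded :: "('r, 'a) rel_struct \<Rightarrow> bool" where
  "finitely_bounded A \<longleftrightarrow> finite (sig A) \<and>
     (\<exists>\<F> :: ('r, nat) rel_struct set. finite \<F> \<and>
        (\<forall>F\<in>\<F>. is_structure F \<and> finite (universe F) \<and> same_signature F A) \<and>
        (\<forall>C :: ('r, nat) rel_struct.
           is_structure C \<and> finite (universe C) \<and> same_signature C A \<longrightarrow>
           (embeds C A \<longleftrightarrow> \<not> (\<exists>F\<in>\<F>. embeds F C))))"


section \<open>First-order definability\<close>

datatype 'r atom = AEq nat nat | ARel 'r "nat list"

datatype 'r formula =
    Atom "'r atom"
  | Neg "'r formula"
  | Conj "'r formula" "'r formula"
  | Exists nat "'r formula"

fun atom_wf :: "('r, 'a) rel_struct \<Rightarrow> 'r atom \<Rightarrow> bool" where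
  "atom_wf A (AEq x y) = True"
| "atom_wf A (ARel r xs) = (r \<in> sig A \<and> length xs = arity A r)"

fun atom_vars :: "'r atom \<Rightarrow> nat set" where
  "atom_vars (AEq x y) = {x, y}"
| "atom_vars (ARel r xs) = set xs"

fun atom_holds :: "('r, 'a) rel_struct \<Rightarrow> (nat \<Rightarrow> 'a) \<Rightarrow> 'r atom \<Rightarrow> bool" where
  "atom_holds A s (AEq x y) = (s x = s y)"
| "atom_holds A s (ARel r xs) = (map s xs \<in> rel A r)"

fun formula_wf :: "('r, 'a) rel_struct \<Rightarrow> 'r formula \<Rightarrow> bool" where
  "formula_wf A (Atom a) = atom_wf A a"
| "formula_wf A (Neg p) = formula_wf A p"
| "formula_wf A (Conj p q) = (formula_wf A p \<and> formula_wf A q)"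
| "formula_wf A (Exists x p) = formula_wf A p"

fun free_vars :: "'r formula \<Rightarrow> nat set" where
  "free_vars (Atom a) = atom_vars a"
| "free_vars (Neg p) = free_vars p"
| "free_vars (Conj p q) = free_vars p \<union> free_vars q"
| "free_vars (Exists x p) = free_vars p - {x}"

fun formula_holds :: "('r, 'a) rel_struct \<Rightarrow> (nat \<Rightarrow> 'a) \<Rightarrow> 'r formula \<Rightarrow> bool" where
  "formula_holds A s (Atom a) = atom_holds A s a"
| "formula_holds A s (Neg p) = (\<not> formula_holds A s p)"
| "formula_holds A s (Conj p q) = (formula_holds A s p \<and> formula_holds A s q)"
| "formula_holds A s (Exists x p) = (\<exists>a\<in>universe A. formula_holds A (s(x := a)) p)"

definition fo_definable :: "('r, 'a) rel_struct \<Rightarrow> nat \<Rightarrow> 'a list set \<Rightarrow> bool" where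
  "fo_definable A k R \<longleftrightarrow>
     (\<exists>p. formula_wf A p \<and> free_vars p \<subseteq> {..<k} \<and>
        R = {t \<in> tuples (universe A) k. formula_holds A (\<lambda>i. t ! i) p})"

definition fo_reduct :: "('q, 'a) rel_struct \<Rightarrow> ('r, 'a) rel_struct \<Rightarrow> bool" where
  "fo_reduct B A \<longleftrightarrow> universe B = universe A \<and>
     (\<forall>r\<in>sig B. fo_definable A (arity B r) (rel B r))"


section \<open>Operations, clones and height 1 conditions\<close>

text \<open>A set of finitary operations is represented as a family indexed by the arity. An
  operation is extensional, i.e. fixed to be \<^term>\<open>undefined\<close> off its domain, so that equality
  in HOL is equality of operations.\<close>

type_synonym 'a ops = "nat \<Rightarrow> ('a list \<Rightarrow> 'a) set"

definition operations :: "'a set \<Rightarrow> 'a ops" where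
  "operations D n = (if n = 0 then {} else tuples D n \<rightarrow>\<^sub>E D)"

definition proj :: "'a set \<Rightarrow> nat \<Rightarrow> nat \<Rightarrow> 'a list \<Rightarrow> 'a" where
  "proj D n i = restrict (\<lambda>xs. xs ! i) (tuples D n)"

definition compose_op ::
  "'a set \<Rightarrow> nat \<Rightarrow> ('a list \<Rightarrow> 'a) \<Rightarrow> ('a list \<Rightarrow> 'a) list \<Rightarrow> 'a list \<Rightarrow> 'a" where
  "compose_op D m f gs = restrict (\<lambda>xs. f (map (\<lambda>g. g xs) gs)) (tuples D m)"

definition is_clone :: "'a set \<Rightarrow> 'a ops \<Rightarrow> bool" where
  "is_clone D \<A> \<longleftrightarrow>
     (\<forall>n. \<A> n \<subseteq> operations D n) \<and>
     (\<forall>n. \<forall>i<n. proj D n i \<in> \<A> n) \<and>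
     (\<forall>n m f gs. 1 \<le> m \<and> f \<in> \<A> n \<and> length gs = n \<and> set gs \<subseteq> \<A> m \<longrightarrow>
        compose_op D m f gs \<in> \<A> m)"

definition projections :: "'a set \<Rightarrow> 'a ops" where
  "projections D n = {proj D n i | i. i < n}"

abbreviation proj_clone :: "nat ops" where
  "proj_clone \<equiv> projections {0, 1}"

definition power_struct :: "nat \<Rightarrow> ('r, 'a) rel_struct \<Rightarrow> ('r, 'a list) rel_struct" where
  "power_struct n A =
     \<lparr>universe = tuples (universe A) n, sig = sig A, arity = arity A,
      rel = (\<lambda>r. {ts \<in> tuples (tuples (universe A) n) (arity A r).
                    \<forall>i<n. map (\<lambda>t. t ! i) ts \<in> rel A r})\<rparr>"

definition Pol :: "('r, 'a) rel_struct \<Rightarrow> 'a ops" where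
  "Pol A n = {f \<in> operations (universe A) n. homomorphism (power_struct n A) A f}"

text \<open>A function symbol is a name together with an arity. The argument lists of an identity
  are the index sequences \<open>\<pi>(1), \<dots>, \<pi>(n)\<close> and \<open>\<rho>(1), \<dots>, \<rho>(m)\<close> of its variables.\<close>

type_synonym fsym = "nat \<times> nat"

datatype h1_identity =
  H1 (lhs_sym: fsym) (lhs_vars: "nat list") (rhs_sym: fsym) (rhs_vars: "nat list")

definition h1_identity_wf :: "h1_identity \<Rightarrow> bool" where
  "h1_identity_wf e \<longleftrightarrow>
     1 \<le> snd (lhs_sym e) \<and> length (lhs_vars e) = snd (lhs_sym e) \<and>
     1 \<le> snd (rhs_sym e) \<and> length (rhs_vars e) = snd (rhs_sym e)"

definition height1_condition :: "h1_identity set \<Rightarrow> bool" where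
  "height1_condition \<Sigma> \<longleftrightarrow> finite \<Sigma> \<and> (\<forall>e\<in>\<Sigma>. h1_identity_wf e)"

definition satisfies :: "'a set \<Rightarrow> 'a ops \<Rightarrow> h1_identity set \<Rightarrow> bool" where
  "satisfies D \<A> \<Sigma> \<longleftrightarrow>
     (\<exists>I :: fsym \<Rightarrow> 'a list \<Rightarrow> 'a.
        (\<forall>f \<in> lhs_sym ` \<Sigma> \<union> rhs_sym ` \<Sigma>. I f \<in> \<A> (snd f)) \<and>
        (\<forall>e\<in>\<Sigma>. \<forall>s :: nat \<Rightarrow> 'a. range s \<subseteq> D \<longrightarrow>
           I (lhs_sym e) (map s (lhs_vars e)) = I (rhs_sym e) (map s (rhs_vars e))))"

text \<open>Triviality is satisfaction in every clone. HOL cannot quantify over the underlying types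
  inside a definition, so it is stated for the clone of projections on \<open>{0, 1}\<close>; \<open>is_clone_projections\<close>
  and \<open>trivial_condition_in_clone\<close> show that this amounts to satisfaction in every clone.\<close>

definition trivial_condition :: "h1_identity set \<Rightarrow> bool" where
  "trivial_condition \<Sigma> \<longleftrightarrow> satisfies {0, 1} proj_clone \<Sigma>"

lemma proj_in_operations:
  assumes "i < n" shows "proj D n i \<in> operations D n"
proof -
  have "xs ! i \<in> D" if "xs \<in> tuples D n" for xs
    using that assms nth_mem[of i xs] unfolding tuples_def by blast
  then show ?thesis using assms by (auto simp: proj_def operations_def)
qed

lemma is_clone_projections: "is_clone D (projections D)"
proof -
  have "compose_op D m f gs \<in> projections D m"
    if m: "1 \<le> m" and f: "f \<in> projections D n" and l: "length gs = n"
      and gs: "set gs \<subseteq> projections D m" for n m f gs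
  proof -
    obtain i where i: "i < n" "f = proj D n i" using f by (auto simp: projections_def)
    have "gs ! i \<in> projections D m" using gs i l by auto
    then obtain j where j: "j < m" "gs ! i = proj D m j" by (auto simp: projections_def)
    have op: "g \<in> operations D m" if "g \<in> set gs" for g
    proof -
      from gs that have "g \<in> projections D m" by blast
      then show ?thesis by (auto simp: projections_def intro: proj_in_operations)
    qed
    have "compose_op D m f gs = proj D m j"
    proof
      fix xs
      show "compose_op D m f gs xs = proj D m j xs"
      proof (cases "xs \<in> tuples D m")
        case True
        have "g xs \<in> D" if "g \<in> set gs" for g
          using op[OF that] True m PiE_mem unfolding operations_def by (auto split: if_splits)
        then have "map (\<lambda>g. g xs) gs \<in> tuples D n" using l by (auto simp: tuples_def)
        then show ?thesis using True i j l by (simp add: compose_op_def proj_def)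
      qed (simp add: compose_op_def proj_def)
    qed
    then show ?thesis using j by (auto simp: projections_def)
  qed
  moreover have "projections D n \<subseteq> operations D n" for n
    by (auto simp: projections_def intro: proj_in_operations)
  moreover have "proj D n i \<in> projections D n" if "i < n" for n i
    using that by (auto simp: projections_def)
  ultimately show ?thesis unfolding is_clone_def by blast
qed

lemma proj_map:
  assumes "i < n" and "length vs = n" and "range s \<subseteq> D"
  shows "proj D n i (map s vs) = s (vs ! i)"
  using assms by (auto simp: proj_def tuples_def)

lemma trivial_condition_in_clone:
  assumes h: "height1_condition \<Sigma>" and t: "trivial_condition \<Sigma>" and c: "is_clone D \<A>"
  shows "satisfies D \<A> \<Sigma>"
proof -
  let ?S = "lhs_sym ` \<Sigma> \<union> rhs_sym ` \<Sigma>"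
  obtain I where I: "\<forall>f\<in>?S. I f \<in> proj_clone (snd f)"
    and eqs: "\<forall>e\<in>\<Sigma>. \<forall>s. range s \<subseteq> {0, 1} \<longrightarrow>
       I (lhs_sym e) (map s (lhs_vars e)) = I (rhs_sym e) (map s (rhs_vars e))"
    using t unfolding trivial_condition_def satisfies_def by (elim exE conjE)
  have "\<forall>f\<in>?S. \<exists>i. i < snd f \<and> I f = proj {0, 1} (snd f) i"
  proof
    fix f assume "f \<in> ?S"
    then have "I f \<in> proj_clone (snd f)" by (rule I[rule_format])
    then show "\<exists>i. i < snd f \<and> I f = proj {0, 1} (snd f) i"
      unfolding projections_def by blast
  qed
  then obtain k where k: "\<forall>f\<in>?S. k f < snd f \<and> I f = proj {0, 1} (snd f) (k f)"
    by (rule bchoice[THEN exE])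
  let ?J = "\<lambda>f. proj D (snd f) (k f)"
  have "?J (lhs_sym e) (map s (lhs_vars e)) = ?J (rhs_sym e) (map s (rhs_vars e))"
    if e: "e \<in> \<Sigma>" and s: "range s \<subseteq> D" for e s
  proof -
    let ?u = "lhs_vars e ! k (lhs_sym e)" and ?v = "rhs_vars e ! k (rhs_sym e)"
    have w: "length (lhs_vars e) = snd (lhs_sym e)" "length (rhs_vars e) = snd (rhs_sym e)"
      using h e by (auto simp: height1_condition_def h1_identity_wf_def)
    have kl: "k (lhs_sym e) < snd (lhs_sym e)"
        "I (lhs_sym e) = proj {0, 1} (snd (lhs_sym e)) (k (lhs_sym e))"
      using k[rule_format, of "lhs_sym e"] e by simp_all
    have kr: "k (rhs_sym e) < snd (rhs_sym e)"
        "I (rhs_sym e) = proj {0, 1} (snd (rhs_sym e)) (k (rhs_sym e))"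
      using k[rule_format, of "rhs_sym e"] e by simp_all
    define d where "d = (\<lambda>x. if x = ?u then 1 else 0 :: nat)"
    have d: "range d \<subseteq> {0, 1}" by (auto simp: d_def)
    have "I (lhs_sym e) (map d (lhs_vars e)) = I (rhs_sym e) (map d (rhs_vars e))"
      using eqs[rule_format, OF e d] .
    then have "d ?u = d ?v"
      unfolding kl(2) kr(2) proj_map[OF kl(1) w(1) d] proj_map[OF kr(1) w(2) d] .
    then have "?u = ?v" by (simp add: d_def split: if_splits)
    then show ?thesis unfolding proj_map[OF kl(1) w(1) s] proj_map[OF kr(1) w(2) s] by simp
  qed
  moreover have "?J f \<in> \<A> (snd f)" if "f \<in> ?S" for f
    using c k[rule_format, OF that] unfolding is_clone_def by simp
  ultimately show ?thesis unfolding satisfies_def by (intro exI[of _ ?J]) simp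
qed

definition minor ::
  "'a set \<Rightarrow> nat \<Rightarrow> nat \<Rightarrow> (nat \<Rightarrow> nat) \<Rightarrow> ('a list \<Rightarrow> 'a) \<Rightarrow> 'a list \<Rightarrow> 'a" where
  "minor D n k \<pi> f = restrict (\<lambda>xs. f (map (\<lambda>i. xs ! \<pi> i) [0..<n])) (tuples D k)"

definition minion_homomorphism ::
  "'a set \<Rightarrow> 'a ops \<Rightarrow> 'b set \<Rightarrow> 'b ops \<Rightarrow> (nat \<Rightarrow> ('a list \<Rightarrow> 'a) \<Rightarrow> 'b list \<Rightarrow> 'b) \<Rightarrow> bool" where
  "minion_homomorphism D \<A> E \<B> \<xi> \<longleftrightarrow>
     (\<forall>n\<ge>1. \<forall>f\<in>\<A> n. \<xi> n f \<in> \<B> n) \<and>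
     (\<forall>n\<ge>1. \<forall>k\<ge>1. \<forall>f\<in>\<A> n. \<forall>\<pi> \<in> {..<n} \<rightarrow> {..<k}.
        \<xi> k (minor D n k \<pi> f) = minor E n k \<pi> (\<xi> n f))"


section \<open>Polynomial time\<close>

text \<open>Deterministic Turing machines with any fixed number of two-way infinite tapes. States and
  tape symbols are initial segments of the natural numbers; 0 is the blank. The input is written
  on tape 0, from position 0 on.\<close>

datatype dir = MoveLeft | Stay | MoveRight

record turing_machine =
  num_tapes :: nat
  num_states :: nat
  num_symbols :: nat
  start_state :: nat
  accept_state :: nat
  reject_state :: nat
  delta :: "nat \<Rightarrow> nat list \<Rightarrow> nat \<times> (nat \<times> dir) list"

definition tm_wf :: "turing_machine \<Rightarrow> bool" where
  "tm_wf M \<longleftrightarrow> 1 \<le> num_tapes M \<and> 1 \<le> num_symbols M \<and>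
     start_state M < num_states M \<and> accept_state M < num_states M \<and>
     reject_state M < num_states M \<and> accept_state M \<noteq> reject_state M \<and>
     (\<forall>q < num_states M. \<forall>xs \<in> tuples {..<num_symbols M} (num_tapes M).
        fst (delta M q xs) < num_states M \<and>
        length (snd (delta M q xs)) = num_tapes M \<and>
        fst ` set (snd (delta M q xs)) \<subseteq> {..<num_symbols M})"

type_synonym tape = "(int \<Rightarrow> nat) \<times> int"
type_synonym config = "nat \<times> tape list"

fun move :: "dir \<Rightarrow> int \<Rightarrow> int" where
  "move MoveLeft p = p - 1"
| "move Stay p = p"
| "move MoveRight p = p + 1"

fun tape_act :: "nat \<times> dir \<Rightarrow> tape \<Rightarrow> tape" where
  "tape_act (a, d) (t, p) = (t(p := a), move d p)"

definition tm_step :: "turing_machine \<Rightarrow> config \<Rightarrow> config" where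
  "tm_step M c =
     (if fst c = accept_state M \<or> fst c = reject_state M then c
      else let (q, acts) = delta M (fst c) (map (\<lambda>(t, p). t p) (snd c))
           in (q, map2 tape_act acts (snd c)))"

definition input_tape :: "nat list \<Rightarrow> tape" where
  "input_tape w = ((\<lambda>i. if 0 \<le> i \<and> i < int (length w) then w ! nat i else 0), 0)"

definition tm_init :: "turing_machine \<Rightarrow> nat list \<Rightarrow> config" where
  "tm_init M w = (start_state M, input_tape w # replicate (num_tapes M - 1) (input_tape []))"

definition poly_time_decidable :: "nat set \<Rightarrow> nat list set \<Rightarrow> bool" where
  "poly_time_decidable \<Gamma> L \<longleftrightarrow>
     (\<exists>M c d. tm_wf M \<and> \<Gamma> \<subseteq> {1..<num_symbols M} \<and>
        (\<forall>w \<in> lists \<Gamma>.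
           fst ((tm_step M ^^ (c * length w ^ d + c)) (tm_init M w)) =
             (if w \<in> L then accept_state M else reject_state M)))"


section \<open>Constraint satisfaction problems\<close>

definition csp_instance :: "('r, 'a) rel_struct \<Rightarrow> 'r atom list \<Rightarrow> bool" where
  "csp_instance B \<Phi> \<longleftrightarrow> (\<forall>a\<in>set \<Phi>. atom_wf B a)"

definition csp_satisfiable :: "('r, 'a) rel_struct \<Rightarrow> 'r atom list \<Rightarrow> bool" where
  "csp_satisfiable B \<Phi> \<longleftrightarrow>
     (\<exists>s. range s \<subseteq> universe B \<and> (\<forall>a\<in>set \<Phi>. atom_holds B s a))"

text \<open>Instances are written over the alphabet \<open>{1, \<dots>, 5}\<close>: 1 and 2 are the binary digits 0 and 1
  (numbers are written with the least significant digit first), 3 precedes a variable, 4 opens a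
  relational atom and 5 opens an equation.\<close>

fun binary :: "nat \<Rightarrow> nat list" where
  "binary n = (if n = 0 then [] else (if even n then 1 else 2) # binary (n div 2))"

declare binary.simps [simp del]

fun encode_atom :: "nat atom \<Rightarrow> nat list" where
  "encode_atom (ARel r xs) = 4 # binary r @ concat (map (\<lambda>x. 3 # binary x) xs)"
| "encode_atom (AEq x y) = 5 # 3 # binary x @ 3 # binary y"

definition encode_instance :: "nat atom list \<Rightarrow> nat list" where
  "encode_instance \<Phi> = concat (map encode_atom \<Phi>)"

definition CSP :: "(nat, 'a) rel_struct \<Rightarrow> nat list set" where
  "CSP B = {encode_instance \<Phi> | \<Phi>. csp_instance B \<Phi> \<and> csp_satisfiable B \<Phi>}"

definition csp_poly_time :: "(nat, 'a) rel_struct \<Rightarrow> bool" where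
  "csp_poly_time B \<longleftrightarrow> finite (sig B) \<and> poly_time_decidable {1..5} (CSP B)"

end

theory Submission
  imports Defs "HOL-Library.Countable" "HOL-Library.Nat_Bijection"
begin

text \<open>
  Let \<open>f\<^sub>0, \<dots>, f\<^sub>r\<^sub>-\<^sub>1\<close> be the symbols of a minimal non-trivial condition. Let \<open>F\<close> be the finite
      structure
  whose vertices are the terms \<open>f\<^sub>j(a)\<close>, for \<open>a\<close> a tuple over \<open>{0, 1}\<close>, modulo the identities,
      and which has
  one relation for each \<open>j\<close>, consisting of the single tuple of all \<open>f\<^sub>j(a)\<close>. Let \<open>T\<close> be the
      structure on
  \<open>{0, 1}\<close> whose \<open>j\<close>-th relation consists of the tables of the projections. Then \<open>F\<close> has no
      homomorphism to
  \<open>T\<close>, since the condition is non-trivial. Let \<open>B\<close> be a countable structure to which a countable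
      structure
  maps if and only if \<open>F\<close> does not map to it. Then \<open>T\<close> maps to \<open>B\<close>,
      and polymorphisms of \<open>B\<close> that satisfy
  the condition would map \<open>F\<close> to \<open>B\<close>, which is impossible.

  On the other hand, \<open>B\<close> has quasi Hagemann--Mitschke polymorphisms \<open>g\<^sub>0, \<dots>, g\<^sub>r\<close>:
      if \<open>F\<close> mapped to the free
  structure over \<open>B\<close> generated by such operations, then its \<open>r\<close> tuples would use at most \<open>r\<close> of the
  \<open>r + 1\<close> symbols, so some \<open>g\<^sub>m\<close> would be missing, and interpreting \<open>g\<^sub>k\<close> by the third projection
      for \<open>k < m\<close>
  and by the first one for \<open>k > m\<close> would map \<open>F\<close> to \<open>B\<close>.

  A homogeneous expansion of \<open>B\<close> is the Fraisse limit of a class defined by finitely many universal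
  sentences, which axiomatise the primitive positive formulas
      for the parts of \<open>F\<close>. For \<open>CSP(B)\<close> it suffices
  to eliminate the equations by substitution and to search for a copy of \<open>F\<close>.
\<close>

section \<open>A while language for Turing machines\<close>

text \<open>Forbidding \<open>F\<close> alone does not give amalgamation, because a copy of
  \<open>F\<close> can be assembled from parts lying in different factors. The extra symbols record
  which boundary tuples of a set of edges are declared extendable. They only have to contain the
  primitive positive relations, not to equal them. This keeps the axioms universal and free of
  inequalities; a copy of \<open>F\<close> would force the formula for the set of all edges, which
  is false by decree.

  Minimality of the condition serves to make \<open>F\<close> connected. Every proper set of edges
  then has a nonempty boundary, so the extra symbols have positive arity.

  The number r + 1 comes from a pigeonhole: a tuple of the free structure uses one operation symbol.
  The chain of identities forces the third projection when followed from one end and the first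
  projection from the other; deleting a single symbol removes the conflict.

  Polynomial time refers to Turing machines. The algorithm is therefore composed of combinators,
  each of which carries a program together with a size and a time bound.\<close>

datatype com =
    Skip
  | Act nat "nat option" dir
  | Seq com com
  | Cond nat "nat \<Rightarrow> bool" com com
  | Loop nat "nat \<Rightarrow> bool" com

definition reads :: "tape list \<Rightarrow> nat list" where
  "reads ts = map (\<lambda>(t, p). t p) ts"

text \<open>Reduction modulo 6 keeps every program, without any side condition, inside the alphabet
  of the machine.\<close>

definition do_act :: "nat \<Rightarrow> nat option \<Rightarrow> dir \<Rightarrow> tape list \<Rightarrow> tape list" where
  "do_act r w d ts =
     ts[r := tape_act (case w of None \<Rightarrow> reads ts ! r | Some a \<Rightarrow> a mod 6, d) (ts ! r)]"

fun next_cont :: "com list \<Rightarrow> nat list \<Rightarrow> com list" where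
  "next_cont [] xs = []"
| "next_cont (Skip # k) xs = k"
| "next_cont (Act r w d # k) xs = k"
| "next_cont (Seq c d # k) xs = c # d # k"
| "next_cont (Cond r P c d # k) xs = (if P (xs ! r) then c else d) # k"
| "next_cont (Loop r P c # k) xs = (if P (xs ! r) then c # Loop r P c # k else k)"

fun next_tapes :: "com list \<Rightarrow> tape list \<Rightarrow> tape list" where
  "next_tapes (Act r w d # k) ts = do_act r w d ts"
| "next_tapes _ ts = ts"

definition cstep :: "com list \<times> tape list \<Rightarrow> com list \<times> tape list" where
  "cstep c = (next_cont (fst c) (reads (snd c)), next_tapes (fst c) (snd c))"

text \<open>Only finitely many continuations are reachable from a program, so they can serve as the
  states of a Turing machine.\<close>

fun conts :: "com \<Rightarrow> com list \<Rightarrow> com list set" where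
  "conts Skip k = {Skip # k}"
| "conts (Act r w d) k = {Act r w d # k}"
| "conts (Seq c d) k = {Seq c d # k} \<union> conts c (d # k) \<union> conts d k"
| "conts (Cond r P c d) k = {Cond r P c d # k} \<union> conts c k \<union> conts d k"
| "conts (Loop r P c) k = {Loop r P c # k} \<union> conts c (Loop r P c # k)"

lemma finite_conts: "finite (conts c k)"
  by (induction c arbitrary: k) auto

lemma conts_start: "c # k \<in> conts c k"
  by (cases c) auto

lemma conts_closed: "q \<in> conts c k \<Longrightarrow> next_cont q xs \<in> conts c k \<union> {k}"
proof (induction c arbitrary: k)
  case (Seq c d)
  then consider "q = Seq c d # k" | "q \<in> conts c (d # k)" | "q \<in> conts d k" by auto
  then show ?case
  proof cases
    case 2
    then show ?thesis using Seq.IH(1)[of "d # k"] conts_start[of d k] by auto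
  qed (use Seq conts_start in auto)
next
  case (Cond r P c d)
  then show ?case using conts_start by auto
next
  case (Loop r P c)
  then consider "q = Loop r P c # k" | "q \<in> conts c (Loop r P c # k)" by auto
  then show ?case
  proof cases
    case 2
    then show ?thesis using Loop.IH[of "Loop r P c # k"] by auto
  qed (use conts_start in auto)
qed auto

definition tape_acts :: "com list \<Rightarrow> nat list \<Rightarrow> (nat \<times> dir) list" where
  "tape_acts k xs = (case k of
      Act r w d # _ \<Rightarrow>
        map (\<lambda>i. if i = r then (case w of None \<Rightarrow> xs ! i | Some a \<Rightarrow> a mod 6, d) else (xs ! i, Stay))
          [0..<length xs]
    | _ \<Rightarrow> map (\<lambda>a. (a, Stay)) xs)"

lemma tape_act_Stay: "tape_act (reads ts ! i, Stay) (ts ! i) = ts ! i" if "i < length ts"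
  using that by (cases "ts ! i") (simp add: reads_def)

lemma next_tapes_eq: "next_tapes k ts = map2 tape_act (tape_acts k (reads ts)) ts"
proof -
  have id: "map2 tape_act (map (\<lambda>a. (a, Stay)) (reads ts)) ts = ts"
    by (rule nth_equalityI) (auto simp: reads_def split: prod.split)
  show ?thesis
  proof (cases "\<exists>r w d k'. k = Act r w d # k'")
    case True
    then obtain r w d k' where k: "k = Act r w d # k'" by blast
    have l: "length (reads ts) = length ts" by (simp add: reads_def)
    show ?thesis
      unfolding k tape_acts_def
      by (rule nth_equalityI)
        (auto simp: do_act_def l nth_list_update tape_act_Stay split: option.splits)
  next
    case False
    then have "next_tapes k ts = ts" "tape_acts k (reads ts) = map (\<lambda>a. (a, Stay)) (reads ts)"
      by (cases k; cases "hd k"; auto simp: tape_acts_def)+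
    then show ?thesis using id by simp
  qed
qed

lemma length_tape_acts: "length (tape_acts k xs) = length xs"
  by (auto simp: tape_acts_def split: list.splits com.splits)

lemma tape_acts_symbols:
  "set xs \<subseteq> {..<6} \<Longrightarrow> fst ` set (tape_acts k xs) \<subseteq> {..<6}"
  using nth_mem[of _ xs]
  by (fastforce simp: tape_acts_def split: list.splits com.splits option.splits)

definition init_tapes :: "nat list \<Rightarrow> tape list" where
  "init_tapes w = input_tape w # replicate 4 (input_tape [])"

lemma poly_time_decidable_com:
  assumes run: "\<And>w. w \<in> lists {1..5} \<Longrightarrow> \<exists>t ts. t \<le> c * length w ^ d + c \<and>
      (cstep ^^ t) ([prog], init_tapes w) = ([], ts) \<and> (reads ts ! 0 = 2 \<longleftrightarrow> w \<in> L)"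
  shows "poly_time_decidable {1..5} L"
proof -
  define Q where "Q = conts prog [] \<union> {[]}"
  have finQ: "finite Q" by (simp add: Q_def finite_conts)
  have closed: "next_cont q xs \<in> Q" if "q \<in> Q" for q xs
    using that conts_closed[of q prog "[]" xs] by (auto simp: Q_def)
  obtain num n where num: "num ` Q = {i. i < (n::nat)}" "inj_on num Q"
    using finite_imp_inj_to_nat_seg[OF finQ] by auto
  \<comment> \<open>0 and 1 are kept for acceptance and rejection, hence the shift by 2.\<close>
  define st where "st q = num q + 2" for q
  define dec where "dec i = inv_into Q num (i - 2)" for i
  have dec: "dec (st q) = q" if "q \<in> Q" for q
    using that num by (simp add: dec_def st_def)
  have decQ: "dec i \<in> Q" if "2 \<le> i" "i < n + 2" for i
  proof -
    have "i - 2 \<in> num ` Q" using num that by auto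
    then show ?thesis unfolding dec_def by (rule inv_into_into)
  qed
  have st: "2 \<le> st q" "st q < n + 2" if "q \<in> Q" for q
    using num(1) that by (auto simp: st_def)
  define M where "M = \<lparr>num_tapes = 5, num_states = n + 2, num_symbols = 6, start_state = st [prog],
     accept_state = 0, reject_state = 1,
     delta = (\<lambda>i xs. if i < 2 then (i, map (\<lambda>a. (a, Stay)) xs)
        else (if dec i = [] then (if xs ! 0 = 2 then 0 else 1) else st (next_cont (dec i) xs),
              tape_acts (dec i) xs))\<rparr>"
  have pQ: "[prog] \<in> Q" using conts_start[of prog "[]"] by (simp add: Q_def)
  have wf: "tm_wf M"
  proof -
    have "fst (delta M q xs) < n + 2 \<and> length (snd (delta M q xs)) = 5 \<and>
        fst ` set (snd (delta M q xs)) \<subseteq> {..<6}"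
      if "q < n + 2" "xs \<in> tuples {..<6} 5" for q xs
    proof (cases "q < 2")
      case True
      then show ?thesis using that by (auto simp: M_def tuples_def)
    next
      case False
      then have "dec q \<in> Q" using decQ that by auto
      then show ?thesis
        using False that closed st tape_acts_symbols[of xs "dec q"]
        by (auto simp: M_def tuples_def length_tape_acts)
    qed
    then show ?thesis using st[OF pQ] by (auto simp: tm_wf_def M_def)
  qed
  have step: "tm_step M (st q, ts) = (st (fst (cstep (q, ts))), snd (cstep (q, ts)))"
    if "q \<in> Q" "q \<noteq> []" for q ts
    using that st[of q] dec[of q]
    by (simp add: tm_step_def M_def cstep_def next_tapes_eq reads_def)
  have inQ: "fst ((cstep ^^ t) ([prog], ts)) \<in> Q" for t ts
    by (induction t) (auto simp: cstep_def pQ intro: closed)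
  have Nil_stay: "(cstep ^^ t) ([], ts) = ([], ts)" for t ts
    by (induction t) (auto simp: cstep_def)
  \<comment> \<open>Only \<open>t' \<le> t\<close>, because \<open>cstep\<close> idles on the empty
    continuation whereas the machine moves on.\<close>
  have sim: "\<exists>t'\<le>t. (tm_step M ^^ t') (st [prog], ts) = (st q, ts')"
    if "(cstep ^^ t) ([prog], ts) = (q, ts')" for t ts q ts'
    using that
  proof (induction t arbitrary: q ts')
    case 0
    then show ?case by auto
  next
    case (Suc t)
    obtain q1 ts1 where 1: "(cstep ^^ t) ([prog], ts) = (q1, ts1)" by fastforce
    then obtain t' where t': "t' \<le> t" "(tm_step M ^^ t') (st [prog], ts) = (st q1, ts1)"
      using Suc.IH by blast
    show ?case
    proof (cases "q1 = []")
      case True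
      then have "cstep (q1, ts1) = ([], ts1)" by (simp add: cstep_def)
      then have "q = []" "ts' = ts1" using Suc.prems 1 by auto
      then show ?thesis using t' True by (intro exI[of _ t']) auto
    next
      case False
      have "q1 \<in> Q" using inQ[of t ts] 1 by simp
      then have "tm_step M (st q1, ts1) = (st q, ts')"
        using step[OF _ False, of ts1] Suc.prems 1 by simp
      then show ?thesis using t' by (intro exI[of _ "Suc t'"]) simp
    qed
  qed
  have halt: "(tm_step M ^^ m) (i, ts) = (i, ts)" if "i < 2" for m i ts
    using that by (induction m) (auto simp: tm_step_def M_def)
  \<comment> \<open>The empty continuation is one more state, whose only step inspects tape 0. The
    bound \<open>c + 1\<close> pays for this step.\<close>
  have fin: "fst ((tm_step M ^^ Suc m) (st [], ts)) = (if reads ts ! 0 = 2 then 0 else 1)"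
    for m ts
  proof -
    have "[] \<in> Q" by (simp add: Q_def)
    then have "\<exists>ts'. tm_step M (st [], ts) = (if reads ts ! 0 = 2 then 0 else 1, ts')"
      using st[of "[]"] dec[of "[]"] by (auto simp: tm_step_def M_def reads_def)
    then show ?thesis using halt by (auto simp: funpow_Suc_right simp del: funpow.simps)
  qed
  have "fst ((tm_step M ^^ ((c + 1) * length w ^ d + (c + 1))) (tm_init M w)) =
      (if w \<in> L then accept_state M else reject_state M)" if w: "w \<in> lists {1..5}" for w
  proof -
    let ?T = "(c + 1) * length w ^ d + (c + 1)"
    obtain t ts where t: "t \<le> c * length w ^ d + c"
      "(cstep ^^ t) ([prog], init_tapes w) = ([], ts)" "reads ts ! 0 = 2 \<longleftrightarrow> w \<in> L"
      using run[OF w] by blast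
    obtain t' where t': "t' \<le> t" "(tm_step M ^^ t') (st [prog], init_tapes w) = (st [], ts)"
      using sim[OF t(2)] by blast
    have "t' < ?T" using t'(1) t(1) by (simp add: algebra_simps)
    then obtain m where m: "?T = Suc m + t'" by (metis add.commute less_imp_Suc_add add_Suc)
    have "tm_init M w = (st [prog], init_tapes w)"
      by (simp add: tm_init_def M_def init_tapes_def)
    then have "(tm_step M ^^ ?T) (tm_init M w) = (tm_step M ^^ Suc m) (st [], ts)"
      unfolding m funpow_add using t' by simp
    then show ?thesis using fin[of m ts] t(3) by (simp add: M_def del: funpow.simps)
  qed
  then show ?thesis
    unfolding poly_time_decidable_def using wf
    by (intro exI[of _ M] exI[of _ "c + 1"] exI[of _ d]) (auto simp: M_def)
qed


section \<open>Stack programs\<close>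

type_synonym store = "nat \<Rightarrow> nat list"

definition pad :: "nat list \<Rightarrow> nat \<Rightarrow> nat" where
  "pad xs n = (if n < length xs then xs ! n else 0)"

text \<open>A stack occupies the cells from the head position to the right; the cells to the left of the
  head are garbage.\<close>

definition rep :: "tape list \<Rightarrow> store \<Rightarrow> bool" where
  "rep ts s \<longleftrightarrow> length ts = 5 \<and>
     (\<forall>i<5. \<forall>n. fst (ts ! i) (snd (ts ! i) + int n) = pad (s i) n)"

definition top :: "nat list \<Rightarrow> nat" where
  "top xs = (case xs of [] \<Rightarrow> 0 | x # _ \<Rightarrow> x)"

lemma top_simps [simp]: "top [] = 0" "top (x # xs) = x"
  by (simp_all add: top_def)

text \<open>A total correctness triple with a time bound. The arbitrary continuation
  \<open>k\<close> makes it compositional.\<close>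

definition run :: "com \<Rightarrow> store \<Rightarrow> nat \<Rightarrow> store \<Rightarrow> bool" where
  "run c s T s' \<longleftrightarrow> (\<forall>ts k. rep ts s \<longrightarrow>
     (\<exists>t\<le>T. \<exists>ts'. rep ts' s' \<and> (cstep ^^ t) (c # k, ts) = (k, ts')))"

lemma run_mono: "run c s T s' \<Longrightarrow> T \<le> T' \<Longrightarrow> run c s T' s'"
  unfolding run_def by (meson order_trans)

lemma reads_rep: "rep ts s \<Longrightarrow> r < 5 \<Longrightarrow> reads ts ! r = top (s r)"
proof -
  assume "rep ts s" "r < 5"
  then have l: "length ts = 5" and "fst (ts ! r) (snd (ts ! r) + int 0) = pad (s r) 0"
    unfolding rep_def by blast+
  then show ?thesis
    using \<open>r < 5\<close> by (cases "s r") (auto simp: reads_def pad_def split: prod.split)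
qed

lemma run_Skip: "run Skip s 1 s"
  unfolding run_def by (auto intro!: exI[of _ 1] simp: cstep_def)

lemma run_Seq:
  assumes "run c s T1 s'" "run d s' T2 s''"
  shows "run (Seq c d) s (1 + T1 + T2) s''"
  unfolding run_def
proof (intro allI impI)
  fix ts k assume "rep ts s"
  then obtain t1 ts1 where 1: "t1 \<le> T1" "rep ts1 s'" "(cstep ^^ t1) (c # d # k, ts) = (d # k, ts1)"
    using assms(1) unfolding run_def by blast
  then obtain t2 ts2 where 2: "t2 \<le> T2" "rep ts2 s''" "(cstep ^^ t2) (d # k, ts1) = (k, ts2)"
    using assms(2) unfolding run_def by blast
  have "(cstep ^^ (t2 + (t1 + 1))) (Seq c d # k, ts) = (k, ts2)"
    unfolding funpow_add using 1 2 by (simp add: cstep_def)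
  then show "\<exists>t\<le>1 + T1 + T2. \<exists>ts'. rep ts' s'' \<and> (cstep ^^ t) (Seq c d # k, ts) = (k, ts')"
    using 1 2 by (intro exI[of _ "t2 + (t1 + 1)"]) auto
qed

lemma run_step:
  assumes "\<And>ts k. rep ts s \<Longrightarrow> cstep (c # k, ts) = (c' # k, ts)" and "run c' s T s'"
  shows "run c s (1 + T) s'"
  unfolding run_def
proof (intro allI impI)
  fix ts k assume r: "rep ts s"
  then obtain t ts' where t: "t \<le> T" "rep ts' s'" "(cstep ^^ t) (c' # k, ts) = (k, ts')"
    using assms(2) unfolding run_def by blast
  have "(cstep ^^ (t + 1)) (c # k, ts) = (k, ts')"
    unfolding funpow_add using t assms(1)[OF r] by simp
  then show "\<exists>t\<le>1 + T. \<exists>ts'. rep ts' s' \<and> (cstep ^^ t) (c # k, ts) = (k, ts')"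
    using t by (intro exI[of _ "t + 1"]) auto
qed

lemma run_Cond:
  assumes "r < 5" and "P (top (s r)) \<Longrightarrow> run c s T s'" and "\<not> P (top (s r)) \<Longrightarrow> run d s T s'"
  shows "run (Cond r P c d) s (1 + T) s'"
  by (rule run_step[where c' = "if P (top (s r)) then c else d"])
    (use assms in \<open>auto simp: cstep_def reads_rep\<close>)

lemma run_Loop_False:
  assumes "r < 5" and "\<not> P (top (s r))"
  shows "run (Loop r P c) s 1 s"
  unfolding run_def using assms by (auto intro!: exI[of _ 1] simp: cstep_def reads_rep)

lemma run_Loop_True:
  assumes "r < 5" and "P (top (s r))" and "run c s T1 s'" and "run (Loop r P c) s' T2 s''"
  shows "run (Loop r P c) s (1 + T1 + T2) s''"
  unfolding run_def
proof (intro allI impI)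
  fix ts k assume r: "rep ts s"
  then obtain t1 ts1 where
    1: "t1 \<le> T1" "rep ts1 s'" "(cstep ^^ t1) (c # Loop r P c # k, ts) = (Loop r P c # k, ts1)"
    using assms(3) unfolding run_def by blast
  then obtain t2 ts2 where
    2: "t2 \<le> T2" "rep ts2 s''" "(cstep ^^ t2) (Loop r P c # k, ts1) = (k, ts2)"
    using assms(4) unfolding run_def by blast
  have "(cstep ^^ (t2 + (t1 + 1))) (Loop r P c # k, ts) = (k, ts2)"
    unfolding funpow_add using 1 2 assms r by (simp add: cstep_def reads_rep)
  then show "\<exists>t\<le>1 + T1 + T2. \<exists>ts'. rep ts' s'' \<and> (cstep ^^ t) (Loop r P c # k, ts) = (k, ts')"
    using 1 2 by (intro exI[of _ "t2 + (t1 + 1)"]) auto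
qed

definition pop :: "nat \<Rightarrow> com" where
  "pop r = Act r None MoveRight"

definition push :: "nat \<Rightarrow> nat \<Rightarrow> com" where
  "push r a = Seq (Act r None MoveLeft) (Act r (Some a) Stay)"

lemma run_pop:
  assumes "r < 5"
  shows "run (pop r) s 1 (s(r := tl (s r)))"
  unfolding run_def
proof (intro allI impI)
  fix ts k assume rp: "rep ts s"
  obtain t p where tp: "ts ! r = (t, p)" by fastforce
  have l: "length ts = 5" using rp by (simp add: rep_def)
  have "t (p + int n) = pad (s r) n" for n
    using rp assms tp unfolding rep_def by (metis fst_conv snd_conv)
  from this[of "Suc _"] have "t (p + 1 + int n) = pad (tl (s r)) n" for n
    by (simp add: algebra_simps) (auto simp: pad_def nth_tl)
  then have "rep (ts[r := (t, p + 1)]) (s(r := tl (s r)))"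
    using rp by (auto simp: rep_def nth_list_update)
  moreover have "cstep (pop r # k, ts) = (k, ts[r := (t, p + 1)])"
    using assms tp l by (simp add: cstep_def pop_def do_act_def reads_def)
  ultimately show "\<exists>t\<le>1. \<exists>ts'. rep ts' (s(r := tl (s r))) \<and> (cstep ^^ t) (pop r # k, ts) = (k, ts')"
    by (intro exI[of _ 1]) auto
qed

text \<open>The cell to the left of the head is garbage, so it may be overwritten after the move.
  The three steps are the unfolding of \<open>Seq\<close> and the two actions.\<close>

lemma run_push:
  assumes "r < 5" and "a < 6"
  shows "run (push r a) s 3 (s(r := a # s r))"
  unfolding run_def
proof (intro allI impI)
  fix ts k assume rp: "rep ts s"
  obtain t p where tp: "ts ! r = (t, p)" by fastforce
  have l: "length ts = 5" using rp by (simp add: rep_def)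
  have t: "t (p + int n) = pad (s r) n" for n
    using rp assms tp unfolding rep_def by (metis fst_conv snd_conv)
  have "(t(p - 1 := a)) (p - 1 + int n) = pad (a # s r) n" for n
    using t[of "n - 1"] by (cases n) (auto simp: pad_def algebra_simps)
  then have "rep (ts[r := (t(p - 1 := a), p - 1)]) (s(r := a # s r))"
    using rp by (auto simp: rep_def nth_list_update)
  moreover have "(cstep ^^ 3) (push r a # k, ts) = (k, ts[r := (t(p - 1 := a), p - 1)])"
    using assms tp l by (simp add: numeral_3_eq_3 cstep_def push_def do_act_def reads_def)
  ultimately show "\<exists>t\<le>3. \<exists>ts'. rep ts' (s(r := a # s r)) \<and>
      (cstep ^^ t) (push r a # k, ts) = (k, ts')"
    by (intro exI[of _ 3]) auto
qed

section \<open>Polynomial time functions on encoded data\<close>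

lemma run_conv: "run c s T s1 \<Longrightarrow> s1 = s2 \<Longrightarrow> T \<le> T' \<Longrightarrow> run c s T' s2"
  using run_mono by blast

fun pushes :: "nat list \<Rightarrow> nat \<Rightarrow> com" where
  "pushes [] a = Skip"
| "pushes (y # ys) a = Seq (push y a) (pushes ys a)"

lemma run_pushes:
  assumes "distinct ys" "set ys \<subseteq> {..<5}" "a < 6"
  shows "run (pushes ys a) s (4 * length ys + 1) (\<lambda>i. if i \<in> set ys then a # s i else s i)"
  using assms
proof (induction ys arbitrary: s)
  case (Cons y ys)
  show ?case
    unfolding pushes.simps
    by (rule run_conv[OF run_Seq[OF run_push Cons.IH]]) (use Cons.prems in auto)
qed (simp add: run_Skip[simplified])

text \<open>One primitive for three tasks: moving reverses, several targets copy, and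
  \<open>ys = []\<close> erases.\<close>

definition mv :: "nat \<Rightarrow> nat list \<Rightarrow> com" where
  "mv r ys = Loop r (\<lambda>a. a \<noteq> 0)
     (Seq (Cond r (\<lambda>a. a = 2) (pushes ys 2) (pushes ys 1)) (pop r))"

lemma run_mv:
  assumes "r < 5" "r \<notin> set ys" "distinct ys" "set ys \<subseteq> {..<5}" "set (s r) \<subseteq> {1, 2}"
  shows "run (mv r ys) s ((4 * length ys + 5) * length (s r) + 1)
    (\<lambda>i. if i = r then [] else if i \<in> set ys then rev (s r) @ s i else s i)"
  using assms(5)
proof (induction "s r" arbitrary: s)
  case Nil
  then show ?case
    unfolding mv_def using assms(1) by (intro run_conv[OF run_Loop_False]) auto
next
  case (Cons a xs)
  let ?s1 = "\<lambda>i. if i \<in> set ys then a # s i else s i"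
  let ?s2 = "?s1(r := tl (?s1 r))"
  have a: "a = 1 \<or> a = 2" using Cons by (metis insert_iff list.set(2) singletonD subsetD empty_iff)
  have r2: "?s2 r = xs" using Cons.hyps(2) assms(2) by (simp flip: Cons.hyps(2))
  have 1: "run (Cond r (\<lambda>a. a = 2) (pushes ys 2) (pushes ys 1)) s (1 + (4 * length ys + 1)) ?s1"
    by (rule run_Cond) (use assms a run_pushes[of ys a s] Cons.hyps(2)[symmetric] in auto)
  have 2: "run (Loop r (\<lambda>a. a \<noteq> 0) (Seq (Cond r (\<lambda>a. a = 2) (pushes ys 2) (pushes ys 1)) (pop r)))
     ?s2 ((4 * length ys + 5) * length xs + 1)
     (\<lambda>i. if i = r then [] else if i \<in> set ys then rev xs @ ?s2 i else ?s2 i)"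
  proof -
    have "set (?s2 r) \<subseteq> {1, 2}"
      unfolding r2 using Cons.prems unfolding Cons.hyps(2)[symmetric] by auto
    from Cons.hyps(1)[of ?s2, OF r2[symmetric] this] show ?thesis unfolding mv_def r2 .
  qed
  show ?case
    unfolding mv_def
    by (rule run_conv[OF run_Loop_True[OF assms(1) _ run_Seq[OF 1 run_pop[OF assms(1)]] 2]])
      (use a assms(2) in \<open>auto simp flip: Cons.hyps(2)\<close>)
qed

section \<open>Trees as a common data format, and stack programs that handle them\<close>

datatype tree = Lf | Nd tree tree

fun code :: "tree \<Rightarrow> nat list" where
  "code Lf = [1]"
| "code (Nd a b) = 2 # code a @ code b"

lemma set_code: "set (code t) \<subseteq> {1, 2}"
  by (induction t) auto

lemma code_ne [simp]: "code t \<noteq> []"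
  by (cases t) auto

text \<open>The preorder word of a tree delimits itself, so codes can be stacked without
  separators.\<close>

lemma code_prefix: "code t @ xs = code u @ ys \<Longrightarrow> t = u \<and> xs = ys"
proof (induction t arbitrary: u xs ys)
  case Lf
  then show ?case by (cases u) auto
next
  case (Nd a b)
  obtain c d where u: "u = Nd c d" using Nd.prems by (cases u) auto
  then have "code a @ code b @ xs = code c @ code d @ ys" using Nd.prems by simp
  then show ?case using Nd.IH u by blast
qed

lemma code_inject: "code t = code u \<longleftrightarrow> t = u"
  using code_prefix[of t "[]" u "[]"] by auto

text \<open>Register 4 counts the subtrees that remain to be read.\<close>

definition grab_loop :: "nat \<Rightarrow> com" where
  "grab_loop r = Loop 4 (\<lambda>a. a \<noteq> 0) (Cond 0 (\<lambda>a. a = 2)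
     (Seq (push 4 1) (Seq (push r 2) (pop 0)))
     (Seq (pop 4) (Seq (push r 1) (pop 0))))"

definition grab :: "nat \<Rightarrow> com" where
  "grab r = Seq (push 4 1) (grab_loop r)"

text \<open>The induction is on the total length of the codes still to be read: a leaf removes a
  tree from the forest, a node is replaced by its two subtrees. Each symbol costs 11 steps.\<close>

lemma run_grab_loop:
  assumes "r \<in> {1, 2, 3}" "s 0 = concat (map code ts) @ rest" "s 4 = replicate (length ts) 1"
  shows "run (grab_loop r) s (11 * length (concat (map code ts)) + 1)
    (s(0 := rest, 4 := [], r := rev (concat (map code ts)) @ s r))"
  using assms(2,3)
proof (induction "length (concat (map code ts))" arbitrary: ts s rule: less_induct)
  case less
  have r: "r < 5" "r \<noteq> 0" "r \<noteq> 4" using assms(1) by auto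
  show ?case
  proof (cases ts)
    case Nil
    then show ?thesis
      unfolding grab_loop_def using less.prems r
      by (intro run_conv[OF run_Loop_False]) (auto simp: fun_eq_iff)
  next
    case (Cons t us)
    show ?thesis
    proof (cases t)
      case Lf
      let ?s1 = "s(4 := tl (s 4), r := 1 # s r)"
      let ?s2 = "?s1(0 := tl (?s1 0))"
      have "run (Seq (pop 4) (Seq (push r 1) (pop 0))) s (1 + 1 + (1 + 3 + 1)) ?s2"
        using r by (intro run_Seq run_pop run_conv[OF run_push] run_conv[OF run_pop]) auto
      then have "run (Seq (pop 4) (Seq (push r 1) (pop 0))) s 9 ?s2" by (rule run_mono) simp
      then have 1: "run (Cond 0 (\<lambda>a. a = 2) (Seq (push 4 1) (Seq (push r 2) (pop 0)))
          (Seq (pop 4) (Seq (push r 1) (pop 0)))) s (1 + 9) ?s2"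
        using less.prems Cons Lf by (intro run_Cond) (auto elim: run_mono)
      have 2: "run (grab_loop r) ?s2 (11 * length (concat (map code us)) + 1)
         (?s2(0 := rest, 4 := [], r := rev (concat (map code us)) @ ?s2 r))"
        using less.prems Cons Lf r by (intro less.hyps) auto
      show ?thesis
        unfolding grab_loop_def
        by (rule run_conv[OF run_Loop_True[OF _ _ 1 2[unfolded grab_loop_def]]])
          (use less.prems Cons Lf r in \<open>auto simp: fun_eq_iff\<close>)
    next
      case (Nd a b)
      let ?s1 = "s(4 := 1 # s 4, r := 2 # s r)"
      let ?s2 = "?s1(0 := tl (?s1 0))"
      have "run (Seq (push 4 1) (Seq (push r 2) (pop 0))) s (1 + 3 + (1 + 3 + 1)) ?s2"
        using r by (intro run_Seq run_push run_conv[OF run_push] run_conv[OF run_pop]) auto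
      then have 1: "run (Cond 0 (\<lambda>a. a = 2) (Seq (push 4 1) (Seq (push r 2) (pop 0)))
          (Seq (pop 4) (Seq (push r 1) (pop 0)))) s (1 + 9) ?s2"
        using less.prems Cons Nd by (intro run_Cond) (auto elim: run_mono)
      have 2: "run (grab_loop r) ?s2 (11 * length (concat (map code (a # b # us))) + 1)
         (?s2(0 := rest, 4 := [], r := rev (concat (map code (a # b # us))) @ ?s2 r))"
        using less.prems Cons Nd r by (intro less.hyps) auto
      show ?thesis
        unfolding grab_loop_def
        by (rule run_conv[OF run_Loop_True[OF _ _ 1 2[unfolded grab_loop_def]]])
          (use less.prems Cons Nd r in \<open>auto simp: fun_eq_iff\<close>)
    qed
  qed
qed

definition st :: "nat list \<Rightarrow> nat list \<Rightarrow> nat list \<Rightarrow> nat list \<Rightarrow> store" where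
  "st x a b d = (\<lambda>i. if i = 0 then x else if i = 1 then a else if i = 2 then b
     else if i = 3 then d else [])"

lemma st_simps [simp]:
  "st x a b d 0 = x" "st x a b d (Suc 0) = a" "st x a b d 2 = b" "st x a b d 3 = d"
    "st x a b d 4 = []"
  by (simp_all add: st_def)

lemma run_grab:
  shows "run (grab 1) (st (code t @ xs) a b d) (11 * length (code t) + 5) (st xs (rev (code t) @ a)
      b d)"
    and "run (grab 2) (st (code t @ xs) a b d) (11 * length (code t) + 5) (st xs a (rev (code t) @
        b) d)"
    and "run (grab 3) (st (code t @ xs) a b d) (11 * length (code t) + 5) (st xs a b (rev (code t) @
        d))"
  unfolding grab_def
  by (rule run_conv[OF run_Seq[OF run_push run_grab_loop[of _ _ "[t]" xs]]];
      auto simp: st_def fun_eq_iff)+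

lemma run_mv_st:
  "set a \<subseteq> {1, 2} \<Longrightarrow> run (mv 1 [0]) (st x a b d) (9 * length a + 1) (st (rev a @ x) [] b d)"
  "set b \<subseteq> {1, 2} \<Longrightarrow> run (mv 2 [0]) (st x a b d) (9 * length b + 1) (st (rev b @ x) a [] d)"
  "set d \<subseteq> {1, 2} \<Longrightarrow> run (mv 3 [0]) (st x a b d) (9 * length d + 1) (st (rev d @ x) a b [])"
  "set b \<subseteq> {1, 2} \<Longrightarrow> run (mv 2 [1]) (st x a b d) (9 * length b + 1) (st x (rev b @ a) [] d)"
  "set a \<subseteq> {1, 2} \<Longrightarrow> run (mv 1 [0, 2]) (st x a b d) (13 * length a + 1) (st (rev a @ x) [] (rev a @
    b) d)"
  "set a \<subseteq> {1, 2} \<Longrightarrow> run (mv 1 []) (st x a b d) (5 * length a + 1) (st x [] b d)"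
  "set b \<subseteq> {1, 2} \<Longrightarrow> run (mv 2 []) (st x a b d) (5 * length b + 1) (st x a [] d)"
  "set d \<subseteq> {1, 2} \<Longrightarrow> run (mv 3 []) (st x a b d) (5 * length d + 1) (st x a b [])"
  by (rule run_conv[OF run_mv]; force simp: st_def fun_eq_iff)+

lemma run_pop_st:
  "run (pop 0) (st (c # x) a b d) 1 (st x a b d)"
  "run (pop 1) (st x (c # a) b d) 1 (st x a b d)"
  "run (pop 2) (st x a (c # b) d) 1 (st x a b d)"
  by (rule run_conv[OF run_pop]; auto simp: st_def fun_eq_iff)+

lemma run_push_st:
  "c < 6 \<Longrightarrow> run (push 0 c) (st x a b d) 3 (st (c # x) a b d)"
  "c < 6 \<Longrightarrow> run (push 1 c) (st x a b d) 3 (st x (c # a) b d)"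
  "c < 6 \<Longrightarrow> run (push 3 c) (st x a b d) 3 (st x a b (c # d))"
  by (rule run_conv[OF run_push]; auto simp: st_def fun_eq_iff)+

text \<open>The copy in register 2 is in the right order. A move reverses, so it takes two moves,
  through register 1, to bring it back in that order.\<close>

definition dup :: com where
  "dup = Seq (grab 1) (Seq (mv 1 [0, 2]) (Seq (mv 2 [1]) (mv 1 [0])))"

lemma run_dup:
  "run dup (st (code t @ x) [] [] []) (42 * length (code t) + 11) (st (code t @ code t @ x) [] []
    [])"
  unfolding dup_def
  by (rule run_conv[OF run_Seq[OF run_grab(1) run_Seq[OF run_mv_st(5) run_Seq[OF run_mv_st(4)
      run_mv_st(1)]]]])
    (use set_code[of t] in auto)

definition swap :: com where
  "swap = Seq (grab 1) (Seq (grab 2) (Seq (mv 1 [0]) (mv 2 [0])))"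

lemma run_swap:
  "run swap (st (code t @ code u @ x) [] [] []) (20 * (length (code t) + length (code u)) + 15)
     (st (code u @ code t @ x) [] [] [])"
  unfolding swap_def
  by (rule run_conv[OF run_Seq[OF run_grab(1) run_Seq[OF run_grab(2) run_Seq[OF run_mv_st(1)
      run_mv_st(2)]]]])
    (use set_code[of t] set_code[of u] in auto)

definition drop_tree :: com where
  "drop_tree = Seq (grab 1) (mv 1 [])"

lemma run_drop_tree:
  "run drop_tree (st (code t @ x) [] [] []) (16 * length (code t) + 7) (st x [] [] [])"
  unfolding drop_tree_def
  by (rule run_conv[OF run_Seq[OF run_grab(1) run_mv_st(6)]]) (use set_code[of t] in auto)

fun push_list :: "nat list \<Rightarrow> com" where
  "push_list [] = Skip"
| "push_list (a # as) = Seq (push_list as) (push 0 a)"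

lemma run_push_list:
  "set as \<subseteq> {..<6} \<Longrightarrow> run (push_list as) (st x a [] []) (4 * length as + 1) (st (as @ x) a [] [])"
proof (induction as)
  case Nil
  then show ?case by (simp add: run_Skip[simplified])
next
  case (Cons c as)
  show ?case
    unfolding push_list.simps
    by (rule run_conv[OF run_Seq[OF Cons.IH run_push_st(1)]]) (use Cons.prems in auto)
qed

definition cmp_loop :: com where
  "cmp_loop = Loop 1 (\<lambda>a. a \<noteq> 0) (Seq
     (Cond 1 (\<lambda>a. a = 1)
        (Cond 2 (\<lambda>a. a = 1) (pop 2) (push 3 1))
        (Cond 2 (\<lambda>a. a = 2) (pop 2) (push 3 1)))
     (pop 1))"

text \<open>A mismatch leaves a mark in register 3 that is never removed, and a second word that is
  too long leaves a rest in register 2. The loop is driven by register 1 alone, which bounds the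
  time.\<close>

lemma run_cmp_loop:
  assumes "set a \<subseteq> {1, 2}" "set b \<subseteq> {1, 2}" "set d \<subseteq> {1, 2}"
  shows "\<exists>b' d'. run cmp_loop (st x a b d) (8 * length a + 1) (st x [] b' d') \<and>
    set b' \<subseteq> {1, 2} \<and> set d' \<subseteq> {1, 2} \<and> length b' \<le> length b \<and> length d' \<le> length d + length a \<and>
    (b' = [] \<and> d' = [] \<longleftrightarrow> a = b \<and> d = [])"
  using assms
proof (induction a arbitrary: b d)
  case Nil
  have "run cmp_loop (st x [] b d) 1 (st x [] b d)"
    unfolding cmp_loop_def by (intro run_Loop_False) (auto simp: st_def)
  then show ?case using Nil by (intro exI[of _ b] exI[of _ d]) auto
next
  case (Cons c a)
  have c: "c = 1 \<or> c = 2" using Cons.prems by auto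
  define b1 where "b1 = (if top b = c then tl b else b)"
  define d1 where "d1 = (if top b = c then d else 1 # d)"
  let ?c = "Cond 1 (\<lambda>a. a = 1)
        (Cond 2 (\<lambda>a. a = 1) (pop 2) (push 3 1))
        (Cond 2 (\<lambda>a. a = 2) (pop 2) (push 3 1))"
  have "run ?c (st x (c # a) b d) (1 + (1 + 3)) (st x (c # a) b1 d1)"
  proof (cases "top b = c")
    case True
    then obtain b2 where b: "b = c # b2" using c by (cases b) auto
    have "run (pop 2) (st x (c # a) b d) 3 (st x (c # a) b1 d1)"
      using run_mono[OF run_pop_st(3), of 3] by (simp add: b b1_def d1_def)
    then show ?thesis using c b by (intro run_Cond) auto
  next
    case False
    have "run (push 3 1) (st x (c # a) b d) 3 (st x (c # a) b1 d1)"
      using run_push_st(3) False by (simp add: b1_def d1_def)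
    then show ?thesis using c False by (intro run_Cond) auto
  qed
  note 1 = this
  have s1: "set b1 \<subseteq> {1, 2}" "set d1 \<subseteq> {1, 2}" "set a \<subseteq> {1, 2}"
    using Cons.prems by (cases b; auto simp: b1_def d1_def split: if_splits)+
  obtain b' d' where IH: "run cmp_loop (st x a b1 d1) (8 * length a + 1) (st x [] b' d')"
    "set b' \<subseteq> {1, 2}" "set d' \<subseteq> {1, 2}" "length b' \<le> length b1" "length d' \<le> length d1 + length a"
    "b' = [] \<and> d' = [] \<longleftrightarrow> a = b1 \<and> d1 = []"
    using Cons.IH[OF s1(3,1,2)] by blast
  have "run cmp_loop (st x (c # a) b d) (8 * length (c # a) + 1) (st x [] b' d')"
    unfolding cmp_loop_def
    by (rule run_conv[OF run_Loop_True[OF _ _ run_Seq[OF 1 run_pop_st(2)] IH(1)[unfolded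
        cmp_loop_def]]])
      (use c in \<open>auto simp: st_def\<close>)
  moreover have "a = b1 \<and> d1 = [] \<longleftrightarrow> c # a = b \<and> d = []"
    using c by (cases b) (auto simp: b1_def d1_def)
  moreover have "length b1 \<le> length b" "length d1 \<le> length d + 1" by (auto simp: b1_def d1_def)
  ultimately show ?case using IH(2-6) by (intro exI[of _ b'] exI[of _ d']) auto
qed

text \<open>A rest in register 2 is turned into a mark in register 3, so that a single test decides.
  The words \<open>[2, 1, 1]\<close> and \<open>[1]\<close> are the codes of \<open>True\<close> and
  \<open>False\<close>.\<close>

definition eq_test :: com where
  "eq_test = Seq (grab 1) (Seq (grab 2) (Seq cmp_loop
     (Seq (Cond 2 (\<lambda>a. a = 0) Skip (push 3 1)) (Seq (mv 2 [])
     (Cond 3 (\<lambda>a. a = 0) (push_list [2, 1, 1]) (Seq (mv 3 []) (push_list [1])))))))"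

definition bool_tree :: "bool \<Rightarrow> tree" where
  "bool_tree b = (if b then Nd Lf Lf else Lf)"

lemma run_eq_test:
  "run eq_test (st (code t @ code u @ x) [] [] []) (50 * (length (code t) + length (code u)) + 50)
     (st (code (bool_tree (t = u)) @ x) [] [] [])"
proof -
  obtain b d where c: "run cmp_loop (st x (rev (code t)) (rev (code u)) []) (8 * length (rev (code
      t)) + 1) (st x [] b d)"
    "set b \<subseteq> {1, 2}" "set d \<subseteq> {1, 2}" "length b \<le> length (code u)" "length d \<le> length (code t)"
    "b = [] \<and> d = [] \<longleftrightarrow> t = u"
    using run_cmp_loop[of "rev (code t)" "rev (code u)" "[]" x] set_code[of t] set_code[of u]
    by (auto simp: code_inject)
  define d1 where "d1 = (if b = [] then d else 1 # d)"
  have d1: "set d1 \<subseteq> {1, 2}" "length d1 \<le> length (code t) + 1" "d1 = [] \<longleftrightarrow> t = u"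
    using c by (auto simp: d1_def)
  have 1: "run (Cond 2 (\<lambda>a. a = 0) Skip (push 3 1)) (st x [] b d) (1 + 3) (st x [] b d1)"
  proof (rule run_Cond)
    assume "top (st x [] b d 2) = 0"
    then have "b = []" using c(2) by (cases b) auto
    then show "run Skip (st x [] b d) 3 (st x [] b d1)"
      using run_mono[OF run_Skip, of 3] by (simp add: d1_def)
  next
    assume "top (st x [] b d 2) \<noteq> 0"
    then have "b \<noteq> []" by auto
    then show "run (push 3 1) (st x [] b d) 3 (st x [] b d1)"
      using run_push_st(3) by (simp add: d1_def)
  qed simp
  have 2: "run (Cond 3 (\<lambda>a. a = 0) (push_list [2, 1, 1]) (Seq (mv 3 []) (push_list [1])))
     (st x [] [] d1) (1 + (5 * length d1 + 1 + 20)) (st (code (bool_tree (t = u)) @ x) [] [] [])"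
  proof (rule run_Cond)
    assume "top (st x [] [] d1 3) = 0"
    then have e: "d1 = []" using d1(1) by (cases d1) (auto simp: st_def)
    show "run (push_list [2, 1, 1]) (st x [] [] d1) (5 * length d1 + 1 + 20)
        (st (code (bool_tree (t = u)) @ x) [] [] [])"
      unfolding e by (rule run_conv[OF run_push_list]) (use e d1 in \<open>auto simp: bool_tree_def\<close>)
  next
    assume "top (st x [] [] d1 3) \<noteq> 0"
    then have e: "d1 \<noteq> []" by (auto simp: st_def)
    show "run (Seq (mv 3 []) (push_list [1])) (st x [] [] d1) (5 * length d1 + 1 + 20)
        (st (code (bool_tree (t = u)) @ x) [] [] [])"
      by (rule run_conv[OF run_Seq[OF run_mv_st(8) run_push_list]])
          (use e d1 in \<open>auto simp: bool_tree_def\<close>)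
  qed simp
  have c1: "run cmp_loop (st x (rev (code t) @ []) (rev (code u) @ []) []) (8 * length (rev (code
      t)) + 1) (st x [] b d)"
    using c(1) by simp
  show ?thesis
    unfolding eq_test_def
    by (rule run_conv[OF run_Seq[OF run_grab(1) run_Seq[OF run_grab(2) run_Seq[OF c1
          run_Seq[OF 1 run_Seq[OF run_mv_st(7)[OF c(2)] 2]]]]]])
      (use c d1 in auto)
qed

text \<open>Monotonicity allows a bound to be applied to an upper estimate of a size. The base
  \<open>n + 1\<close> is positive, so its powers increase with the exponent.\<close>

definition polyb :: "(nat \<Rightarrow> nat) \<Rightarrow> bool" where
  "polyb p \<longleftrightarrow> mono p \<and> (\<exists>c d. \<forall>n. p n \<le> c * (n + 1) ^ d)"

lemma polyb_mono: "polyb p \<Longrightarrow> m \<le> n \<Longrightarrow> p m \<le> p n"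
  by (auto simp: polyb_def dest: monoD)

lemma polyb_const: "polyb (\<lambda>n. k)"
  unfolding polyb_def by (rule conjI, simp add: monoI, rule exI[of _ k], rule exI[of _ 0], simp)

lemma polyb_id: "polyb (\<lambda>n. n)"
  unfolding polyb_def by (auto intro!: monoI exI[of _ 1] exI[of _ 1])

lemma polyb_add:
  assumes "polyb p" "polyb q"
  shows "polyb (\<lambda>n. p n + q n)"
proof -
  obtain c d c' d' where p: "\<And>n. p n \<le> c * (n + 1) ^ d" and q: "\<And>n. q n \<le> c' * (n + 1) ^ d'"
    using assms unfolding polyb_def by blast
  have "p n + q n \<le> (c + c') * (n + 1) ^ (d + d')" for n
  proof -
    have "(n + 1) ^ d \<le> (n + 1) ^ (d + d')" "(n + 1) ^ d' \<le> (n + 1) ^ (d + d')"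
      by (intro power_increasing; simp)+
    then have "c * (n + 1) ^ d + c' * (n + 1) ^ d' \<le> (c + c') * (n + 1) ^ (d + d')"
      unfolding distrib_right by (intro add_mono mult_le_mono) auto
    then show ?thesis using p[of n] q[of n] by linarith
  qed
  then show ?thesis using assms unfolding polyb_def by (auto intro!: monoI add_mono dest: monoD)
qed

lemma polyb_mult:
  assumes "polyb p" "polyb q"
  shows "polyb (\<lambda>n. p n * q n)"
proof -
  obtain c d c' d' where p: "\<And>n. p n \<le> c * (n + 1) ^ d" and q: "\<And>n. q n \<le> c' * (n + 1) ^ d'"
    using assms unfolding polyb_def by blast
  have "p n * q n \<le> (c * c') * (n + 1) ^ (d + d')" for n
    using mult_le_mono[OF p[of n] q[of n]] by (simp add: power_add algebra_simps)
  then show ?thesis using assms unfolding polyb_def by (auto intro!: monoI mult_le_mono dest: monoD)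
qed

lemma polyb_comp:
  assumes "polyb p" "polyb q"
  shows "polyb (\<lambda>n. p (q n))"
proof -
  obtain c d c' d' where p: "\<And>n. p n \<le> c * (n + 1) ^ d" and q: "\<And>n. q n \<le> c' * (n + 1) ^ d'"
    using assms unfolding polyb_def by blast
  have "p (q n) \<le> (c * (c' + 1) ^ d) * (n + 1) ^ (d' * d)" for n
  proof -
    have "q n + 1 \<le> (c' + 1) * (n + 1) ^ d'" 
    proof -
      have "1 \<le> (n + 1) ^ d'" by simp
      then show ?thesis using q[of n] unfolding distrib_right by linarith
    qed
    then have "(q n + 1) ^ d \<le> ((c' + 1) * (n + 1) ^ d') ^ d" by (intro power_mono) auto
    then have "c * (q n + 1) ^ d \<le> (c * (c' + 1) ^ d) * (n + 1) ^ (d' * d)"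
      by (metis mult.assoc mult_le_mono2 power_mult power_mult_distrib)
    then show ?thesis using p[of "q n"] by linarith
  qed
  then show ?thesis using assms unfolding polyb_def by (auto intro!: monoI dest: monoD)
qed

lemmas polyb_intros = polyb_const polyb_id polyb_add polyb_mult

text \<open>This is the form of bound in \<open>poly_time_decidable\<close>. The factor
  \<open>2 ^ d\<close> comes from \<open>n + 1 \<le> 2 * n\<close> for positive
  \<open>n\<close>.\<close>

lemma polyb_bound:
  assumes "polyb p"
  shows "\<exists>c d. \<forall>n. p n \<le> c * n ^ d + c"
proof -
  obtain c d where p: "\<And>n. p n \<le> c * (n + 1) ^ d" using assms unfolding polyb_def by blast
  have "p n \<le> (c * 2 ^ d) * n ^ d + c * 2 ^ d" for n
  proof (cases n)
    case 0
    have "c * 1 \<le> c * 2 ^ d" by (intro mult_le_mono) auto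
    moreover have "p n \<le> c * 1" using p[of n] 0 by simp
    ultimately show ?thesis by linarith
  next
    case (Suc m)
    have "(n + 1) ^ d \<le> (2 * n) ^ d" using Suc by (intro power_mono) auto
    then have "c * (n + 1) ^ d \<le> (c * 2 ^ d) * n ^ d"
      by (metis mult.assoc mult_le_mono2 power_mult_distrib)
    then show ?thesis using p[of n] by linarith
  qed
  then show ?thesis by blast
qed

section \<open>Encoding of data types as trees\<close>

class enc =
  fixes enc :: "'a \<Rightarrow> tree"
  assumes inj_enc: "inj enc"

instantiation bool :: enc
begin
definition enc_bool where "enc_bool = bool_tree"
instance by standard (auto simp: enc_bool_def bool_tree_def inj_def)
end

text \<open>Unary is affordable: in the algorithm numbers occur only as input symbols, which are at
  most 5, while variables and relation names stay lists of binary digits.\<close>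

instantiation nat :: enc
begin
primrec enc_nat where "enc_nat 0 = Lf" | "enc_nat (Suc n) = Nd Lf (enc_nat n)"
instance
proof (standard, rule injI)
  show "enc x = enc y \<Longrightarrow> x = y" for x y :: nat
  proof (induction x arbitrary: y)
    case 0
    then show ?case by (cases y) auto
  next
    case (Suc x)
    then show ?case by (cases y) auto
  qed
qed
end

instantiation prod :: (enc, enc) enc
begin
definition enc_prod :: "'a \<times> 'b \<Rightarrow> tree" where "enc_prod z = Nd (enc (fst z)) (enc (snd z))"
instance
  by standard (auto simp: enc_prod_def inj_def dest: injD[OF inj_enc])
end

instantiation list :: (enc) enc
begin
primrec enc_list :: "'a list \<Rightarrow> tree" where
  "enc_list [] = Lf" | "enc_list (x # xs) = Nd (enc x) (enc_list xs)"
instance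
proof (standard, rule injI)
  show "enc x = enc y \<Longrightarrow> x = y" for x y :: "'a list"
  proof (induction x arbitrary: y)
    case Nil
    then show ?case by (cases y) auto
  next
    case (Cons a x)
    then show ?case by (cases y) (auto dest: injD[OF inj_enc])
  qed
qed
end

lemma enc_inject: "enc x = enc y \<longleftrightarrow> x = y"
  using inj_enc by (auto dest: injD)

lemma enc_pair [simp]: "enc (x, y) = Nd (enc x) (enc y)"
  by (simp add: enc_prod_def)

abbreviation cd :: "'a::enc \<Rightarrow> nat list" where
  "cd x \<equiv> code (enc x)"

definition sz :: "'a::enc \<Rightarrow> nat" where
  "sz x = length (cd x)"

lemma sz_pair [simp]: "sz (x, y) = 1 + sz x + sz y"
  by (simp add: sz_def)

lemma sz_Nil [simp]: "sz [] = 1"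
  by (simp add: sz_def)

lemma sz_Cons [simp]: "sz (x # xs) = 1 + sz x + sz xs"
  by (simp add: sz_def)

lemma sz_bool: "sz (b :: bool) \<le> 3"
  by (simp add: sz_def enc_bool_def bool_tree_def)

lemma sz_pos: "1 \<le> sz x"
  by (cases "enc x") (auto simp: sz_def)

lemma sz_nat: "sz (n::nat) = 2 * n + 1"
  by (induction n) (auto simp: sz_def)

lemma sz_append: "sz (xs @ ys) + 1 = sz xs + sz ys"
  by (induction xs) auto

lemma sz_list: "sz xs = 1 + (\<Sum>x\<leftarrow>xs. 1 + sz x)"
  by (induction xs) auto

lemma sz_rev: "sz (rev xs) = sz xs"
  by (simp add: sz_list rev_map[symmetric] sum_list_rev)

lemma sz_mem: "x \<in> set xs \<Longrightarrow> sz x \<le> sz xs"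
  by (induction xs) auto

lemma length_le_sz: "length xs \<le> sz xs"
  by (induction xs) auto

lemma sz_list_le: "(\<And>x. x \<in> set xs \<Longrightarrow> sz x \<le> m) \<Longrightarrow> sz xs \<le> 1 + length xs * (1 + m)"
  by (induction xs) (force simp: add_mono)+

lemma sz_take: "sz (take i xs) \<le> sz xs"
  using sz_append[of "take i xs" "drop i xs"] sz_pos[of "drop i xs"] by simp

section \<open>Polynomial time functions and their basic combinators\<close>

abbreviation mst :: "nat list \<Rightarrow> store" where
  "mst x \<equiv> st x [] [] []"

text \<open>The program replaces the topmost code in register 0 and leaves the rest \<open>r\<close>
  alone, so it can run in the presence of other data. The size bound is included because the time of
  a composition depends on the size of the intermediate result.\<close>

definition PT :: "('a::enc \<Rightarrow> 'b::enc) \<Rightarrow> bool" where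
  "PT f \<longleftrightarrow> (\<exists>c p. polyb p \<and> (\<forall>x. sz (f x) \<le> p (sz x)) \<and>
     (\<forall>x r. run c (mst (cd x @ r)) (p (sz x)) (mst (cd (f x) @ r))))"

lemma PT_I:
  assumes "polyb p" "polyb q" "\<And>x. sz (f x) \<le> q (sz x)"
    and "\<And>x r. run c (mst (cd x @ r)) (p (sz x)) (mst (cd (f x) @ r))"
  shows "PT f"
  unfolding PT_def
proof (intro exI[of _ c] exI[of _ "\<lambda>n. p n + q n"] conjI allI)
  show "polyb (\<lambda>n. p n + q n)" using assms polyb_add by blast
  show "sz (f x) \<le> p (sz x) + q (sz x)" for x using assms(3)[of x] by simp
  show "run c (mst (cd x @ r)) (p (sz x) + q (sz x)) (mst (cd (f x) @ r))" for x r
    using run_mono[OF assms(4)] by simp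
qed

lemma PT_E:
  assumes "PT f"
  obtains c p where "polyb p" "\<And>x. sz (f x) \<le> p (sz x)"
    "\<And>x r. run c (mst (cd x @ r)) (p (sz x)) (mst (cd (f x) @ r))"
  using assms unfolding PT_def by blast

lemma PT_size: "PT f \<Longrightarrow> \<exists>p. polyb p \<and> (\<forall>x. sz (f x) \<le> p (sz x))"
  unfolding PT_def by blast

lemma PT_id: "PT (\<lambda>x. x)"
  by (rule PT_I[where p = "\<lambda>n. 1" and q = "\<lambda>n. n", OF polyb_const polyb_id _ run_Skip]) simp

lemma PT_comp:
  assumes "PT g" "PT f"
  shows "PT (\<lambda>x. g (f x))"
proof -
  obtain c p where f: "polyb p" "\<And>x. sz (f x) \<le> p (sz x)"
    "\<And>x r. run c (mst (cd x @ r)) (p (sz x)) (mst (cd (f x) @ r))" using assms PT_E by metis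
  obtain d q where g: "polyb q" "\<And>x. sz (g x) \<le> q (sz x)"
    "\<And>x r. run d (mst (cd x @ r)) (q (sz x)) (mst (cd (g x) @ r))" using assms PT_E by metis
  have le: "q (sz (f x)) \<le> q (p (sz x))" for x using polyb_mono[OF g(1) f(2)] .
  show ?thesis
  proof (rule PT_I)
    show "polyb (\<lambda>n. 1 + p n + q (p n))" "polyb (\<lambda>n. q (p n))"
      by (rule f(1) g(1) polyb_intros polyb_comp[of q])+
    show "sz (g (f x)) \<le> q (p (sz x))" for x using g(2)[of "f x"] le[of x] by simp
    show "run (Seq c d) (mst (cd x @ r)) (1 + p (sz x) + q (p (sz x))) (mst (cd (g (f x)) @ r))"
        for x r
      by (rule run_conv[OF run_Seq[OF f(3) g(3)]]) (use le in auto)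
  qed
qed

lemma PT_const: "PT (\<lambda>x::'b::enc. k :: 'a::enc)"
proof (rule PT_I[where q = "\<lambda>n. sz k" and p = "\<lambda>n. 16 * n + (4 * sz k + 9)"])
  show "run (Seq drop_tree (push_list (cd k))) (mst (cd x @ r)) (16 * sz x + (4 * sz k + 9)) (mst
      (cd k @ r))"
    for x :: 'b and r
    by (rule run_conv[OF run_Seq[OF run_drop_tree run_push_list]])
      (use set_code[of "enc k"] in \<open>auto simp: sz_def\<close>)
qed (intro polyb_intros | simp)+

text \<open>The second component is computed first, so that the first one ends up above it; the
  symbol 2 on top then makes the two codes the code of a pair.\<close>

lemma PT_Pair:
  assumes "PT f" "PT g"
  shows "PT (\<lambda>x. (f x, g x))"
proof -
  obtain c p where f: "polyb p" "\<And>x. sz (f x) \<le> p (sz x)"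
    "\<And>x r. run c (mst (cd x @ r)) (p (sz x)) (mst (cd (f x) @ r))" using assms PT_E by metis
  obtain d q where g: "polyb q" "\<And>x. sz (g x) \<le> q (sz x)"
    "\<And>x r. run d (mst (cd x @ r)) (q (sz x)) (mst (cd (g x) @ r))" using assms PT_E by metis
  show ?thesis
  proof (rule PT_I)
    show "polyb (\<lambda>n. 62 * n + 21 * q n + p n + 33)" "polyb (\<lambda>n. 1 + p n + q n)"
      by (rule f(1) g(1) polyb_intros)+
    show "sz (f x, g x) \<le> 1 + p (sz x) + q (sz x)" for x using f(2)[of x] g(2)[of x] by simp
    show "run (Seq dup (Seq d (Seq swap (Seq c (push 0 2))))) (mst (cd x @ r))
        (62 * sz x + 21 * q (sz x) + p (sz x) + 33) (mst (cd (f x, g x) @ r))" for x r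
      by (rule run_conv[OF run_Seq[OF run_dup run_Seq[OF g(3) run_Seq[OF run_swap run_Seq[OF f(3)
          run_push_st(1)]]]]])
        (use g(2)[of x] in \<open>auto simp: sz_def\<close>)
  qed
qed

lemma PT_fst0: "PT fst"
proof (rule PT_I[where q = "\<lambda>n. n" and p = "\<lambda>n. 40 * n + 40"])
  show "sz (fst x) \<le> sz x" for x :: "'a \<times> 'b" by (cases x) simp
  show "run (Seq (pop 0) (Seq swap drop_tree)) (mst (cd x @ r)) (40 * sz x + 40) (mst (cd (fst x) @
      r))"
    for x :: "'a \<times> 'b" and r
  proof (cases x)
    case (Pair a b)
    have "run (Seq (pop 0) (Seq swap drop_tree)) (mst (2 # cd a @ cd b @ r)) (40 * sz x + 40) (mst
        (cd (fst x) @ r))"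
      by (rule run_conv[OF run_Seq[OF run_pop_st(1) run_Seq[OF run_swap run_drop_tree]]])
        (auto simp: sz_def Pair)
    then show ?thesis by (simp add: Pair)
  qed
qed (intro polyb_intros | simp)+

lemma PT_snd0: "PT snd"
proof (rule PT_I[where q = "\<lambda>n. n" and p = "\<lambda>n. 40 * n + 40"])
  show "sz (snd x) \<le> sz x" for x :: "'a \<times> 'b" by (cases x) simp
  show "run (Seq (pop 0) drop_tree) (mst (cd x @ r)) (40 * sz x + 40) (mst (cd (snd x) @ r))"
    for x :: "'a \<times> 'b" and r
  proof (cases x)
    case (Pair a b)
    have "run (Seq (pop 0) drop_tree) (mst (2 # cd a @ cd b @ r)) (40 * sz x + 40) (mst (cd (snd x)
        @ r))"
      by (rule run_conv[OF run_Seq[OF run_pop_st(1) run_drop_tree]]) (auto simp: sz_def Pair)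
    then show ?thesis by (simp add: Pair)
  qed
qed (intro polyb_intros | simp)+

lemmas PT_fst = PT_comp[OF PT_fst0]
lemmas PT_snd = PT_comp[OF PT_snd0]

text \<open>A nonempty list has the same code as the pair of its head and tail.\<close>

lemma PT_Cons0: "PT (\<lambda>z. fst z # snd z)"
proof (rule PT_I[where q = "\<lambda>n. n" and p = "\<lambda>n. 1"])
  show "run Skip (mst (cd z @ r)) 1 (mst (cd (fst z # snd z) @ r))" for z :: "'a \<times> 'a list" and r
    using run_Skip by (cases z) simp
  show "sz (fst z # snd z) \<le> sz z" for z :: "'a \<times> 'a list" by (cases z) simp
qed (intro polyb_intros)+

lemma PT_Cons: "PT f \<Longrightarrow> PT g \<Longrightarrow> PT (\<lambda>x. f x # g x)"
  using PT_comp[OF PT_Cons0 PT_Pair[of f g]] by simp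

lemma PT_eq0: "PT (\<lambda>z. fst z = snd z)"
proof (rule PT_I[where q = "\<lambda>n. 3" and p = "\<lambda>n. 50 * n + 60"])
  show "sz (fst z = snd z) \<le> 3" for z :: "'a \<times> 'a" by (rule sz_bool)
  show "run (Seq (pop 0) eq_test) (mst (cd z @ r)) (50 * sz z + 60) (mst (cd (fst z = snd z) @ r))"
    for z :: "'a \<times> 'a" and r
  proof (cases z)
    case (Pair a b)
    have "run (Seq (pop 0) eq_test) (mst (2 # cd a @ cd b @ r)) (50 * sz z + 60) (mst (cd (fst z =
        snd z) @ r))"
      by (rule run_conv[OF run_Seq[OF run_pop_st(1) run_eq_test]])
        (auto simp: sz_def Pair enc_bool_def enc_inject)
    then show ?thesis by (simp add: Pair)
  qed
qed (intro polyb_intros)+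

lemma PT_eq: "PT f \<Longrightarrow> PT g \<Longrightarrow> PT (\<lambda>x. f x = g x)"
  using PT_comp[OF PT_eq0 PT_Pair[of f g]] by simp

text \<open>Since \<open>y # ys\<close> and \<open>(y, ys)\<close> have the same code, pushing 2
  onto the codes of \<open>y # ys\<close> and \<open>x\<close> yields the code of
  \<open>((y, ys), x)\<close>.\<close>

lemma PT_case_list:
  assumes "PT l" "PT f" "PT (\<lambda>z. g (fst (fst z)) (snd (fst z)) (snd z))"
  shows "PT (\<lambda>x. case l x of [] \<Rightarrow> f x | y # ys \<Rightarrow> g y ys x)"
proof -
  obtain cl pl where l: "polyb pl" "\<And>x. sz (l x) \<le> pl (sz x)"
    "\<And>x r. run cl (mst (cd x @ r)) (pl (sz x)) (mst (cd (l x) @ r))" using assms PT_E by metis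
  obtain cf pf where f: "polyb pf" "\<And>x. sz (f x) \<le> pf (sz x)"
    "\<And>x r. run cf (mst (cd x @ r)) (pf (sz x)) (mst (cd (f x) @ r))" using assms PT_E by metis
  obtain cg pg where g: "polyb pg" "\<And>z. sz (g (fst (fst z)) (snd (fst z)) (snd z)) \<le> pg (sz z)"
    "\<And>z r. run cg (mst (cd z @ r)) (pg (sz z)) (mst (cd (g (fst (fst z)) (snd (fst z)) (snd z)) @
      r))"
    using PT_E[OF assms(3)] by metis
  let ?h = "\<lambda>x. case l x of [] \<Rightarrow> f x | y # ys \<Rightarrow> g y ys x"
  have szl: "sz ((y, ys), x) \<le> 1 + pl (sz x) + sz x" if "l x = y # ys" for x y ys
    using l(2)[of x] that by simp
  have le: "pg (sz ((y, ys), x)) \<le> pg (1 + pl (sz x) + sz x)" if "l x = y # ys" for x y ys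
    by (rule polyb_mono[OF g(1) szl[OF that]])
  show ?thesis
  proof (rule PT_I)
    show "polyb (\<lambda>n. 42 * n + pl n + pf n + pg (1 + pl n + n) + 30)"
      by (rule f(1) g(1) l(1) polyb_intros polyb_comp[of pg])+
    show "polyb (\<lambda>n. pf n + pg (1 + pl n + n))"
      by (rule f(1) g(1) l(1) polyb_intros polyb_comp[of pg])+
    show "sz (?h x) \<le> pf (sz x) + pg (1 + pl (sz x) + sz x)" for x
    proof (cases "l x")
      case Nil
      then show ?thesis using f(2)[of x] by simp
    next
      case (Cons y ys)
      then show ?thesis using g(2)[of "((y, ys), x)"] le[OF Cons] by simp
    qed
    show "run (Seq dup (Seq cl (Cond 0 (\<lambda>a. a = 1) (Seq (pop 0) cf) (Seq (push 0 2) cg))))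
       (mst (cd x @ r)) (42 * sz x + pl (sz x) + pf (sz x) + pg (1 + pl (sz x) + sz x) + 30)
       (mst (cd (?h x) @ r))" for x r
    proof -
      let ?T = "5 + pf (sz x) + pg (1 + pl (sz x) + sz x)"
      have "run (Cond 0 (\<lambda>a. a = 1) (Seq (pop 0) cf) (Seq (push 0 2) cg))
        (mst (cd (l x) @ cd x @ r)) (1 + ?T) (mst (cd (?h x) @ r))"
      proof (cases "l x")
        case Nil
        have "run (Seq (pop 0) cf) (mst (1 # cd x @ r)) ?T (mst (cd (f x) @ r))"
          by (rule run_conv[OF run_Seq[OF run_pop_st(1) f(3)]]) auto
        then show ?thesis using Nil by (intro run_Cond) auto
      next
        case (Cons y ys)
        have "run cg (mst (2 # cd (y # ys) @ cd x @ r)) (pg (sz ((y, ys),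
            x))) (mst (cd (g y ys x) @ r))"
          using g(3)[of "((y, ys), x)" r] by simp
        then have "run (Seq (push 0 2) cg) (mst (cd (y # ys) @ cd x @ r)) ?T (mst (cd (g y ys x) @
            r))"
          by (intro run_conv[OF run_Seq[OF run_push_st(1)]]) (use le[OF Cons] in auto)
        then show ?thesis using Cons by (intro run_Cond) auto
      qed
      then show ?thesis
        by (intro run_conv[OF run_Seq[OF run_dup run_Seq[OF l(3)]]]) (auto simp: sz_def)
    qed
  qed
qed

lemma PT_If:
  assumes "PT b" "PT f" "PT g"
  shows "PT (\<lambda>x. if b x then f x else g x)"
proof -
  obtain cb pb where b: "polyb pb" "\<And>x. sz (b x) \<le> pb (sz x)"
    "\<And>x r. run cb (mst (cd x @ r)) (pb (sz x)) (mst (cd (b x) @ r))" using assms PT_E by metis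
  obtain cf pf where f: "polyb pf" "\<And>x. sz (f x) \<le> pf (sz x)"
    "\<And>x r. run cf (mst (cd x @ r)) (pf (sz x)) (mst (cd (f x) @ r))" using assms PT_E by metis
  obtain cg pg where g: "polyb pg" "\<And>x. sz (g x) \<le> pg (sz x)"
    "\<And>x r. run cg (mst (cd x @ r)) (pg (sz x)) (mst (cd (g x) @ r))" using assms PT_E by metis
  let ?h = "\<lambda>x. if b x then f x else g x"
  show ?thesis
  proof (rule PT_I)
    show "polyb (\<lambda>n. 42 * n + pb n + pf n + pg n + 30)" "polyb (\<lambda>n. pf n + pg n)"
      by (rule f(1) g(1) b(1) polyb_intros)+
    show "sz (?h x) \<le> pf (sz x) + pg (sz x)" for x using f(2)[of x] g(2)[of x] by simp
    show "run (Seq dup (Seq cb (Cond 0 (\<lambda>a. a =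
        1) (Seq (pop 0) cg) (Seq (pop 0) (Seq (pop 0) (Seq (pop 0) cf))))))
       (mst (cd x @ r)) (42 * sz x + pb (sz x) + pf (sz x) + pg (sz x) + 30)
       (mst (cd (?h x) @ r))" for x r
    proof -
      let ?T = "10 + pf (sz x) + pg (sz x)"
      have 1: "run (Seq (pop 0) cg) (mst (1 # cd x @ r)) ?T (mst (cd (g x) @ r))"
        by (rule run_conv[OF run_Seq[OF run_pop_st(1) g(3)]]) auto
      \<comment> \<open>The code of \<open>True\<close> has three symbols and that of
        \<open>False\<close> one; hence three pops here and one above.\<close>
      have 2: "run (Seq (pop 0) (Seq (pop 0) (Seq (pop 0) cf))) (mst (2 # 1 # 1 # cd x @ r)) ?T (mst
          (cd (f x) @ r))"
        by (rule run_conv[OF run_Seq[OF run_pop_st(1) run_Seq[OF run_pop_st(1) run_Seq[OF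
            run_pop_st(1) f(3)]]]]) auto
      have "run (Cond 0 (\<lambda>a. a = 1) (Seq (pop 0) cg) (Seq (pop 0) (Seq (pop 0) (Seq (pop 0) cf))))
        (mst (cd (b x) @ cd x @ r)) (1 + ?T) (mst (cd (?h x) @ r))"
        by (intro run_Cond) (use 1 2 in \<open>auto simp: enc_bool_def bool_tree_def split: if_splits\<close>)
      then show ?thesis
        by (intro run_conv[OF run_Seq[OF run_dup run_Seq[OF b(3)]]]) (auto simp: sz_def)
    qed
  qed
qed

text \<open>The rest of the list lies between its head and the state. It is moved below the state,
  so that the step program sees the pair of head and state; the final \<open>swap\<close> restores
  the layout.\<close>

definition fold_body :: "com \<Rightarrow> com" where
  "fold_body c = Seq (pop 0) (Seq (grab 1) (Seq (grab 2) (Seq (grab 3) (Seq (mv 2 [0])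
     (Seq (mv 3 [0]) (Seq (mv 1 [0]) (Seq (push 0 2) (Seq c swap))))))))"

lemma run_fold_body:
  assumes g: "\<And>z r. run c (mst (cd z @ r)) (p (sz z)) (mst (cd (g z) @ r))"
  shows "run (fold_body c) (mst (cd (a # xs) @ cd s @ r))
    (20 * sz a + 40 * sz xs + 20 * sz s + 20 * sz (g (a, s)) + p (sz (a, s)) + 60)
    (mst (cd xs @ cd (g (a, s)) @ r))"
proof -
  have g1: "run c (mst (2 # rev (rev (cd a) @ []) @ rev (rev (cd s) @ []) @ rev (rev (cd xs) @ []) @
      r)) (p (sz (a, s)))
      (mst (cd (g (a, s)) @ cd xs @ r))"
    using g[of "(a, s)" "cd xs @ r"] by simp
  have "run (fold_body c) (mst (2 # cd a @ cd xs @ cd s @ r))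
    (20 * sz a + 40 * sz xs + 20 * sz s + 20 * sz (g (a, s)) + p (sz (a, s)) + 60)
    (mst (cd xs @ cd (g (a, s)) @ r))"
    unfolding fold_body_def
    by (rule run_conv[OF run_Seq[OF run_pop_st(1) run_Seq[OF run_grab(1) run_Seq[OF run_grab(2)
      run_Seq[OF run_grab(3) run_Seq[OF run_mv_st(2) run_Seq[OF run_mv_st(3) run_Seq[OF run_mv_st(1)
        run_Seq[OF run_push_st(1) run_Seq[OF g1 run_swap]]]]]]]]]])
      (use set_code[of "enc a"] set_code[of "enc s"] set_code[of "enc xs"] in \<open>auto simp: sz_def\<close>)
  then show ?thesis by simp
qed

lemma run_fold_loop:
  assumes g: "\<And>z r. run c (mst (cd z @ r)) (p (sz z)) (mst (cd (g z) @ r))" and p: "polyb p"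
    and "sz xs \<le> m" and "\<And>i. sz (fold (\<lambda>a s. g (a, s)) (take i xs) s) \<le> m"
  shows "run (Loop 0 (\<lambda>a. a = 2) (fold_body c)) (mst (cd xs @ cd s @ r))
    (length xs * (100 * m + p (1 + m + m) + 61) + 1) (mst (1 # cd (fold (\<lambda>a s. g (a, s)) xs s) @
        r))"
  using assms(3,4)
proof (induction xs arbitrary: s)
  case Nil
  then show ?case by (intro run_conv[OF run_Loop_False]) auto
next
  case (Cons a xs)
  have "sz s \<le> m" using Cons.prems(2)[of 0] by simp
  moreover have "sz (g (a, s)) \<le> m" using Cons.prems(2)[of 1] by simp
  moreover have "sz a \<le> m" "sz xs \<le> m" using Cons.prems(1) by auto
  moreover have "p (sz (a, s)) \<le> p (1 + m + m)"
    using calculation by (intro polyb_mono[OF p]) simp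
  ultimately have le: "20 * sz a + 40 * sz xs + 20 * sz s + 20 * sz (g (a, s)) + p (sz (a, s)) + 60
      \<le> 100 * m + p (1 + m + m) + 60" by linarith
  have "sz (fold (\<lambda>a s. g (a, s)) (take i xs) (g (a, s))) \<le> m" for i
    using Cons.prems(2)[of "Suc i"] by simp
  note IH = Cons.IH[OF \<open>sz xs \<le> m\<close> this]
  show ?case
    by (rule run_conv[OF run_Loop_True[OF _ _ run_fold_body[OF g] IH]]) (use le in auto)
qed

text \<open>A polynomial iterated along a list need not stay polynomial, so a bound on all
  intermediate states is a hypothesis. With it every round has the same polynomial cost.\<close>

lemma PT_fold0:
  assumes "PT g" "PT l" "PT s" "polyb q"
    and bnd: "\<And>x i. sz (fold (\<lambda>a s. g (a, s)) (take i (l x)) (s x)) \<le> q (sz x)"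
  shows "PT (\<lambda>x. fold (\<lambda>a s. g (a, s)) (l x) (s x))"
proof -
  obtain c p where g: "polyb p" "\<And>x. sz (g x) \<le> p (sz x)"
    "\<And>x r. run c (mst (cd x @ r)) (p (sz x)) (mst (cd (g x) @ r))" using assms PT_E by metis
  obtain d p' where ls: "polyb p'" "\<And>x. sz (l x, s x) \<le> p' (sz x)"
    "\<And>x r. run d (mst (cd x @ r)) (p' (sz x)) (mst (cd (l x, s x) @ r))"
    using PT_E[OF PT_Pair[OF assms(2,3)]] by metis
  let ?m = "\<lambda>n. q n + p' n"
  show ?thesis
  proof (rule PT_I[where q = q])
    show "polyb (\<lambda>n. p' n + ?m n * (100 * ?m n + p (1 + ?m n + ?m n) + 61) + 10)"
      by (rule assms(4) g(1) ls(1) polyb_intros polyb_comp[of p])+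
    show "polyb q" by fact
    show "sz (fold (\<lambda>a s. g (a, s)) (l x) (s x)) \<le> q (sz x)" for x
      using bnd[of "length (l x)" x] by simp
    show "run (Seq d (Seq (pop 0) (Seq (Loop 0 (\<lambda>a. a =
        2) (fold_body c)) (pop 0)))) (mst (cd x @ r))
      (p' (sz x) + ?m (sz x) * (100 * ?m (sz x) + p (1 + ?m (sz x) + ?m (sz x)) + 61) + 10)
      (mst (cd (fold (\<lambda>a s. g (a, s)) (l x) (s x)) @ r))" for x r
    proof -
      let ?M = "?m (sz x)"
      have M: "sz (l x) \<le> ?M" using ls(2)[of x] by simp
      have 1: "run (Loop 0 (\<lambda>a. a = 2) (fold_body c)) (mst (cd (l x) @ cd (s x) @ r))
        (length (l x) * (100 * ?M + p (1 + ?M + ?M) + 61) + 1) (mst (1 # cd (fold (\<lambda>a s. g (a, s))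
            (l x) (s x)) @ r))"
        using bnd[of _ x] M by (intro run_fold_loop[OF g(3,1)]) (auto intro: trans_le_add1)
      have d: "run d (mst (cd x @ r)) (p' (sz x)) (mst (2 # cd (l x) @ cd (s x) @ r))"
        using ls(3)[of x r] by simp
      have "length (l x) * (100 * ?M + p (1 + ?M + ?M) + 61) \<le>
          ?M * (100 * ?M + p (1 + ?M + ?M) + 61)"
        using M length_le_sz[of "l x"] by (intro mult_le_mono1) linarith
      then have T: "1 + p' (sz x) + (1 + 1 + (1 + (length (l x) * (100 * ?M + p (1 + ?M + ?M) + 61)
          + 1) + 1))
          \<le> p' (sz x) + ?M * (100 * ?M + p (1 + ?M + ?M) + 61) + 10" by linarith
      show ?thesis
        by (rule run_conv[OF run_Seq[OF d run_Seq[OF run_pop_st(1) run_Seq[OF 1 run_pop_st(1)]]]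
            refl T])
    qed
  qed
qed

text \<open>The step may depend on the input \<open>x\<close>, which is carried along in the
  state.\<close>

lemma PT_fold:
  assumes "PT l" "PT s" "PT (\<lambda>z. F (fst z) (fst (snd z)) (snd (snd z)))" "polyb q"
    and bnd: "\<And>x i. sz (fold (\<lambda>a s. F a s x) (take i (l x)) (s x)) \<le> q (sz x)"
  shows "PT (\<lambda>x. fold (\<lambda>a s. F a s x) (l x) (s x))"
proof -
  let ?g = "\<lambda>z. (F (fst z) (fst (snd z)) (snd (snd z)), snd (snd z))"
  have e: "fold (\<lambda>a s. ?g (a, s)) xs (s0, x) = (fold (\<lambda>a s. F a s x) xs s0, x)" for xs s0 x
    by (induction xs arbitrary: s0) auto
  have "PT (\<lambda>x. fold (\<lambda>a s. ?g (a, s)) (l x) (s x, x))"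
  proof (rule PT_fold0[where q = "\<lambda>n. 1 + q n + n"])
    show "polyb (\<lambda>n. 1 + q n + n)" by (rule assms(4) polyb_intros)+
    show "sz (fold (\<lambda>a s. ?g (a, s)) (take i (l x)) (s x, x)) \<le> 1 + q (sz x) + sz x" for x i
      unfolding e using bnd by simp
  qed (use assms in \<open>auto intro!: PT_Pair PT_snd PT_id\<close>)
  from PT_fst[OF this] show ?thesis by (simp add: e[simplified])
qed

section \<open>Loading the raw input word into the encoded format\<close>

fun select :: "nat \<Rightarrow> (nat \<Rightarrow> com) \<Rightarrow> nat \<Rightarrow> com" where
  "select r F 0 = Skip"
| "select r F (Suc n) = Cond r (\<lambda>a. a = Suc n) (F (Suc n)) (select r F n)"

lemma run_select:
  "r < 5 \<Longrightarrow> 1 \<le> top (s r) \<Longrightarrow> top (s r) \<le> n \<Longrightarrow> run (F (top (s r))) s T s' \<Longrightarrow>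
    run (select r F n) s (n + T) s'"
proof (induction n)
  case (Suc n)
  have "run (Cond r (\<lambda>a. a = Suc n) (F (Suc n)) (select r F n)) s (1 + (n + T)) s'"
  proof (rule run_Cond)
    show "run (F (Suc n)) s (n + T) s'" if "top (s r) = Suc n"
      using Suc.prems(4) that by (auto intro: run_mono)
    show "run (select r F n) s (n + T) s'" if "top (s r) \<noteq> Suc n"
      using Suc that by auto
  qed (use Suc in auto)
  then show ?case by simp
qed simp

text \<open>The first loop reverses the word into register 1. The second can then build the list
  from its last element on, starting with the code \<open>[1]\<close> of the empty list.\<close>

definition load :: com where
  "load = Seq (Loop 0 (\<lambda>a. a \<noteq> 0) (Seq (select 0 (push 1) 5) (pop 0)))
     (Seq (push 0 1) (Loop 1 (\<lambda>a. a \<noteq> 0) (Seq (select 1 (\<lambda>a. push_list (2 # cd a)) 5) (pop 1))))"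

lemma run_load1:
  "set w \<subseteq> {1..5} \<Longrightarrow> run (Loop 0 (\<lambda>a. a \<noteq> 0) (Seq (select 0 (push 1) 5) (pop 0)))
     (st w a [] []) (11 * length w + 1) (st [] (rev w @ a) [] [])"
proof (induction w arbitrary: a)
  case Nil
  then show ?case by (intro run_conv[OF run_Loop_False]) auto
next
  case (Cons c w)
  have 1: "run (select 0 (push 1) 5) (st (c # w) a [] []) (5 + 3) (st (c # w) (c # a) [] [])"
    using Cons.prems by (intro run_select) (auto intro: run_push_st(2)[simplified])
  show ?case
    by (rule run_conv[OF run_Loop_True[OF _ _ run_Seq[OF 1 run_pop_st(1)] Cons.IH]])
      (use Cons.prems in auto)
qed

lemma run_load2:
  "set w \<subseteq> {1..5} \<Longrightarrow> run (Loop 1 (\<lambda>a. a \<noteq> 0) (Seq (select 1 (\<lambda>a. push_list (2 # cd a)) 5) (pop 1)))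
     (st (cd v) w [] []) (60 * length w + 1) (st (cd (rev w @ v)) [] [] [])"
proof (induction w arbitrary: v)
  case Nil
  then show ?case by (intro run_conv[OF run_Loop_False]) auto
next
  case (Cons c w)
  have l: "length (cd c) \<le> 11" using Cons.prems sz_nat[of c] by (simp add: sz_def)
  have 0: "run (push_list (2 # cd c)) (st (cd v) (c # w) [] []) 49 (st (cd (c # v)) (c # w) [] [])"
    by (rule run_conv[OF run_push_list]) (use l set_code[of "enc c"] in auto)
  have 1: "run (select 1 (\<lambda>a. push_list (2 # cd a)) 5) (st (cd v) (c # w) [] []) (5 + 49) (st (cd (c
      # v)) (c # w) [] [])"
    by (rule run_select) (use Cons.prems 0 in auto)
  show ?case
    by (rule run_conv[OF run_Loop_True[OF _ _ run_Seq[OF 1 run_pop_st(2)] Cons.IH]])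
      (use Cons.prems in auto)
qed

lemma run_load:
  assumes "set w \<subseteq> {1..5}"
  shows "run load (mst w) (71 * length w + 7) (mst (cd w))"
proof -
  have 1: "run (Loop 1 (\<lambda>a. a \<noteq> 0) (Seq (select 1 (\<lambda>a. push_list (2 # cd a)) 5) (pop 1)))
     (st [1] (rev w @ []) [] []) (60 * length (rev w) + 1) (st (cd (rev (rev w) @ [])) [] [] [])"
    using run_load2[of "rev w" "[]"] assms by simp
  show ?thesis
    unfolding load_def
    by (rule run_conv[OF run_Seq[OF run_load1 run_Seq[OF run_push_st(1) 1]]]) (use assms in auto)
qed

lemma poly_time_decidable_PT:
  fixes f :: "nat list \<Rightarrow> bool"
  assumes "PT f" and f: "\<And>w. w \<in> lists {1..5} \<Longrightarrow> f w \<longleftrightarrow> w \<in> L"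
  shows "poly_time_decidable {1..5} L"
proof -
  obtain c p where g: "polyb p" "\<And>x r. run c (mst (cd x @ r)) (p (sz x)) (mst (cd (f x) @ r))"
    using assms(1) PT_E by metis
  have "polyb (\<lambda>n. 1 + (71 * n + 7) + p (12 * n + 1))"
    by (rule g(1) polyb_intros polyb_comp[of p])+
  from polyb_bound[OF this] obtain C D
    where C: "\<forall>n. 1 + (71 * n + 7) + p (12 * n + 1) \<le> C * n ^ D + C" by blast
  show ?thesis
  proof (rule poly_time_decidable_com)
    fix w :: "nat list" assume w: "w \<in> lists {1..5}"
    then have ws: "set w \<subseteq> {1..5}" by (auto simp: lists_eq_set)
    \<comment> \<open>An input symbol has a code of length at most 11, and its list cell adds
      1.\<close>
    have "sz w \<le> 12 * length w + 1" using ws by (induction w) (auto simp: sz_nat)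
    then have "p (sz w) \<le> p (12 * length w + 1)" by (rule polyb_mono[OF g(1)])
    then have "run c (mst (cd w)) (p (12 * length w + 1)) (mst (cd (f w)))"
      using g(2)[of w "[]"] by (auto intro: run_mono)
    then have "run (Seq load c) (mst w) (C * length w ^ D + C) (mst (cd (f w)))"
      by (rule run_conv[OF run_Seq[OF run_load[OF ws]] refl C[rule_format]])
    moreover have "rep (init_tapes w) (mst w)"
    proof -
      have "fst (init_tapes w ! i) (snd (init_tapes w ! i) + int n) = pad (mst w i) n" if "i < 5"
          for i n
        using that by (cases i) (auto simp: init_tapes_def input_tape_def pad_def st_def nth_Cons)
      then show ?thesis by (simp add: rep_def init_tapes_def)
    qed
    ultimately obtain t ts where t: "t \<le> C * length w ^ D + C" "rep ts (mst (cd (f w)))"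
      "(cstep ^^ t) ([Seq load c], init_tapes w) = ([], ts)"
      unfolding run_def by blast
    have "reads ts ! 0 = top (cd (f w))" using reads_rep[OF t(2), of 0] by simp
    then have "reads ts ! 0 = 2 \<longleftrightarrow> f w" by (simp add: enc_bool_def bool_tree_def)
    then show "\<exists>t ts. t \<le> C * length w ^ D + C \<and>
      (cstep ^^ t) ([Seq load c], init_tapes w) = ([], ts) \<and> (reads ts ! 0 = 2 \<longleftrightarrow> w \<in> L)"
      using t f[OF w] by blast
  qed
qed

section \<open>Derived combinators: connectives, maps, bounded quantifiers, indexing\<close>

lemma PT_not:
  assumes "PT f"
  shows "PT (\<lambda>x. \<not> f x)"
proof -
  have e: "(\<lambda>x. \<not> f x) = (\<lambda>x. if f x then False else True)" by auto
  show ?thesis unfolding e by (rule PT_If[OF assms PT_const PT_const])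
qed

lemma PT_conj:
  assumes "PT f" "PT g"
  shows "PT (\<lambda>x. f x \<and> g x)"
proof -
  have e: "(\<lambda>x. f x \<and> g x) = (\<lambda>x. if f x then g x else False)" by auto
  show ?thesis unfolding e by (rule PT_If[OF assms PT_const])
qed

lemma PT_disj:
  assumes "PT f" "PT g"
  shows "PT (\<lambda>x. f x \<or> g x)"
proof -
  have e: "(\<lambda>x. f x \<or> g x) = (\<lambda>x. if f x then True else g x)" by auto
  show ?thesis unfolding e by (rule PT_If[OF assms(1) PT_const assms(2)])
qed

text \<open>A source of the bounds that \<open>PT_fold\<close> asks for: a potential that grows by
  at most a constant multiple of the consumed element stays linear.\<close>

lemma fold_potential:
  fixes \<mu> :: "'s \<Rightarrow> nat" and xs :: "'a::enc list"
  assumes "\<And>a s. \<mu> (F a s) \<le> \<mu> s + k * (1 + sz a)"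
  shows "\<mu> (fold F xs s) \<le> \<mu> s + k * sz xs"
proof (induction xs arbitrary: s)
  case (Cons a xs)
  show ?case using Cons.IH[of "F a s"] assms[of a s] by (simp add: algebra_simps)
qed simp

lemma sz_map_le:
  assumes "\<And>a. a \<in> set xs \<Longrightarrow> sz (f a) \<le> c * sz a" "1 \<le> c"
  shows "sz (map f xs) \<le> c * sz xs"
  using assms(1)
proof (induction xs)
  case (Cons a xs)
  have "sz (f a) \<le> c * sz a" "sz (map f xs) \<le> c * sz xs" using Cons by auto
  then show ?case using assms(2) by (simp add: algebra_simps)
qed (use assms in auto)

lemma PT_rev_map:
  assumes "PT l" "PT (\<lambda>z. f (fst z) (snd z))"
  shows "PT (\<lambda>x. rev (map (\<lambda>a. f a x) (l x)))"
proof -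
  obtain p where p: "polyb p" "\<And>z. sz (f (fst z) (snd z)) \<le> p (sz z)" using PT_size[OF assms(2)]
      by blast
  obtain q where q: "polyb q" "\<And>x. sz (l x) \<le> q (sz x)" using PT_size[OF assms(1)] by blast
  have e: "fold (\<lambda>a s. f a x # s) xs s = rev (map (\<lambda>a. f a x) xs) @ s" for xs s x
    by (induction xs arbitrary: s) auto
  have "PT (\<lambda>x. fold (\<lambda>a s. f a x # s) (l x) [])"
  proof (rule PT_fold[where q = "\<lambda>n. 1 + q n * (1 + p (1 + q n + n))"])
    show "polyb (\<lambda>n. 1 + q n * (1 + p (1 + q n + n)))"
      by (rule p(1) q(1) polyb_intros polyb_comp[of p])+
    have "PT (\<lambda>z. (fst z, snd (snd z)))" by (intro PT_Pair PT_fst PT_snd PT_id)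
    from PT_comp[OF assms(2) this]
    show "PT (\<lambda>z. f (fst z) (snd (snd z)) # fst (snd z))"
      by (intro PT_Cons PT_fst PT_snd PT_id) simp
    show "sz (fold (\<lambda>a s. f a x # s) (take i (l x)) []) \<le>
        1 + q (sz x) * (1 + p (1 + q (sz x) + sz x))"
      for x i
    proof -
      let ?m = "p (1 + q (sz x) + sz x)"
      have "sz (f a x) \<le> ?m" if "a \<in> set (take i (l x))" for a
      proof -
        have "sz a \<le> q (sz x)" using sz_mem[of a "l x"] q(2)[of x] that by (auto dest: in_set_takeD)
        then have "p (sz (a, x)) \<le> ?m" by (intro polyb_mono[OF p(1)]) simp
        then show ?thesis using p(2)[of "(a, x)"] by simp
      qed
      then have "sz (rev (map (\<lambda>a. f a x) (take i (l x)))) \<le>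
          1 + length (rev (map (\<lambda>a. f a x) (take i (l x)))) * (1 + ?m)"
        by (intro sz_list_le) auto
      also have "\<dots> \<le> 1 + q (sz x) * (1 + ?m)"
        using length_le_sz[of "l x"] q(2)[of x] by (intro add_mono mult_le_mono) auto
      finally show ?thesis by (simp add: e)
    qed
  qed (use assms(1) PT_const in auto)
  then show ?thesis by (simp add: e)
qed

lemma PT_rev: "PT l \<Longrightarrow> PT (\<lambda>x. rev (l x))"
  using PT_rev_map[of l "\<lambda>a x. a"] PT_fst[OF PT_id] by simp

lemma PT_map:
  "PT l \<Longrightarrow> PT (\<lambda>z. f (fst z) (snd z)) \<Longrightarrow> PT (\<lambda>x. map (\<lambda>a. f a x) (l x))"
  using PT_rev[OF PT_rev_map] by fastforce

lemma PT_bex: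
  assumes "PT l" "PT (\<lambda>z. P (fst z) (snd z))"
  shows "PT (\<lambda>x. \<exists>a\<in>set (l x). P a x)"
proof -
  have e: "fold (\<lambda>a s. s \<or> P a x) xs s \<longleftrightarrow> s \<or> (\<exists>a\<in>set xs. P a x)" for xs s x
    by (induction xs arbitrary: s) auto
  have "PT (\<lambda>x. fold (\<lambda>a s. s \<or> P a x) (l x) False)"
  proof (rule PT_fold[where q = "\<lambda>n. 3"])
    have "PT (\<lambda>z. (fst z, snd (snd z)))" by (intro PT_Pair PT_fst PT_snd PT_id)
    from PT_comp[OF assms(2) this]
    show "PT (\<lambda>z. fst (snd z) \<or> P (fst z) (snd (snd z)))"
      by (intro PT_disj PT_fst PT_snd PT_id) simp
  qed (use assms(1) PT_const polyb_const sz_bool in auto)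
  then show ?thesis by (simp add: e)
qed

lemma PT_member: "PT f \<Longrightarrow> PT l \<Longrightarrow> PT (\<lambda>x. f x \<in> set (l x))"
proof -
  assume a: "PT f" "PT l"
  have "PT (\<lambda>x. \<exists>a\<in>set (l x). a = f x)"
    using a by (intro PT_bex PT_eq PT_fst PT_id PT_comp[OF \<open>PT f\<close>] PT_snd)
  then show ?thesis by simp
qed

lemma PT_ball_list: "(\<And>j. PT (P j)) \<Longrightarrow> PT (\<lambda>x. \<forall>j\<in>set js. P j x)"
  by (induction js) (auto intro: PT_const PT_conj)

lemma PT_bex_list: "(\<And>j. PT (P j)) \<Longrightarrow> PT (\<lambda>x. \<exists>j\<in>set js. P j x)"
  by (induction js) (auto intro: PT_const PT_disj)

lemma PT_map_list: "(\<And>j. PT (f j)) \<Longrightarrow> PT (\<lambda>x. map (\<lambda>j. f j x) js)"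
  by (induction js) (auto intro: PT_const PT_Cons)

lemma PT_length_eq0: "PT (\<lambda>xs. length xs = k)"
proof (induction k)
  case 0
  have "PT (\<lambda>xs :: 'a list. xs = [])" by (intro PT_eq PT_id PT_const)
  then show ?case by simp
next
  case (Suc k)
  have e: "(\<lambda>xs :: 'a list. length xs = Suc k) =
      (\<lambda>xs. case xs of [] \<Rightarrow> False | y # ys \<Rightarrow> length ys = k)"
    by (rule ext) (auto split: list.split)
  show ?case
    unfolding e by (rule PT_case_list[OF PT_id PT_const PT_comp[OF Suc PT_snd[OF PT_fst[OF
        PT_id]]]])
qed

lemmas PT_length_eq = PT_comp[OF PT_length_eq0]

text \<open>Indexing made total by the default \<open>[]\<close>, so that it is meaningful on
  malformed input as well.\<close>

fun nthd :: "'a list list \<Rightarrow> nat \<Rightarrow> 'a list" where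
  "nthd [] i = []"
| "nthd (x # xs) 0 = x"
| "nthd (x # xs) (Suc i) = nthd xs i"

lemma nthd_nth: "i < length xs \<Longrightarrow> nthd xs i = xs ! i"
  by (induction xs i rule: nthd.induct) auto

lemma PT_nthd0: "PT (\<lambda>xs. nthd xs i)"
proof (induction i)
  case 0
  have e: "(\<lambda>xs :: 'a list list. nthd xs 0) = (\<lambda>xs. case xs of [] \<Rightarrow> [] | y # ys \<Rightarrow> y)"
    by (auto split: list.split)
  show ?case unfolding e by (rule PT_case_list[OF PT_id PT_const PT_fst[OF PT_fst[OF PT_id]]])
next
  case (Suc i)
  have e: "(\<lambda>xs :: 'a list list. nthd xs (Suc i)) = (\<lambda>xs. case xs of [] \<Rightarrow> [] | y # ys \<Rightarrow> nthd ys i)"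
    by (auto split: list.split)
  show ?case
    unfolding e by (rule PT_case_list[OF PT_id PT_const PT_comp[OF Suc PT_snd[OF PT_fst[OF
        PT_id]]]])
qed

lemmas PT_nthd = PT_comp[OF PT_nthd0]

section \<open>The algorithm\<close>

type_synonym bits = "nat list"
type_synonym pstate = "bits \<times> bits list \<times> (bits \<times> bits) list \<times> (bits \<times> bits list) list \<times> bool"

definition okrel :: "nat list list \<Rightarrow> bits \<Rightarrow> bits list \<Rightarrow> bool" where
  "okrel es b vs \<longleftrightarrow> (\<exists>j\<in>set [0..<length es]. b = binary j \<and> length vs = length (es ! j))"

text \<open>The input is parsed from right to left. The state consists of the digits and the variables
  read since the last atom, the equations, the relational atoms, and a validity flag.\<close>

definition pstep :: "nat list list \<Rightarrow> nat \<Rightarrow> pstate \<Rightarrow> pstate" where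
  "pstep es a s =
     (if a = 1 \<or> a = 2 then
        (a # fst s, fst (snd s), fst (snd (snd s)), fst (snd (snd (snd s))),
         snd (snd (snd (snd s))) \<and> (a = 2 \<or> \<not> fst s = []))
      else if a = 3 then
        ([], fst s # fst (snd s), fst (snd (snd s)), fst (snd (snd (snd s))), snd (snd (snd (snd
            s))))
      else if a = 4 then
        ([], [], fst (snd (snd s)), (fst s, fst (snd s)) # fst (snd (snd (snd s))),
         snd (snd (snd (snd s))) \<and> okrel es (fst s) (fst (snd s)))
      else
        ([], [], (nthd (fst (snd s)) 0, nthd (fst (snd s)) 1) # fst (snd (snd s)), fst (snd (snd
            (snd s))),
         snd (snd (snd (snd s))) \<and> fst s = [] \<and> length (fst (snd s)) = 2))"

definition pinit :: pstate where
  "pinit = ([], [], [], [], True)"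

definition parse :: "nat list list \<Rightarrow> nat list \<Rightarrow> pstate" where
  "parse es w = fold (\<lambda>a s. pstep es a s) (rev w) pinit"

lemma sz_nthd: "sz (nthd xs i) \<le> sz xs"
  by (induction xs i rule: nthd.induct) auto

text \<open>The two variables of an equation are charged jointly to the list they come from.
  Charging each of them to the whole list could double the potential in one step.\<close>

lemma sz_nthd2: "sz (nthd xs 0) + sz (nthd xs 1) \<le> sz xs + 1"
proof (cases xs)
  case (Cons x ys)
  then show ?thesis using sz_nthd[of ys 0] by (cases ys) auto
qed auto

lemma PT_parse: "PT (parse es)"
proof -
  have b: "sz (fold (\<lambda>a s. pstep es a s) (take i (rev w)) pinit) \<le> 40 * sz w + 20" for w i
  proof -
    \<comment> \<open>The potential omits the flag, whose size is bounded. A step only rearranges or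
      drops what is in the state and adds the symbol read and a constant.\<close>
    define \<mu> where "\<mu> s = sz (fst s) + sz (fst (snd s)) + sz (fst (snd (snd s))) + sz (fst (snd (snd
        (snd s))))"
      for s :: pstate
    have 1: "\<mu> (pstep es a s) \<le> \<mu> s + 10 * (1 + sz a)" for a s
      using sz_nthd2[of "fst (snd s)"] sz_pos[of "fst s"] by (auto simp: pstep_def \<mu>_def)
    have 2: "\<mu> (fold (\<lambda>a s. pstep es a s) (take i (rev w)) pinit) \<le>
        \<mu> pinit + 10 * sz (take i (rev w))"
      by (rule fold_potential) (rule 1)
    have 3: "sz (take i (rev w)) \<le> sz w" using sz_take[of i "rev w"] sz_rev[of w] by simp
    have 4: "\<mu> pinit = 4" by (simp add: \<mu>_def pinit_def)
    have "sz s \<le> \<mu> s + 7" for s :: pstate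
      using sz_bool[of "snd (snd (snd (snd s)))"] by (cases s) (auto simp: \<mu>_def)
    from this[of "fold (\<lambda>a s. pstep es a s) (take i (rev w)) pinit"] 2 3 4 show ?thesis by linarith
  qed
  have ok: "PT (\<lambda>z :: nat \<times> pstate \<times> nat list.
      okrel es (fst (fst (snd z))) (fst (snd (fst (snd z)))))"
    unfolding okrel_def
    by (intro PT_bex_list PT_conj PT_length_eq PT_eq PT_fst PT_snd PT_id PT_const)
  have "PT (\<lambda>w. fold (\<lambda>a s. pstep es a s) (rev w) pinit)"
  proof (rule PT_fold[where q = "\<lambda>n. 40 * n + 20"])
    show "PT (\<lambda>z :: nat \<times> pstate \<times> nat list. pstep es (fst z) (fst (snd z)))"
      unfolding pstep_def
      by (intro ok PT_If PT_disj PT_conj PT_not PT_Pair PT_Cons PT_length_eq PT_eq PT_nthd PT_const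
          PT_fst PT_snd PT_id)
    show "polyb (\<lambda>n. 40 * n + 20)" by (rule polyb_intros)+
  qed (use b in \<open>auto intro: PT_rev PT_id PT_const\<close>)
  then show ?thesis unfolding parse_def .
qed

section \<open>Elimination of equations by substitution\<close>

definition sub :: "bits \<times> bits \<Rightarrow> bits \<Rightarrow> bits" where
  "sub p v = (if v = fst p then snd p else v)"

type_synonym estate = "(bits \<times> bits) list \<times> (bits \<times> bits list) list"

definition estep :: "estate \<Rightarrow> estate" where
  "estep s = (case fst s of [] \<Rightarrow> s | p # E \<Rightarrow>
     (map (\<lambda>q. (sub p (fst q), sub p (snd q))) E,
      map (\<lambda>q. (fst q, map (\<lambda>v. sub p v) (snd q))) (snd s)))"

definition elim_eqs :: "estate \<Rightarrow> estate" where
  "elim_eqs s = fold (\<lambda>a t. estep t) (fst s) s"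

abbreviation map_vars :: "(bits \<Rightarrow> bits) \<Rightarrow> (bits \<times> bits list) list \<Rightarrow> (bits \<times> bits list) list" where
  "map_vars g \<equiv> map (\<lambda>q. (fst q, map g (snd q)))"

abbreviation map_eqs :: "(bits \<Rightarrow> bits) \<Rightarrow> (bits \<times> bits) list \<Rightarrow> (bits \<times> bits) list" where
  "map_eqs g \<equiv> map (\<lambda>q. (g (fst q), g (snd q)))"

lemma estep_simps:
  "estep ([], L) = ([], L)"
  "estep (p # E, L) = (map_eqs (sub p) E, map_vars (sub p) L)"
  by (simp_all add: estep_def)

lemma sz_fst_snd: "sz (fst q) \<le> sz q" "sz (snd q) \<le> sz q"
  by (cases q; simp)+

text \<open>The accumulated substitution never nests: a changed variable becomes the current right
  side of an equation, which is itself an original variable of \<open>E\<close> or already small. So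
  sizes stay bounded by \<open>sz E\<close>, however many steps are made.\<close>

lemma estep_iterate:
  "\<exists>g. (estep ^^ i) (E, L) = (drop i (map_eqs g E), map_vars g L) \<and> (\<forall>v. g v = v \<or> sz (g v) \<le> sz E)"
proof (induction i)
  case 0
  show ?case by (intro exI[of _ "\<lambda>v. v"]) simp
next
  case (Suc i)
  then obtain g where g: "(estep ^^ i) (E, L) = (drop i (map_eqs g E), map_vars g L)"
    "\<And>v. g v = v \<or> sz (g v) \<le> sz E" by blast
  show ?case
  proof (cases "drop i (map_eqs g E)")
    case Nil
    then have "drop (Suc i) (map_eqs g E) = []" by simp
    then show ?thesis using g Nil by (intro exI[of _ g]) (simp add: estep_simps)
  next
    case (Cons p E')
    have E': "E' = drop (Suc i) (map_eqs g E)" using Cons by (metis drop_Suc drop_tl list.sel(3))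
    have "p \<in> set (map_eqs g E)" using Cons by (metis in_set_dropD list.set_intros(1))
    then obtain q where q: "q \<in> set E" "p = (g (fst q), g (snd q))" by auto
    have "sz (snd q) \<le> sz E" using q sz_mem[of q E] sz_fst_snd(2)[of q] by simp
    then have "sz (snd p) \<le> sz E" using g(2)[of "snd q"] q by auto
    then have "sub p (g v) = v \<or> sz (sub p (g v)) \<le> sz E" for v
      using g(2)[of v] by (auto simp: sub_def)
    then show ?thesis
      using g(1) Cons E' by (intro exI[of _ "\<lambda>v. sub p (g v)"]) (simp add: estep_simps drop_map
          comp_def)
  qed
qed

lemma fold_estep: "fold (\<lambda>a t. estep t) xs s = (estep ^^ length xs) s"
  by (induction xs arbitrary: s) (simp_all add: funpow_swap1)

lemma PT_elim_eqs: "PT elim_eqs"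
proof -
  have b: "sz ((estep ^^ i) s) \<le> 1 + (sz s * sz s + sz s * sz s)" for i s
  proof -
    obtain E L where s: "s = (E, L)" by fastforce
    obtain g where g: "(estep ^^ i) (E, L) = (drop i (map_eqs g E), map_vars g L)"
      "\<And>v. g v = v \<or> sz (g v) \<le> sz E" using estep_iterate[of i E L] by blast
    let ?c = "sz E"
    have c: "1 \<le> ?c" by (rule sz_pos)
    have v: "sz (g v) \<le> ?c * sz v" for v
    proof -
      have "sz v \<le> ?c * sz v" using c by simp
      moreover have "?c \<le> ?c * sz v" using sz_pos[of v] by simp
      ultimately show ?thesis using g(2)[of v] by (metis le_trans)
    qed
    have "sz (drop i (map_eqs g E)) \<le> sz (map_eqs g E)"
      using sz_append[of "take i (map_eqs g E)" "drop i (map_eqs g E)"] sz_pos[of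
          "take i (map_eqs g E)"]
      by simp
    also have "\<dots> \<le> ?c * sz E"
    proof (rule sz_map_le[OF _ c])
      show "sz (g (fst q), g (snd q)) \<le> ?c * sz q" for q
        using v[of "fst q"] v[of "snd q"] c by (cases q) (simp add: algebra_simps)
    qed
    also have "\<dots> \<le> sz s * sz s" unfolding s by (intro mult_le_mono) simp_all
    finally have 1: "sz (drop i (map_eqs g E)) \<le> sz s * sz s" .
    have "sz (map_vars g L) \<le> ?c * sz L"
    proof (rule sz_map_le[OF _ c])
      show "sz (fst q, map g (snd q)) \<le> ?c * sz q" for q :: "bits \<times> bits list"
      proof (cases q)
        case (Pair x ys)
        have "sz (map g ys) \<le> ?c * sz ys" by (rule sz_map_le[OF v c])
        moreover have "sz x \<le> ?c * sz x" using c by simp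
        ultimately have "1 + sz x + sz (map g ys) \<le> ?c * 1 + ?c * sz x + ?c * sz ys" using c
            by linarith
        then show ?thesis by (simp add: Pair distrib_left)
      qed
    qed
    also have "\<dots> \<le> sz s * sz s" unfolding s by (intro mult_le_mono) simp_all
    finally show ?thesis using 1 by (simp add: s g(1))
  qed
  have "PT (\<lambda>s. fold (\<lambda>a t. estep t) (fst s) s)"
  proof (rule PT_fold[where q = "\<lambda>n. 1 + (n * n + n * n)"])
    show "PT (\<lambda>z :: (bits \<times> bits) \<times> estate \<times> estate. estep (fst (snd z)))"
      unfolding estep_def sub_def
      by (intro PT_case_list PT_Pair PT_map PT_If PT_eq PT_fst PT_snd PT_id)
    show "polyb (\<lambda>n. 1 + (n * n + n * n))" by (rule polyb_intros)+
  qed (use b in \<open>auto simp: fold_estep intro: PT_id PT_fst0\<close>)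
  then show ?thesis unfolding elim_eqs_def .
qed

definition sat :: "(nat \<Rightarrow> nat list set) \<Rightarrow> estate \<Rightarrow> bool" where
  "sat R t \<longleftrightarrow> (\<exists>s :: bits \<Rightarrow> nat. (\<forall>q\<in>set (fst t). s (fst q) = s (snd q)) \<and>
     (\<forall>q\<in>set (snd t). \<exists>j. fst q = binary j \<and> map s (snd q) \<in> R j))"

text \<open>Composition with the substitution turns a solution after the step into one before it.
  Conversely, a solution gives both sides of the eliminated equation the same value, so the
  substitution does not affect it.\<close>

lemma sat_estep: "sat R (estep t) \<longleftrightarrow> sat R t"
proof (cases "fst t")
  case Nil
  then show ?thesis by (simp add: estep_def)
next
  case (Cons p E)
  then have e: "estep t = (map_eqs (sub p) E, map_vars (sub p) (snd t))" by (simp add: estep_def)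
  show ?thesis
  proof
    assume "sat R (estep t)"
    then obtain s where s: "\<forall>q\<in>set E. s (sub p (fst q)) = s (sub p (snd q))"
      "\<forall>q\<in>set (snd t). \<exists>j. fst q = binary j \<and> map (s \<circ> sub p) (snd q) \<in> R j"
      unfolding sat_def e by auto
    then show "sat R t"
      unfolding sat_def by (intro exI[of _ "s \<circ> sub p"]) (auto simp: Cons sub_def)
  next
    assume "sat R t"
    then obtain s where s: "\<forall>q\<in>set (fst t). s (fst q) = s (snd q)"
      "\<forall>q\<in>set (snd t). \<exists>j. fst q = binary j \<and> map s (snd q) \<in> R j"
      unfolding sat_def by auto
    have "s (sub p v) = s v" for v using s(1) Cons by (simp add: sub_def)
    then show "sat R (estep t)"
      unfolding sat_def e using s Cons by (intro exI[of _ s]) (auto simp: comp_def)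
  qed
qed

lemma sat_elim_eqs: "sat R (elim_eqs t) \<longleftrightarrow> sat R t"
proof -
  have "sat R ((estep ^^ i) t) \<longleftrightarrow> sat R t" for i by (induction i) (auto simp: sat_estep)
  then show ?thesis by (simp add: elim_eqs_def fold_estep)
qed

lemma fst_elim_eqs: "fst (elim_eqs t) = []"
proof (cases t)
  case (Pair E L)
  then show ?thesis using estep_iterate[of "length E" E L] by (auto simp: elim_eqs_def fold_estep)
qed

lemma elim_eqs_names:
  "(\<lambda>q. (fst q, length (snd q))) ` set (snd (elim_eqs t)) =
    (\<lambda>q. (fst q, length (snd q))) ` set (snd t)"
proof (cases t)
  case (Pair E L)
  then show ?thesis
    using estep_iterate[of "length E" E L] by (force simp: elim_eqs_def fold_estep image_image)
qed

section \<open>Search for a copy of the forbidden structure\<close>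

fun search :: "nat list list \<Rightarrow> nat \<Rightarrow> bits list \<Rightarrow> (bits \<times> bits list) list \<Rightarrow> bool" where
  "search es 0 hs L \<longleftrightarrow>
     (\<forall>j\<in>set [0..<length es]. (binary j, map (\<lambda>v. nthd hs v) (es ! j)) \<in> set L)"
| "search es (Suc n) hs L \<longleftrightarrow> (\<exists>q\<in>set L. \<exists>v\<in>set (snd q). search es n (v # hs) L)"

text \<open>The depth \<open>n\<close> is a constant of the problem, so the induction builds a fixed
  number of nested bounded quantifiers.\<close>

lemma PT_search: "PT (\<lambda>z. search es n (fst z) (snd z))"
proof (induction n)
  case 0
  show ?case
    unfolding search.simps
    by (intro PT_ball_list PT_member PT_Pair PT_const PT_map_list PT_nthd PT_fst PT_snd PT_id)
next
  case (Suc n)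
  have "PT (\<lambda>z :: bits \<times> (bits \<times> bits list) \<times> bits list \<times> (bits \<times> bits list) list.
      (fst z # fst (snd (snd z)), snd (snd (snd z))))"
    by (intro PT_Pair PT_Cons PT_fst PT_snd PT_id)
  from PT_comp[OF Suc this] have "PT (\<lambda>z :: bits \<times> (bits \<times> bits list) \<times> bits list \<times> (bits \<times> bits
      list) list.
      search es n (fst z # fst (snd (snd z))) (snd (snd (snd z))))" by simp
  then show ?case
    unfolding search.simps by (intro PT_bex PT_fst PT_snd PT_id)
qed

lemma search_iff:
  "search es n hs L \<longleftrightarrow>
     (\<exists>vs. length vs = n \<and> set vs \<subseteq> (\<Union>q\<in>set L. set (snd q)) \<and> search es 0 (vs @ hs) L)"
proof (induction n arbitrary: hs)
  case (Suc n)
  let ?U = "\<Union>q\<in>set L. set (snd q)"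
  have "search es (Suc n) hs L \<longleftrightarrow> (\<exists>v\<in>?U. search es n (v # hs) L)" by auto
  also have "\<dots> \<longleftrightarrow> (\<exists>v\<in>?U. \<exists>vs. length vs = n \<and> set vs \<subseteq> ?U \<and> search es 0 (vs @ v # hs) L)"
    using Suc by simp
  also have "\<dots> \<longleftrightarrow> (\<exists>vs. length vs = Suc n \<and> set vs \<subseteq> ?U \<and> search es 0 (vs @ hs) L)"
  proof
    assume "\<exists>v\<in>?U. \<exists>vs. length vs = n \<and> set vs \<subseteq> ?U \<and> search es 0 (vs @ v # hs) L"
    then obtain v vs where "v \<in> ?U" "length vs = n" "set vs \<subseteq> ?U" "search es 0 (vs @ v # hs) L"
        by blast
    then show "\<exists>vs. length vs = Suc n \<and> set vs \<subseteq> ?U \<and> search es 0 (vs @ hs) L"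
      by (intro exI[of _ "vs @ [v]"]) (auto simp del: search.simps)
  next
    assume "\<exists>vs. length vs = Suc n \<and> set vs \<subseteq> ?U \<and> search es 0 (vs @ hs) L"
    then obtain us where us: "length us = Suc n" "set us \<subseteq> ?U" "search es 0 (us @ hs) L" by blast
    then obtain vs v where "us = vs @ [v]" by (cases us rule: rev_cases) auto
    then show "\<exists>v\<in>?U. \<exists>vs. length vs = n \<and> set vs \<subseteq> ?U \<and> search es 0 (vs @ v # hs) L"
      using us by (intro bexI[of _ v] exI[of _ vs]) (auto simp del: search.simps)
  qed
  finally show ?case .
qed auto

text \<open>Every vertex lies on an edge, so its image occurs in some atom and it is enough to
  search through the variables of the atoms.\<close>

lemma search_match:
  assumes "(\<Union>j<length es. set (es ! j)) = {..<N}"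
  shows "search es N [] L \<longleftrightarrow> (\<exists>h. \<forall>j<length es. (binary j, map h (es ! j)) \<in> set L)"
proof
  assume "search es N [] L"
  then obtain vs where "search es 0 vs L" using search_iff[of es N "[]" L] by auto
  then show "\<exists>h. \<forall>j<length es. (binary j, map h (es ! j)) \<in> set L"
      by (intro exI[of _ "nthd vs"]) simp
next
  assume "\<exists>h. \<forall>j<length es. (binary j, map h (es ! j)) \<in> set L"
  then obtain h where h: "\<And>j. j < length es \<Longrightarrow> (binary j, map h (es ! j)) \<in> set L" by blast
  let ?vs = "map h [0..<N]"
  have n: "nthd ?vs v = h v" if "v < N" for v using nthd_nth[of v ?vs] that by simp
  have m: "map (\<lambda>v. nthd ?vs v) (es ! j) = map h (es ! j)" if "j < length es" for j
    using n assms that by (intro map_cong) auto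
  have "search es 0 ?vs L"
    unfolding search.simps
  proof
    fix j assume "j \<in> set [0..<length es]"
    then have j: "j < length es" by simp
    show "(binary j, map (\<lambda>v. nthd ?vs v) (es ! j)) \<in> set L" unfolding m[OF j] by (rule h[OF j])
  qed
  moreover have "h v \<in> (\<Union>q\<in>set L. set (snd q))" if v: "v < N" for v
  proof -
    obtain j where "j < length es" "v \<in> set (es ! j)" using assms v by blast
    then show ?thesis using h[of j] by force
  qed
  ultimately show "search es N [] L"
    using search_iff[of es N "[]" L] by (auto intro!: exI[of _ ?vs] simp del: search.simps)
qed

definition decide_csp :: "nat list list \<Rightarrow> nat \<Rightarrow> nat list \<Rightarrow> bool" where
  "decide_csp es N w \<longleftrightarrow> snd (snd (snd (snd (parse es w)))) \<and> fst (parse es w) = [] \<and>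
     fst (snd (parse es w)) = [] \<and>
     \<not> search es N []
         (snd (elim_eqs (fst (snd (snd (parse es w))), fst (snd (snd (snd (parse es w)))))))"

lemma PT_decide_csp: "PT (decide_csp es N)"
proof -
  have "PT (\<lambda>w. (([] :: bits list),
      snd (elim_eqs (fst (snd (snd (parse es w))), fst (snd (snd (snd (parse es w))))))))"
    by (intro PT_Pair PT_const PT_snd PT_comp[OF PT_elim_eqs] PT_fst PT_parse)
  from PT_comp[OF PT_search this] have "PT (\<lambda>w. search es N []
      (snd (elim_eqs (fst (snd (snd (parse es w))), fst (snd (snd (snd (parse es w))))))))" by simp
  then have "PT (\<lambda>w. decide_csp es N w)"
    unfolding decide_csp_def by (intro PT_conj PT_not PT_eq PT_const PT_fst PT_snd PT_parse)
  then show ?thesis .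
qed

section \<open>Correctness of the parser and of the decision procedure\<close>

fun eqs :: "nat atom list \<Rightarrow> (bits \<times> bits) list" where
  "eqs [] = []"
| "eqs (AEq x y # \<Phi>) = (binary x, binary y) # eqs \<Phi>"
| "eqs (ARel r xs # \<Phi>) = eqs \<Phi>"

fun rels :: "nat atom list \<Rightarrow> (bits \<times> bits list) list" where
  "rels [] = []"
| "rels (AEq x y # \<Phi>) = rels \<Phi>"
| "rels (ARel r xs # \<Phi>) = (binary r, map binary xs) # rels \<Phi>"

fun aok :: "nat list list \<Rightarrow> nat atom \<Rightarrow> bool" where
  "aok es (AEq x y) = True"
| "aok es (ARel r xs) = (r < length es \<and> length xs = length (es ! r))"

lemma parse_Nil: "parse es [] = pinit"
  by (simp add: parse_def)

lemma parse_Cons: "parse es (a # w) = pstep es a (parse es w)"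
  by (simp add: parse_def)

lemma binary_0: "binary 0 = []"
  by (simp add: binary.simps)

lemma binary_eq_Nil: "binary n = [] \<longleftrightarrow> n = 0"
  by (subst binary.simps) simp

text \<open>Reading from the right starts with the most significant digit. In
  \<open>binary n\<close> this digit is never zero, and that is what the validity flag
  checks.\<close>

lemma parse_binary:
  "parse es w = ([], vs, E, L, ok) \<Longrightarrow> parse es (binary n @ w) = (binary n, vs, E, L, ok)"
proof (induction n rule: less_induct)
  case (less n)
  show ?case
  proof (cases "n = 0")
    case True
    then show ?thesis using less by (simp add: binary_0)
  next
    case False
    then have b: "binary n = (if even n then 1 else 2) # binary (n div 2)"
        by (subst binary.simps) simp
    have "parse es (binary (n div 2) @ w) = (binary (n div 2), vs, E, L, ok)"
      using False by (intro less) auto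
    moreover have "even n \<Longrightarrow> n div 2 \<noteq> 0" using False by auto
    ultimately show ?thesis unfolding b by (auto simp: parse_Cons pstep_def binary_eq_Nil)
  qed
qed

lemma parse_vars:
  "parse es w = ([], vs, E, L, ok) \<Longrightarrow>
     parse es (concat (map (\<lambda>x. 3 # binary x) xs) @ w) = ([], map binary xs @ vs, E, L, ok)"
proof (induction xs)
  case (Cons x xs)
  show ?case using parse_binary[OF Cons.IH[OF Cons.prems], of x] by (simp add: parse_Cons pstep_def)
qed simp

lemma parse_encode:
  "\<forall>a\<in>set \<Phi>. aok es a \<Longrightarrow> parse es (encode_instance \<Phi>) = ([], [], eqs \<Phi>, rels \<Phi>, True)"
proof (induction \<Phi>)
  case Nil
  then show ?case by (simp add: encode_instance_def parse_Nil pinit_def)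
next
  case (Cons a \<Phi>)
  have IH: "parse es (encode_instance \<Phi>) = ([], [], eqs \<Phi>, rels \<Phi>, True)" using Cons by simp
  have e: "encode_instance (a # \<Phi>) = encode_atom a @ encode_instance \<Phi>"
      by (simp add: encode_instance_def)
  show ?case
  proof (cases a)
    case (AEq x y)
    have "parse es (concat (map (\<lambda>x. 3 # binary x) [x, y]) @ encode_instance \<Phi>) =
       ([], map binary [x, y] @ [], eqs \<Phi>, rels \<Phi>, True)" by (rule parse_vars[OF IH])
    then show ?thesis unfolding AEq e[unfolded AEq] by (simp add: parse_Cons pstep_def)
  next
    case (ARel r xs)
    have "okrel es (binary r) (map binary xs)"
      using Cons.prems ARel by (auto simp: okrel_def)
    moreover have "parse es (binary r @ concat (map (\<lambda>x. 3 # binary x) xs) @ encode_instance \<Phi>) =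
       (binary r, map binary xs @ [], eqs \<Phi>, rels \<Phi>, True)"
      by (rule parse_binary[OF parse_vars[OF IH]])
    ultimately show ?thesis unfolding ARel e[unfolded ARel] by (simp add: parse_Cons pstep_def)
  qed
qed

text \<open>The invariant must describe suffixes that begin in the middle of an atom: a number
  \<open>m\<close> and variables \<open>xs\<close> that no atom has claimed yet, followed by a
  complete instance.\<close>

lemma parse_sound:
  assumes "set w \<subseteq> {1..5}" "parse es w = (b, vs, E, L, True)"
  shows "\<exists>\<Phi> m xs. (\<forall>a\<in>set \<Phi>. aok es a) \<and> b = binary m \<and> vs = map binary xs \<and>
    E = eqs \<Phi> \<and> L = rels \<Phi> \<and> w = binary m @ concat (map (\<lambda>x. 3 # binary x) xs) @ encode_instance \<Phi>"
  using assms
proof (induction w arbitrary: b vs E L)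
  case Nil
  then show ?case
    by (intro exI[of _ "[]"] exI[of _ 0])
      (simp add: parse_Nil pinit_def binary_0 encode_instance_def)
next
  case (Cons a w)
  obtain b0 vs0 E0 L0 ok where p: "parse es w = (b0, vs0, E0, L0, ok)" by (metis prod_cases5)
  have ok: ok and st: "pstep es a (b0, vs0, E0, L0, True) = (b, vs, E, L, True)"
    using Cons.prems(2) p by (auto simp: parse_Cons pstep_def split: if_splits)
  obtain \<Phi> m xs where IH: "\<forall>a\<in>set \<Phi>. aok es a" "b0 = binary m" "vs0 = map binary xs"
    "E0 = eqs \<Phi>" "L0 = rels \<Phi>" "w = binary m @ concat (map (\<lambda>x.
      3 # binary x) xs) @ encode_instance \<Phi>"
    using Cons.IH[of b0 vs0 E0 L0] Cons.prems(1) p ok by auto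
  have a: "a \<in> {1..5}" using Cons.prems by simp
  then consider "a = 1 \<or> a = 2" | "a = 3" | "a = 4" | "a = 5" by fastforce
  then show ?case
  proof cases
    case 1
    then have b: "b = a # binary m" "a = 2 \<or> m \<noteq> 0" "vs = vs0" "E = E0" "L = L0"
      using st IH by (auto simp: pstep_def binary_eq_Nil split: if_splits)
    \<comment> \<open>A new lowest digit doubles the number; a symbol is its digit plus 1.\<close>
    have "a # binary m = binary (2 * m + (a - 1))"
      using 1 b(2) by (subst (2) binary.simps) auto
    then show ?thesis
      using b IH by (intro exI[of _ \<Phi>] exI[of _
          "2 * m + (a - 1)"] exI[of _ xs]) (auto simp flip: append_Cons)
  next
    case 2
    then show ?thesis
      using st IH by (intro exI[of _ \<Phi>] exI[of _ 0] exI[of _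
          "m # xs"]) (auto simp: pstep_def binary_0)
  next
    case 3
    then have 3: "b = []" "vs = []" "E = E0" "L = (binary m, vs0) # L0" "okrel es (binary m) vs0"
        "a = 4"
      using st IH by (auto simp: pstep_def)
    then obtain j where j: "j < length es" "binary m = binary j" "length xs = length (es ! j)"
      using IH by (auto simp: okrel_def)
    show ?thesis
      using IH 3 j
      by (intro exI[of _ "ARel j xs # \<Phi>"] exI[of _ 0] exI[of _
          "[]"]) (auto simp: binary_0 encode_instance_def)
  next
    case 4
    then have 4: "b = []" "vs = []" "E = (nthd vs0 0, nthd vs0 1) # E0" "L = L0" "m = 0"
        "length xs = 2" "a = 5"
      using st IH by (auto simp: pstep_def binary_eq_Nil)
    then obtain x y where "xs = [x, y]" by (auto simp: length_Suc_conv numeral_2_eq_2)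
    then show ?thesis
      using IH 4
      by (intro exI[of _ "AEq x y # \<Phi>"] exI[of _ 0] exI[of _
          "[]"]) (auto simp: binary_0 encode_instance_def)
  qed
qed

lemma inj_binary: "inj binary"
proof (rule injI)
  show "binary x = binary y \<Longrightarrow> x = y" for x y
  proof (induction x arbitrary: y rule: less_induct)
    case (less x)
    show ?case
    proof (cases "x = 0 \<or> y = 0")
      case True
      then show ?thesis using less.prems binary_eq_Nil binary_0 by metis
    next
      case False
      then have e: "(if even x then 1 else 2::nat) # binary (x div 2) =
          (if even y then 1 else 2) # binary (y div 2)"
        using less.prems binary.simps[of x] binary.simps[of y] by simp
      then have "x div 2 = y div 2" using False by (intro less.IH) auto
      moreover have "even x = even y" using e by (auto split: if_splits)
      ultimately show ?thesis by (metis even_two_times_div_two odd_two_times_div_two_succ)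
    qed
  qed
qed

lemma binary_inject: "binary x = binary y \<longleftrightarrow> x = y"
  using inj_binary by (auto dest: injD)

lemma sat_instance:
  "sat R (eqs \<Phi>, rels \<Phi>) \<longleftrightarrow>
     (\<exists>s. \<forall>a\<in>set \<Phi>. case a of AEq x y \<Rightarrow> s x = s y | ARel r xs \<Rightarrow> map s xs \<in> R r)"
proof -
  have 1: "(\<forall>q\<in>set (eqs \<Phi>). s (fst q) = s (snd q)) \<and>
      (\<forall>q\<in>set (rels \<Phi>). \<exists>j. fst q = binary j \<and> map s (snd q) \<in> R j) \<longleftrightarrow>
      (\<forall>a\<in>set \<Phi>. case a of AEq x y \<Rightarrow> (s \<circ> binary) x = (s \<circ> binary) y
         | ARel r xs \<Rightarrow> map (s \<circ> binary) xs \<in> R r)" for s :: "bits \<Rightarrow> nat"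
    by (induction \<Phi> rule: eqs.induct) (auto simp: binary_inject)
  have 2: "(s \<circ> inv binary) \<circ> binary = s" for s :: "nat \<Rightarrow> nat"
    using inj_binary by (simp add: comp_def)
  show ?thesis
    unfolding sat_def fst_conv snd_conv 1 using 2 by metis
qed

text \<open>The assumptions \<open>free\<close> and \<open>hom\<close> make the structure of
  \<open>es\<close> the only obstruction. An instance without equations is a structure on its
  variables, and it is solvable if and only if the search for the obstruction fails.\<close>

theorem csp_poly_time_forbidden:
  fixes es :: "nat list list" and B :: "(nat, nat) rel_struct"
  assumes V: "(\<Union>j<length es. set (es ! j)) = {..<N}"
    and B: "universe B = UNIV" "sig B = {..<length es}"
        "\<And>j. j < length es \<Longrightarrow> arity B j = length (es ! j)"
    and free: "\<not> (\<exists>h. \<forall>j<length es. map h (es ! j) \<in> rel B j)"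
    and hom: "\<And>R :: nat \<Rightarrow> nat list set. \<not> (\<exists>h. \<forall>j<length es. map h (es ! j) \<in> R j) \<Longrightarrow>
       (\<And>j t. j < length es \<Longrightarrow> t \<in> R j \<Longrightarrow> length t = length (es ! j)) \<Longrightarrow>
       \<exists>g. \<forall>j<length es. \<forall>t\<in>R j. map g t \<in> rel B j"
  shows "csp_poly_time B"
  unfolding csp_poly_time_def
proof
  show "finite (sig B)" by (simp add: B)
  have wf: "atom_wf B a \<longleftrightarrow> aok es a" for a by (cases a) (auto simp: B)
  have sat_B: "csp_satisfiable B \<Phi> \<longleftrightarrow> sat (rel B) (eqs \<Phi>, rels \<Phi>)" for \<Phi>
  proof -
    have "atom_holds B s a \<longleftrightarrow> (case a of AEq x y \<Rightarrow> s x = s y | ARel r xs \<Rightarrow> map s xs \<in> rel B r)"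
        for s a
      by (cases a) auto
    then show ?thesis unfolding csp_satisfiable_def sat_instance by (simp add: B)
  qed
  have names: "\<forall>q\<in>set (rels \<Phi>). \<exists>j<length es. fst q = binary j \<and> length (snd q) = length (es ! j)"
      if "\<forall>a\<in>set \<Phi>. aok es a" for \<Phi>
    using that by (induction \<Phi> rule: rels.induct) auto
  have sat_match: "sat (rel B) ([], L) \<longleftrightarrow> \<not> (\<exists>h. \<forall>j<length es. (binary j, map h (es ! j)) \<in> set L)"
    if L: "\<forall>q\<in>set L. \<exists>j<length es. fst q = binary j \<and> length (snd q) = length (es ! j)" for L
  proof
    assume "sat (rel B) ([], L)"
    then obtain s where s: "\<forall>q\<in>set L. \<exists>j. fst q = binary j \<and> map s (snd q) \<in> rel B j"
      by (auto simp: sat_def)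
    show "\<not> (\<exists>h. \<forall>j<length es. (binary j, map h (es ! j)) \<in> set L)"
    proof
      assume "\<exists>h. \<forall>j<length es. (binary j, map h (es ! j)) \<in> set L"
      then obtain h where h: "\<And>j. j < length es \<Longrightarrow> (binary j, map h (es ! j)) \<in> set L" by blast
      have "map (s \<circ> h) (es ! j) \<in> rel B j" if "j < length es" for j
        using s h[OF that] by (fastforce simp: binary_inject)
      then show False using free by blast
    qed
  next
    assume no: "\<not> (\<exists>h. \<forall>j<length es. (binary j, map h (es ! j)) \<in> set L)"
    \<comment> \<open>The atoms as a structure on the natural numbers, the domain that
      \<open>hom\<close> speaks about.\<close>
    define R where "R j = {map to_nat xs | xs. (binary j, xs) \<in> set L}" for j
    have "\<not> (\<exists>h. \<forall>j<length es. map h (es ! j) \<in> R j)"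
    proof
      assume "\<exists>h. \<forall>j<length es. map h (es ! j) \<in> R j"
      then obtain h where h: "\<And>j. j < length es \<Longrightarrow> map h (es ! j) \<in> R j" by blast
      have "(binary j, map (from_nat \<circ> h) (es ! j)) \<in> set L" if j: "j < length es" for j
      proof -
        obtain xs :: "bits list" where xs: "map h (es ! j) = map to_nat xs" "(binary j, xs) \<in> set L"
          using h[OF j] by (auto simp: R_def)
        have "map (from_nat \<circ> h) (es ! j) = map from_nat (map h (es ! j))" by simp
        also have "\<dots> = xs" by (simp add: xs comp_def)
        finally show ?thesis using xs by simp
      qed
      then show False using no by blast
    qed
    moreover have "length t = length (es ! j)" if t: "t \<in> R j" for j t
    proof -
      obtain xs :: "bits list" where xs: "t = map to_nat xs" "(binary j, xs) \<in> set L"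
        using t by (auto simp: R_def)
      then show ?thesis using L by (force simp: binary_inject)
    qed
    ultimately obtain g where g: "\<And>j t. j < length es \<Longrightarrow> t \<in> R j \<Longrightarrow> map g t \<in> rel B j" using hom[of R]
        by blast
    have "\<exists>j. fst q = binary j \<and> map (g \<circ> to_nat) (snd q) \<in> rel B j" if q: "q \<in> set L" for q
    proof -
      obtain j where j: "j < length es" "fst q = binary j" using L q by blast
      then have "map to_nat (snd q) \<in> R j" using q
          by (auto simp: R_def intro!: exI[of _ "snd q"] simp flip: j(2))
      then show ?thesis using g[OF j(1)] j by (intro exI[of _ j]) fastforce
    qed
    then show "sat (rel B) ([], L)" unfolding sat_def by (intro exI[of _ "g \<circ> to_nat"]) simp
  qed
  have dec: "\<not> search es N [] (snd (elim_eqs (eqs \<Phi>, rels \<Phi>))) \<longleftrightarrow> csp_satisfiable B \<Phi>"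
    if "\<forall>a\<in>set \<Phi>. aok es a" for \<Phi>
  proof -
    let ?t = "elim_eqs (eqs \<Phi>, rels \<Phi>)"
    have t: "?t = ([], snd ?t)" using fst_elim_eqs[of "(eqs \<Phi>, rels \<Phi>)"] by (metis prod.collapse)
    have "\<forall>b\<in>(\<lambda>q. (fst q, length (snd q))) ` set (snd ?t). \<exists>j<length es. fst b = binary j \<and>
        snd b = length (es ! j)"
      unfolding elim_eqs_names using names[OF that] by auto
    then have "sat (rel B) ([], snd ?t) \<longleftrightarrow> \<not> search es N [] (snd ?t)"
      unfolding search_match[OF V] by (intro sat_match) auto
    then show ?thesis unfolding sat_B using sat_elim_eqs[of "rel B" "(eqs \<Phi>, rels \<Phi>)"] t by simp
  qed
  show "poly_time_decidable {1..5} (CSP B)"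
  proof (rule poly_time_decidable_PT[OF PT_decide_csp[of es N]])
    fix w :: "nat list" assume w: "w \<in> lists {1..5}"
    show "decide_csp es N w \<longleftrightarrow> w \<in> CSP B"
    proof
      assume d: "decide_csp es N w"
      obtain E L where p: "parse es w = ([], [], E, L, True)"
        using d unfolding decide_csp_def by (metis prod.collapse)
      obtain \<Phi> m xs where P: "\<forall>a\<in>set \<Phi>. aok es a" "[] = binary m" "[] = map binary xs" "E = eqs \<Phi>"
          "L = rels \<Phi>"
        "w = binary m @ concat (map (\<lambda>x. 3 # binary x) xs) @ encode_instance \<Phi>"
        using parse_sound[OF _ p] w by (auto simp: lists_eq_set)
      have "w = encode_instance \<Phi>" using P by simp
      moreover have "csp_satisfiable B \<Phi>"
      proof -
        have "\<not> search es N [] (snd (elim_eqs (E, L)))" using d by (simp add: decide_csp_def p)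
        then show ?thesis using dec[OF P(1)] P(4,5) by simp
      qed
      ultimately show "w \<in> CSP B" using P(1) by (auto simp: CSP_def csp_instance_def wf)
    next
      assume "w \<in> CSP B"
      then obtain \<Phi> where P: "w = encode_instance \<Phi>" "\<forall>a\<in>set \<Phi>. aok es a" "csp_satisfiable B \<Phi>"
        by (auto simp: CSP_def csp_instance_def wf)
      then show "decide_csp es N w" using dec[OF P(2)] parse_encode[OF P(2)]
          by (simp add: decide_csp_def)
    qed
  qed
qed

section \<open>Fraisse limits\<close>

type_synonym interp = "nat \<Rightarrow> nat list set"

definition pull :: "(nat \<Rightarrow> nat) \<Rightarrow> interp \<Rightarrow> interp" where
  "pull g \<rho> r = {t. map g t \<in> \<rho> r}"

lemma tuples_mono: "D \<subseteq> E \<Longrightarrow> tuples D n \<subseteq> tuples E n"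
  by (auto simp: tuples_def)

text \<open>\<open>K D \<rho>\<close> depends only on the tuples over \<open>D\<close>, which may be
  infinite. Closure under \<open>pull\<close> covers renaming of points, by maps that may even
  identify some. \<open>K_local\<close> says that membership is decided by parts of at most
  \<open>bound\<close> points, and \<open>K_amalg\<close> amalgamates without identifying points
  outside the intersection.\<close>

locale amalgamation_class =
  fixes sg :: "nat set" and ar :: "nat \<Rightarrow> nat" and K :: "nat set \<Rightarrow> interp \<Rightarrow> bool" and bound :: nat
  assumes fin_sg: "finite sg" and ar_pos: "r \<in> sg \<Longrightarrow> 1 \<le> ar r"
    and K_cong: "(\<And>r t. r \<in> sg \<Longrightarrow> t \<in> tuples D (ar r) \<Longrightarrow> t \<in> \<rho> r \<longleftrightarrow> t \<in> \<rho>' r) \<Longrightarrow> K D \<rho> \<Longrightarrow> K D \<rho>'"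
    and K_sub: "K D \<rho> \<Longrightarrow> E \<subseteq> D \<Longrightarrow> K E \<rho>"
    and K_pull: "K (g ` D) \<rho> \<Longrightarrow> K D (pull g \<rho>)"
    and K_empty: "K D (\<lambda>r. {})"
    and K_local: "(\<And>S. S \<subseteq> D \<Longrightarrow> S \<noteq> {} \<Longrightarrow> finite S \<Longrightarrow> card S \<le> bound \<Longrightarrow> K S \<rho>) \<Longrightarrow> K D \<rho>"
    and K_amalg: "finite D \<Longrightarrow> finite E \<Longrightarrow> K D \<rho> \<Longrightarrow> K E \<sigma> \<Longrightarrow>
      (\<And>r t. r \<in> sg \<Longrightarrow> t \<in> tuples (D \<inter> E) (ar r) \<Longrightarrow> t \<in> \<rho> r \<longleftrightarrow> t \<in> \<sigma> r) \<Longrightarrow>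
      \<exists>\<tau>. K (D \<union> E) \<tau> \<and> (\<forall>r\<in>sg. \<forall>t\<in>tuples D (ar r). t \<in> \<tau> r \<longleftrightarrow> t \<in> \<rho> r) \<and>
        (\<forall>r\<in>sg. \<forall>t\<in>tuples E (ar r). t \<in> \<tau> r \<longleftrightarrow> t \<in> \<sigma> r)"
begin

definition agree :: "nat set \<Rightarrow> interp \<Rightarrow> interp \<Rightarrow> bool" where
  "agree D \<rho> \<rho>' \<longleftrightarrow> (\<forall>r\<in>sg. \<forall>t\<in>tuples D (ar r). t \<in> \<rho> r \<longleftrightarrow> t \<in> \<rho>' r)"

lemma agreeD: "agree D \<rho> \<rho>' \<Longrightarrow> r \<in> sg \<Longrightarrow> t \<in> tuples D (ar r) \<Longrightarrow> t \<in> \<rho> r \<longleftrightarrow> t \<in> \<rho>' r"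
  by (auto simp: agree_def)

lemma agree_sym: "agree D \<rho> \<rho>' \<Longrightarrow> agree D \<rho>' \<rho>"
  by (auto simp: agree_def)

lemma agree_trans: "agree D \<rho> \<rho>' \<Longrightarrow> agree D \<rho>' \<rho>'' \<Longrightarrow> agree D \<rho> \<rho>''"
  by (auto simp: agree_def)

lemma agree_sub: "agree D \<rho> \<rho>' \<Longrightarrow> E \<subseteq> D \<Longrightarrow> agree E \<rho> \<rho>'"
  unfolding agree_def using tuples_mono[of E D] by blast

lemma K_agree: "agree D \<rho> \<rho>' \<Longrightarrow> K D \<rho> \<Longrightarrow> K D \<rho>'"
  by (rule K_cong) (auto simp: agree_def)

text \<open>An extension task asks to realise the one-point extension of \<open>set xs\<close> by \<open>x\<close> whose relations
  consist of the listed pairs of a symbol and a tuple.\<close>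

type_synonym task = "nat list \<times> nat \<times> (nat \<times> nat list) list"

definition listed :: "(nat \<times> nat list) list \<Rightarrow> interp" where
  "listed X r = {t. (r, t) \<in> set X}"

definition valid :: "nat \<Rightarrow> interp \<Rightarrow> task \<Rightarrow> bool" where
  "valid n \<rho> = (\<lambda>(xs, x, X). set xs \<subseteq> {..<n} \<and> x \<notin> set xs \<and>
     K (insert x (set xs)) (listed X) \<and> agree (set xs) (listed X) \<rho>)"

definition extends :: "nat \<Rightarrow> interp \<Rightarrow> task \<Rightarrow> interp \<Rightarrow> bool" where
  "extends n \<rho> = (\<lambda>(xs, x, X) \<rho>'. K {..<Suc n} \<rho>' \<and> agree {..<n} \<rho>' \<rho> \<and>
     (valid n \<rho> (xs, x, X) \<longrightarrow> agree (insert n (set xs)) \<rho>' (pull (id(n := x)) (listed X))))"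

text \<open>The new point is \<open>n\<close>, standing for \<open>x\<close>. If the task is not
  valid, the stage is amalgamated with a single point that carries no relations.\<close>

lemma ex_extends:
  assumes "K {..<n} \<rho>"
  shows "\<exists>\<rho>'. extends n \<rho> \<tau> \<rho>'"
proof -
  obtain xs x X where \<tau>: "\<tau> = (xs, x, X)" by (cases \<tau>) auto
  show ?thesis
  proof (cases "valid n \<rho> \<tau>")
    case True
    let ?h = "id(n := x)"
    have v: "set xs \<subseteq> {..<n}" "x \<notin> set xs" "K (insert x (set xs)) (listed X)"
        "agree (set xs) (listed X) \<rho>"
      using True by (auto simp: valid_def \<tau>)
    have "?h ` insert n (set xs) = insert x (set xs)" using v by auto
    then have K: "K (insert n (set xs)) (pull ?h (listed X))" using v by (intro K_pull) simp
    have i: "{..<n} \<inter> insert n (set xs) = set xs" "{..<n} \<union> insert n (set xs) = {..<Suc n}" using v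
        by auto
    have "t \<in> \<rho> r \<longleftrightarrow> t \<in> pull ?h (listed X) r" if "r \<in> sg" "t \<in> tuples (set xs) (ar r)" for r t
    proof -
      have "map ?h t = t" using that v(1) by (intro map_idI) (auto simp: tuples_def)
      then show ?thesis using agreeD[OF v(4) that] by (simp add: pull_def)
    qed
    then show ?thesis
      using K_amalg[OF _ _ assms K] unfolding extends_def \<tau> agree_def i by auto
  next
    case False
    have "\<exists>\<tau>. K ({..<n} \<union> {n}) \<tau> \<and> (\<forall>r\<in>sg. \<forall>t\<in>tuples {..<n} (ar r). t \<in> \<tau> r \<longleftrightarrow> t \<in> \<rho> r) \<and>
        (\<forall>r\<in>sg. \<forall>t\<in>tuples {n} (ar r). t \<in> \<tau> r \<longleftrightarrow> t \<in> ({} :: nat list set))"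
    proof (rule K_amalg[OF _ _ assms K_empty])
      show "t \<in> \<rho> r \<longleftrightarrow> t \<in> {}" if "r \<in> sg" "t \<in> tuples ({..<n} \<inter> {n}) (ar r)" for r t
        using that ar_pos[of r] by (auto simp: tuples_def)
    qed auto
    moreover have "{..<n} \<union> {n} = {..<Suc n}" by auto
    ultimately show ?thesis using False unfolding extends_def \<tau> agree_def by auto
  qed
qed

text \<open>Only the first component of the decoded pair names the task. The second one is a counter
  that makes every task return at arbitrarily late stages, when all its points are present.\<close>

primrec stage :: "nat \<Rightarrow> interp" where
  "stage 0 = (\<lambda>r. {})"
| "stage (Suc n) = (SOME \<rho>'. extends n (stage n) (from_nat (fst (prod_decode n))) \<rho>')"

lemma stage_K: "K {..<n} (stage n)"
  and stage_extends: "extends n (stage n) (from_nat (fst (prod_decode n))) (stage (Suc n))"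
proof -
  have *: "extends n (stage n) (from_nat (fst (prod_decode n))) (stage (Suc n))"
      if "K {..<n} (stage n)" for n
    using someI_ex[OF ex_extends[OF that, of "from_nat (fst (prod_decode n))"]] by simp
  show K: "K {..<n} (stage n)" for n
  proof (induction n)
    case 0
    show ?case using K_empty by simp
  next
    case (Suc n)
    show ?case using *[OF Suc] unfolding extends_def by (auto split: prod.splits)
  qed
  show "extends n (stage n) (from_nat (fst (prod_decode n))) (stage (Suc n))" using *[OF K] .
qed

lemma stage_agree: "m \<le> n \<Longrightarrow> agree {..<m} (stage n) (stage m)"
proof (induction n)
  case (Suc n)
  show ?case
  proof (cases "m = Suc n")
    case False
    then have "agree {..<m} (stage (Suc n)) (stage n)"
      using stage_extends[of n] Suc.prems agree_sub[of "{..<n}" _ _ "{..<m}"]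
      unfolding extends_def by (auto split: prod.splits)
    then show ?thesis using Suc False agree_trans by simp
  qed (simp add: agree_def)
qed (simp add: agree_def)

section \<open>The limit of the stages and its extension property\<close>

definition limit :: interp where
  "limit r = {t. length t = ar r \<and> (\<exists>n. set t \<subseteq> {..<n} \<and> t \<in> stage n r)}"

lemma limit_agree: "agree {..<n} limit (stage n)"
  unfolding agree_def
proof (intro ballI)
  fix r t assume r: "r \<in> sg" and t: "t \<in> tuples {..<n} (ar r)"
  have l: "length t = ar r" "set t \<subseteq> {..<n}" using t by (auto simp: tuples_def)
  show "t \<in> limit r \<longleftrightarrow> t \<in> stage n r"
  proof
    assume "t \<in> limit r"
    then obtain m where m: "set t \<subseteq> {..<m}" "t \<in> stage m r" by (auto simp: limit_def)
    have "t \<in> stage (max m n) r"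
      using agreeD[OF stage_agree[of m "max m n"] r] m l by (auto simp: tuples_def)
    then show "t \<in> stage n r" using agreeD[OF stage_agree[of n "max m n"] r t] by simp
  qed (use l in \<open>auto simp: limit_def\<close>)
qed

lemma limit_tuples: "limit r \<subseteq> tuples UNIV (ar r)"
  by (auto simp: limit_def tuples_def)

lemma limit_K:
  assumes "finite D"
  shows "K D limit"
proof -
  obtain n where "D \<subseteq> {..<n}" using assms by (auto simp: finite_nat_set_iff_bounded)
  moreover have "K {..<n} limit" using stage_K[of n] K_agree[OF agree_sym[OF limit_agree]] by simp
  ultimately show ?thesis using K_sub by blast
qed

lemma finite_tuples: "finite D \<Longrightarrow> finite (tuples D n)"
  using finite_lists_length_eq[of D n] by (simp add: tuples_def conj_commute)

lemma limit_ext: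
  assumes "finite D" "x \<notin> D" "K (insert x D) \<rho>" "agree D \<rho> limit"
  shows "\<exists>y. y \<notin> D \<and> agree (insert y D) limit (pull (id(y := x)) \<rho>)"
proof -
  \<comment> \<open>Because the signature and \<open>D\<close> are finite, the extension can be
    listed, which makes it one of the countably many tasks.\<close>
  have "finite (SIGMA r:sg. \<rho> r \<inter> tuples (insert x D) (ar r))"
    using assms(1) fin_sg by (intro finite_SigmaI finite_Int disjI2 finite_tuples) auto
  then obtain X where X: "set X = (SIGMA r:sg. \<rho> r \<inter> tuples (insert x D) (ar r))"
    using finite_list by blast
  have aX: "agree (insert x D) (listed X) \<rho>" by (auto simp: agree_def listed_def X)
  obtain xs where xs: "set xs = D" using assms(1) finite_list by blast
  obtain m where m: "D \<subseteq> {..<m}" using assms(1) by (auto simp: finite_nat_set_iff_bounded)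
  define \<tau> where "\<tau> = (xs, x, X)"
  \<comment> \<open>The counter \<open>m\<close> puts the stage beyond all points of
    \<open>D\<close>.\<close>
  define n where "n = prod_encode (to_nat \<tau>, m)"
  have n: "m \<le> n" unfolding n_def by (rule le_prod_encode_2)
  have \<tau>: "from_nat (fst (prod_decode n)) = \<tau>" by (simp add: n_def)
  have D: "D \<subseteq> {..<n}" using m n by auto
  have "agree D \<rho> (stage n)" using agree_trans[OF assms(4) agree_sub[OF limit_agree D]] .
  then have "agree D (listed X) (stage n)" using agree_trans[OF agree_sub[OF aX]] by auto
  then have "valid n (stage n) \<tau>"
    using assms(2) xs D K_agree[OF agree_sym[OF aX] assms(3)] by (auto simp: valid_def \<tau>_def)
  then have "agree (insert n D) (stage (Suc n)) (pull (id(n := x)) (listed X))"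
    using stage_extends[of n] xs unfolding \<tau> by (auto simp: extends_def \<tau>_def)
  moreover have "agree (insert n D) limit (stage (Suc n))" using D
      by (intro agree_sub[OF limit_agree]) auto
  ultimately have 1: "agree (insert n D) limit (pull (id(n := x)) (listed X))"
      by (rule agree_trans[rotated])
  have "n \<notin> D" using D by auto
  have "agree (insert n D) (pull (id(n := x)) (listed X)) (pull (id(n := x)) \<rho>)"
    unfolding agree_def pull_def
  proof (intro ballI, simp)
    fix r t assume "r \<in> sg" "t \<in> tuples (insert n D) (ar r)"
    then have "map (id(n := x)) t \<in> tuples (insert x D) (ar r)" by (auto simp: tuples_def)
    then show "map (id(n := x)) t \<in> listed X r \<longleftrightarrow> map (id(n := x)) t \<in> \<rho> r"
      using agreeD[OF aX \<open>r \<in> sg\<close>] by blast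
  qed
  then show ?thesis using agree_trans[OF 1] \<open>n \<notin> D\<close> by blast
qed

section \<open>Back and forth with finite partial isomorphisms\<close>

definition part_iso :: "interp \<Rightarrow> interp \<Rightarrow> (nat \<times> nat) set \<Rightarrow> bool" where
  "part_iso \<rho> \<sigma> p \<longleftrightarrow> (\<forall>z\<in>p. \<forall>z'\<in>p. fst z = fst z' \<longleftrightarrow> snd z = snd z') \<and>
     (\<forall>r\<in>sg. \<forall>ts\<in>tuples p (ar r). map fst ts \<in> \<rho> r \<longleftrightarrow> map snd ts \<in> \<sigma> r)"

lemma part_iso_converse: "part_iso \<rho> \<sigma> p \<Longrightarrow> part_iso \<sigma> \<rho> (prod.swap ` p)"
proof -
  assume p: "part_iso \<rho> \<sigma> p"
  have "map fst ts \<in> \<sigma> r \<longleftrightarrow> map snd ts \<in> \<rho> r" if "r \<in> sg" "ts \<in> tuples (prod.swap ` p) (ar r)"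
      for r ts
  proof -
    have "map prod.swap ts \<in> tuples p (ar r)" using that by (auto simp: tuples_def)
    then have "map fst (map prod.swap ts) \<in> \<rho> r \<longleftrightarrow> map snd (map prod.swap ts) \<in> \<sigma> r"
      using p that unfolding part_iso_def by blast
    then show ?thesis by (simp add: comp_def)
  qed
  then show ?thesis using p unfolding part_iso_def by auto
qed

text \<open>The one-point extension is transported to the range of \<open>p\<close>. As
  \<open>x\<close> may itself be a number in that range, it first gets a fresh name
  \<open>x'\<close>; the extension property then supplies the actual point \<open>y\<close>.\<close>

lemma forth:
  assumes p: "part_iso \<rho> limit p" "finite p" and K: "K (insert x (fst ` p)) \<rho>"
  shows "\<exists>y. part_iso \<rho> limit (insert (x, y) p)"
proof (cases "x \<in> fst ` p")
  case True
  then obtain y where "(x, y) \<in> p" by auto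
  then show ?thesis using p by (intro exI[of _ y]) (simp add: insert_absorb)
next
  case False
  let ?R = "snd ` p"
  define g where "g y = (SOME a. (a, y) \<in> p)" for y
  have inj: "a = b" if "(a, y) \<in> p" "(b, y) \<in> p" for a b y
    using p(1) that unfolding part_iso_def by fastforce
  have g: "g y = a" if "(a, y) \<in> p" for a y
    unfolding g_def using that inj someI[of "\<lambda>a. (a, y) \<in> p" a] by blast
  obtain x' where x': "x' \<notin> ?R" using p(2) ex_new_if_finite[of ?R] by auto
  let ?g = "g(x' := x)"
  have "?g ` insert x' ?R = insert x (fst ` p)"
    using g x' by (force simp: image_iff)
  then have K': "K (insert x' ?R) (pull ?g \<rho>)" using K by (intro K_pull) simp
  have "agree ?R (pull ?g \<rho>) limit"
    unfolding agree_def
  proof (intro ballI)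
    fix r t assume r: "r \<in> sg" and t: "t \<in> tuples ?R (ar r)"
    let ?ts = "map (\<lambda>y. (g y, y)) t"
    have "?ts \<in> tuples p (ar r)" using t g by (auto simp: tuples_def)
    then have "map fst ?ts \<in> \<rho> r \<longleftrightarrow> map snd ?ts \<in> limit r" using p(1) r unfolding part_iso_def
        by blast
    moreover have "map fst ?ts = map ?g t" using t x' by (auto simp: tuples_def)
    moreover have "map snd ?ts = t" by (simp add: comp_def)
    ultimately show "t \<in> pull ?g \<rho> r \<longleftrightarrow> t \<in> limit r" unfolding pull_def mem_Collect_eq by metis
  qed
  then obtain y where y: "y \<notin> ?R" "agree (insert y ?R) limit (pull (id(y := x')) (pull ?g \<rho>))"
    using limit_ext[OF _ x' K'] p(2) by auto
  have gy: "?g ((id(y := x')) (snd z)) = fst z" if "z \<in> insert (x, y) p" for z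
  proof (cases "z = (x, y)")
    case False
    then have "z \<in> p" using that by simp
    then have "snd z \<in> ?R" by simp
    then have "snd z \<noteq> y" "snd z \<noteq> x'" using y x' by auto
    then show ?thesis using g[of "fst z" "snd z"] \<open>z \<in> p\<close> by simp
  qed simp
  have "map fst ts \<in> \<rho> r \<longleftrightarrow> map snd ts \<in> limit r"
    if r: "r \<in> sg" and ts: "ts \<in> tuples (insert (x, y) p) (ar r)" for r ts
  proof -
    have "map snd ts \<in> tuples (insert y ?R) (ar r)" using ts by (force simp: tuples_def)
    moreover have "map (\<lambda>z. ?g ((id(y := x')) (snd z))) ts = map fst ts"
      using gy ts by (intro map_cong) (auto simp: tuples_def simp del: fun_upd_apply)
    then have "map ?g (map (id(y := x')) (map snd ts)) = map fst ts" by (simp add: comp_def)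
    ultimately show ?thesis
      using agreeD[OF y(2) r, of "map snd ts"] unfolding pull_def mem_Collect_eq by metis
  qed
  moreover have "\<forall>z\<in>insert (x, y) p. \<forall>z'\<in>insert (x, y) p. fst z = fst z' \<longleftrightarrow> snd z = snd z'"
    using p(1) False y(1) unfolding part_iso_def by (auto; force)
  ultimately show ?thesis unfolding part_iso_def by blast
qed

lemma part_iso_Union:
  assumes "\<And>n. part_iso \<rho> \<sigma> (P n)" "\<And>n. P n \<subseteq> P (Suc n)"
  shows "part_iso \<rho> \<sigma> (\<Union>n. P n)"
proof -
  have mono: "m \<le> n \<Longrightarrow> P m \<subseteq> P n" for m n using assms(2) by (rule lift_Suc_mono_le)
  have fin: "\<exists>n. set ts \<subseteq> P n" if "set ts \<subseteq> (\<Union>n. P n)" for ts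
    using that
  proof (induction ts)
    case (Cons z ts)
    then obtain m n where "z \<in> P m" "set ts \<subseteq> P n" by auto
    then have "set (z # ts) \<subseteq> P (max m n)" using mono[of m "max m n"] mono[of n "max m n"] by auto
    then show ?case by blast
  qed simp
  have "map fst ts \<in> \<rho> r \<longleftrightarrow> map snd ts \<in> \<sigma> r" 
    if r: "r \<in> sg" and ts: "ts \<in> tuples (\<Union>n. P n) (ar r)" for r ts
  proof -
    obtain n where "ts \<in> tuples (P n) (ar r)" using fin[of ts] ts by (auto simp: tuples_def)
    then show ?thesis using assms(1)[of n] r unfolding part_iso_def by blast
  qed
  moreover have "fst z = fst z' \<longleftrightarrow> snd z = snd z'" 
    if z: "z \<in> (\<Union>n. P n)" "z' \<in> (\<Union>n. P n)" for z z'
  proof -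
    obtain n where "z \<in> P n" "z' \<in> P n" using fin[of "[z, z']"] z by auto
    then show ?thesis using assms(1)[of n] unfolding part_iso_def by blast
  qed
  ultimately show ?thesis unfolding part_iso_def by blast
qed

lemma part_iso_map:
  assumes "part_iso \<rho> \<sigma> p" "D \<subseteq> fst ` p"
  obtains g where "inj_on g D" "\<And>x. x \<in> D \<Longrightarrow> (x, g x) \<in> p"
    "\<And>r t. r \<in> sg \<Longrightarrow> t \<in> tuples D (ar r) \<Longrightarrow> t \<in> \<rho> r \<longleftrightarrow> map g t \<in> \<sigma> r"
proof -
  define g where "g x = (SOME y. (x, y) \<in> p)" for x
  have g: "(x, g x) \<in> p" if "x \<in> D" for x
    using that assms(2) unfolding g_def by (metis (mono_tags) imageE prod.collapse someI_ex subsetD)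
  have "x = y" if "x \<in> D" "y \<in> D" "g x = g y" for x y
  proof -
    have "\<forall>z\<in>p. \<forall>z'\<in>p. fst z = fst z' \<longleftrightarrow> snd z = snd z'" using assms(1) unfolding part_iso_def
        by blast
    from this[rule_format, OF g[OF that(1)] g[OF that(2)]] that show ?thesis by simp
  qed
  then have 1: "inj_on g D" by (rule inj_onI)
  have 2: "t \<in> \<rho> r \<longleftrightarrow> map g t \<in> \<sigma> r" if "r \<in> sg" "t \<in> tuples D (ar r)" for r t
  proof -
    let ?ts = "map (\<lambda>x. (x, g x)) t"
    have "?ts \<in> tuples p (ar r)" using that g by (auto simp: tuples_def)
    then have "map fst ?ts \<in> \<rho> r \<longleftrightarrow> map snd ?ts \<in> \<sigma> r" using assms(1) that unfolding part_iso_def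
        by blast
    then show ?thesis by (simp add: comp_def)
  qed
  show thesis using that[OF 1 g 2] .
qed

text \<open>The forth half alone suffices. \<open>C\<close> may be infinite; the point
  \<open>n\<close> of \<open>C\<close> is treated in round \<open>n\<close>.\<close>

lemma limit_universal:
  assumes "\<And>D. finite D \<Longrightarrow> D \<subseteq> C \<Longrightarrow> K D \<rho>"
  obtains g where "inj_on g C"
    "\<And>r t. r \<in> sg \<Longrightarrow> t \<in> tuples C (ar r) \<Longrightarrow> t \<in> \<rho> r \<longleftrightarrow> map g t \<in> limit r"
proof -
  let ?Q = "\<lambda>p. finite p \<and> fst ` p \<subseteq> C \<and> part_iso \<rho> limit p"
  have "\<exists>P. \<forall>n. ?Q (P n) \<and> (P n \<subseteq> P (Suc n) \<and> (n \<in> C \<longrightarrow> n \<in> fst ` P (Suc n)))"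
  proof (rule dependent_nat_choice)
    show "\<exists>p. ?Q p"
    proof (intro exI[of _ "{}"] conjI)
      \<comment> \<open>There are no tuples over the empty set, since arities are positive.\<close>
      show "part_iso \<rho> limit {}" unfolding part_iso_def using ar_pos by (force simp: tuples_def)
    qed auto
    show "\<exists>p'. ?Q p' \<and> p \<subseteq> p' \<and> (n \<in> C \<longrightarrow> n \<in> fst ` p')" if p: "?Q p" for p n
    proof (cases "n \<in> C")
      case True
      then obtain y where "part_iso \<rho> limit (insert (n, y) p)"
        using forth[of \<rho> p n] assms[of "insert n (fst ` p)"] p by auto
      then show ?thesis using p True by (intro exI[of _ "insert (n, y) p"]) auto
    qed (use p in auto)
  qed
  then obtain P where "\<forall>n. ?Q (P n) \<and> (P n \<subseteq> P (Suc n) \<and> (n \<in> C \<longrightarrow> n \<in> fst ` P (Suc n)))"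
    by (elim exE)
  then have P: "?Q (P n)" "P n \<subseteq> P (Suc n)" "n \<in> C \<Longrightarrow> n \<in> fst ` P (Suc n)" for n by blast+
  have "part_iso \<rho> limit (\<Union>n. P n)" by (rule part_iso_Union) (use P in auto)
  moreover have "C \<subseteq> fst ` (\<Union>n. P n)"
  proof
    show "n \<in> fst ` (\<Union>n. P n)" if "n \<in> C" for n using P(3)[OF that] by auto
  qed
  ultimately show thesis by (rule part_iso_map) (rule that)
qed

lemma limit_automorphism:
  assumes "part_iso limit limit p" "finite p"
  obtains g where "bij g" "\<And>x y. (x, y) \<in> p \<Longrightarrow> g x = y"
    "\<And>r t. r \<in> sg \<Longrightarrow> t \<in> tuples UNIV (ar r) \<Longrightarrow> t \<in> limit r \<longleftrightarrow> map g t \<in> limit r"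
proof -
  let ?Q = "\<lambda>q. finite q \<and> p \<subseteq> q \<and> part_iso limit limit q"
  have "\<exists>P. \<forall>n. ?Q (P n) \<and> (P n \<subseteq> P (Suc n) \<and> n \<in> fst ` P (Suc n) \<and> n \<in> snd ` P (Suc n))"
  proof (rule dependent_nat_choice)
    show "\<exists>q. ?Q q" using assms by blast
    show "\<exists>q'. ?Q q' \<and> q \<subseteq> q' \<and> n \<in> fst ` q' \<and> n \<in> snd ` q'" if q: "?Q q" for q n
    proof -
      obtain y where y: "part_iso limit limit (insert (n, y) q)"
        using forth[of limit q n] limit_K q by auto
      \<comment> \<open>The back step is the forth step for the converse.\<close>
      let ?q = "prod.swap ` insert (n, y) q"
      obtain x where "part_iso limit limit (insert (n, x) ?q)"
        using forth[OF part_iso_converse[OF y], of n] limit_K q by auto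
      from part_iso_converse[OF this] have "part_iso limit limit (insert (x, n) (insert (n, y) q))"
        by (simp add: image_image)
      then show ?thesis using q by (intro exI[of _ "insert (x, n) (insert (n, y) q)"]) auto
    qed
  qed
  then obtain P
    where "\<forall>n. ?Q (P n) \<and> (P n \<subseteq> P (Suc n) \<and> n \<in> fst ` P (Suc n) \<and> n \<in> snd ` P (Suc n))"
    by (elim exE)
  then have P: "?Q (P n)" "P n \<subseteq> P (Suc n)" "n \<in> fst ` P (Suc n)" "n \<in> snd ` P (Suc n)" for n
      by blast+
  let ?P = "\<Union>n. P n"
  have iso: "part_iso limit limit ?P" by (rule part_iso_Union) (use P in auto)
  moreover have "UNIV \<subseteq> fst ` ?P"
  proof
    show "n \<in> fst ` ?P" for n using P(3)[of n] by auto
  qed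
  ultimately obtain g where g: "inj_on g UNIV" "\<And>x. x \<in> UNIV \<Longrightarrow> (x, g x) \<in> ?P"
    "\<And>r t. r \<in> sg \<Longrightarrow> t \<in> tuples UNIV (ar r) \<Longrightarrow> t \<in> limit r \<longleftrightarrow> map g t \<in> limit r"
    by (rule part_iso_map) blast
  have uniq: "y = g x" if "(x, y) \<in> ?P" for x y
  proof -
    have "\<forall>z\<in>?P. \<forall>z'\<in>?P. fst z = fst z' \<longleftrightarrow> snd z = snd z'" using iso unfolding part_iso_def by blast
    from this[rule_format, OF that g(2)[of x, OF UNIV_I]] show ?thesis by simp
  qed
  have "surj g"
    unfolding surj_def
  proof
    fix n
    obtain z where z: "z \<in> ?P" "snd z = n" using P(4)[of n] by auto
    then have "n = g (fst z)" using uniq[of "fst z" n] by (cases z) auto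
    then show "\<exists>x. n = g x" by blast
  qed
  moreover have "g x = y" if "(x, y) \<in> p" for x y using uniq[of x y] that P(1)[of 0] by auto
  ultimately show thesis using that[of g] g(1,3) by (simp add: bij_def)
qed

section \<open>The limit as a homogeneous and finitely bounded structure\<close>

definition limit_struct :: "(nat, nat) rel_struct" where
  "limit_struct = \<lparr>universe = UNIV, sig = sg, arity = ar, rel = limit\<rparr>"

lemma is_structure_limit: "is_structure limit_struct"
  using ar_pos limit_tuples by (auto simp: is_structure_def limit_struct_def)

lemma homogeneous_limit: "homogeneous limit_struct"
  unfolding homogeneous_def
proof (intro allI impI)
  fix S T f
  assume "finite S \<and> S \<subseteq> universe limit_struct \<and> finite T \<and> T \<subseteq> universe limit_struct \<and>
    isomorphism (substructure limit_struct S) (substructure limit_struct T) f"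
  then have fin: "finite S" and f: "inj_on f S" "f ` S = T"
    and pres: "\<And>r t. r \<in> sg \<Longrightarrow> t \<in> tuples S (ar r) \<Longrightarrow>
      t \<in> limit r \<inter> tuples S (ar r) \<longleftrightarrow> map f t \<in> limit r \<inter> tuples T (ar r)"
    unfolding isomorphism_def embedding_def substructure_def limit_struct_def by simp_all
  have pres: "t \<in> limit r \<longleftrightarrow> map f t \<in> limit r" if "r \<in> sg" "t \<in> tuples S (ar r)" for r t
  proof -
    have "map f t \<in> tuples T (ar r)" using that f(2) by (auto simp: tuples_def)
    then show ?thesis using pres[OF that] that by simp
  qed
  let ?p = "(\<lambda>x. (x, f x)) ` S"
  have "map fst ts \<in> limit r \<longleftrightarrow> map snd ts \<in> limit r" if "r \<in> sg" "ts \<in> tuples ?p (ar r)" for r ts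
  proof -
    have "map fst ts \<in> tuples S (ar r)" using that by (auto simp: tuples_def)
    moreover have "map f (map fst ts) = map snd ts" using that by (auto simp: tuples_def)
    ultimately show ?thesis using pres[OF that(1), of "map fst ts"] by metis
  qed
  then have "part_iso limit limit ?p" using f(1) by (auto simp: part_iso_def inj_on_eq_iff)
  then obtain g where g: "bij g" "\<And>x y. (x, y) \<in> ?p \<Longrightarrow> g x = y"
    "\<And>r t. r \<in> sg \<Longrightarrow> t \<in> tuples UNIV (ar r) \<Longrightarrow> t \<in> limit r \<longleftrightarrow> map g t \<in> limit r"
    by (rule limit_automorphism[OF _ finite_imageI[OF fin]]) blast
  have "isomorphism limit_struct limit_struct g"
    using g(1,3) by (auto simp: isomorphism_def embedding_def limit_struct_def same_signature_def
        bij_def)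
  then show "\<exists>g. isomorphism limit_struct limit_struct g \<and> (\<forall>x\<in>S. g x = f x)" using g(2) by blast
qed

lemma embeds_limit:
  assumes C: "is_structure C" "same_signature C limit_struct"
  shows "embeds C limit_struct \<longleftrightarrow> K (universe C) (rel C)"
proof
  assume "embeds C limit_struct"
  then obtain f where f: "\<And>r t. r \<in> sg \<Longrightarrow> t \<in> tuples (universe C) (ar r) \<Longrightarrow> t \<in> rel C r \<longleftrightarrow>
      map f t \<in> limit r"
    using C(2) by (auto simp: embeds_def embedding_def limit_struct_def same_signature_def)
  show "K (universe C) (rel C)"
  \<comment> \<open>\<open>C\<close> may be infinite, whereas \<open>limit_K\<close> concerns finite
    sets; locality bridges the gap.\<close>
  proof (rule K_local)
    fix S assume S: "S \<subseteq> universe C" "finite S"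
    have "K S (pull f limit)" using S(2) by (intro K_pull limit_K) simp
    moreover have "agree S (pull f limit) (rel C)"
      using f tuples_mono[OF S(1)] by (fastforce simp: agree_def pull_def)
    ultimately show "K S (rel C)" using K_agree by blast
  qed
next
  assume "K (universe C) (rel C)"
  then obtain g where "inj_on g (universe C)"
    "\<And>r t. r \<in> sg \<Longrightarrow> t \<in> tuples (universe C) (ar r) \<Longrightarrow> t \<in> rel C r \<longleftrightarrow> map g t \<in> limit r"
    using limit_universal[of "universe C" "rel C"] K_sub by metis
  then have "embedding C limit_struct g"
    using C(2) by (auto simp: embedding_def limit_struct_def same_signature_def)
  then show "embeds C limit_struct" unfolding embeds_def by blast
qed

text \<open>The bounds are the structures outside the class on nonempty subsets of
  \<open>{..<bound}\<close>, with extensional interpretations so that there are finitely many. By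
  locality every finite structure outside the class has a bad part with at most \<open>bound\<close>
  points, which is copied onto an initial segment.\<close>

lemma finitely_bounded_limit: "finitely_bounded limit_struct"
proof -
  define mk :: "nat set \<times> interp \<Rightarrow> (nat, nat) rel_struct" where
    "mk = (\<lambda>(S, \<rho>). \<lparr>universe = S, sig = sg, arity = ar, rel = \<rho>\<rparr>)"
  define \<F> where "\<F> = {F \<in> mk ` (Pow {..<bound} \<times> (\<Pi>\<^sub>E r\<in>sg. Pow (tuples {..<bound} (ar r)))).
     is_structure F \<and> \<not> K (universe F) (rel F)}"
  have "finite (mk ` (Pow {..<bound} \<times> (\<Pi>\<^sub>E r\<in>sg. Pow (tuples {..<bound} (ar r)))))"
    using fin_sg finite_tuples by (intro finite_imageI finite_cartesian_product finite_PiE) auto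
  then have fin: "finite \<F>" unfolding \<F>_def by simp
  have F: "is_structure F \<and> finite (universe F) \<and> same_signature F limit_struct \<and>
      \<not> K (universe F) (rel F)"
    if "F \<in> \<F>" for F
    using that finite_subset[OF _ finite_lessThan[of bound]]
    by (auto simp: \<F>_def mk_def same_signature_def limit_struct_def)
  have "embeds C limit_struct \<longleftrightarrow> \<not> (\<exists>F\<in>\<F>. embeds F C)"
    if C: "is_structure C" "finite (universe C)" "same_signature C limit_struct"
        for C :: "(nat, nat) rel_struct"
  proof -
    have sC: "sig C = sg" "\<And>r. r \<in> sg \<Longrightarrow> arity C r = ar r"
      using C(3) by (auto simp: same_signature_def limit_struct_def)
    have "K (universe C) (rel C) \<longleftrightarrow> \<not> (\<exists>F\<in>\<F>. embeds F C)"
    proof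
      assume K: "K (universe C) (rel C)"
      show "\<not> (\<exists>F\<in>\<F>. embeds F C)"
      proof
        assume "\<exists>F\<in>\<F>. embeds F C"
        then obtain F f where Ff: "F \<in> \<F>" "embedding F C f" by (auto simp: embeds_def)
        note F = F[OF Ff(1)]
        have "K (f ` universe F) (rel C)" using K_sub[OF K] Ff(2) by (auto simp: embedding_def)
        then have "K (universe F) (pull f (rel C))" by (rule K_pull)
        moreover have "agree (universe F) (pull f (rel C)) (rel F)"
          using Ff(2) F by (auto simp: agree_def embedding_def pull_def same_signature_def
              limit_struct_def)
        ultimately show False using K_agree F by blast
      qed
    next
      assume no: "\<not> (\<exists>F\<in>\<F>. embeds F C)"
      show "K (universe C) (rel C)"
      proof (rule ccontr)
        assume "\<not> K (universe C) (rel C)"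
        then obtain S where S: "S \<subseteq> universe C" "S \<noteq> {}" "finite S" "card S \<le> bound" "\<not> K S (rel C)"
          using K_local[of "universe C" "rel C"] by blast
        obtain f where f: "bij_betw f {0..<card S} S" using ex_bij_betw_nat_finite[OF S(3)] by blast
        let ?n = "card S"
        define \<rho> where "\<rho> = (\<lambda>r\<in>sg. {t \<in> tuples {..<?n} (ar r). map f t \<in> rel C r})"
        define F where "F = mk ({..<?n}, \<rho>)"
        have fS: "f ` {..<?n} = S" "inj_on f {..<?n}" using f
            by (auto simp: bij_betw_def lessThan_atLeast0)
        have "?n \<noteq> 0" using S by simp
        then have str: "is_structure F"
          using ar_pos by (auto simp: is_structure_def F_def mk_def \<rho>_def)
        have emb: "embedding F C f"
          using fS S(1) sC by (auto simp: embedding_def F_def mk_def \<rho>_def same_signature_def)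
        have "\<not> K {..<?n} \<rho>"
        proof
          assume K: "K {..<?n} \<rho>"
          define g where "g = inv_into {..<?n} f"
          have g: "g ` S = {..<?n}" "\<And>x. x \<in> S \<Longrightarrow> f (g x) = x"
            using inv_into_image_cancel[OF fS(2), of "{..<?n}"] fS
                by (auto simp: g_def f_inv_into_f)
          have "K S (pull g \<rho>)" using K g by (intro K_pull) simp
          moreover have "agree S (pull g \<rho>) (rel C)"
            unfolding agree_def
          proof (intro ballI)
            fix r t assume r: "r \<in> sg" and t: "t \<in> tuples S (ar r)"
            have "map f (map g t) = t" using t g(2) by (auto simp: tuples_def intro!: map_idI)
            moreover have "map g t \<in> tuples {..<?n} (ar r)" using t g(1) by (auto simp: tuples_def)
            ultimately show "t \<in> pull g \<rho> r \<longleftrightarrow> t \<in> rel C r" using r by (simp add: pull_def \<rho>_def)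
          qed
          ultimately show False using S(5) K_agree by blast
        qed
        moreover have "({..<?n}, \<rho>) \<in> Pow {..<bound} \<times> (\<Pi>\<^sub>E r\<in>sg. Pow (tuples {..<bound} (ar r)))"
          using S(4) tuples_mono[of "{..<?n}" "{..<bound}"] by (fastforce simp: \<rho>_def)
        ultimately have "F \<in> \<F>" using str by (auto simp: \<F>_def F_def mk_def)
        then show False using no emb by (auto simp: embeds_def)
      qed
    qed
    then show ?thesis using embeds_limit[OF C(1,3)] by simp
  qed
  then show ?thesis
    unfolding finitely_bounded_def using fin F fin_sg
        by (auto simp: limit_struct_def intro!: exI[of _ \<F>])
qed

end

section \<open>Forbidding a homomorphic image\<close>

text \<open>The list \<open>es\<close> describes a finite structure with one relation for each \<open>j < length es\<close>, which
  consists of the single tuple \<open>es ! j\<close>.\<close>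

locale forbidden =
  fixes es :: "nat list list"
  assumes es_ne: "es \<noteq> []" and edge_ne: "j < length es \<Longrightarrow> es ! j \<noteq> []"
    and connected: "J \<subseteq> {..<length es} \<Longrightarrow> J \<noteq> {} \<Longrightarrow> J \<noteq> {..<length es} \<Longrightarrow>
      (\<Union>j\<in>J. set (es ! j)) \<inter> (\<Union>j\<in>{..<length es} - J. set (es ! j)) \<noteq> {}"
begin

abbreviation All :: "nat set" where
  "All \<equiv> {..<length es}"

lemma All_ne: "All \<noteq> {}"
  using es_ne by (simp add: lessThan_empty_iff)

section \<open>Sets of edges, their boundaries, and the class of expansions\<close>

definition verts :: "nat set \<Rightarrow> nat set" where
  "verts J = (\<Union>j\<in>J. set (es ! j))"

definition bd :: "nat set \<Rightarrow> nat set" where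
  "bd J = verts J \<inter> verts (All - J)"

definition bl :: "nat set \<Rightarrow> nat list" where
  "bl J = sorted_list_of_set (bd J)"

definition sym :: "nat set \<Rightarrow> nat" where
  "sym J = length es + set_encode J"

definition proper :: "nat set \<Rightarrow> bool" where
  "proper J \<longleftrightarrow> J \<subseteq> All \<and> J \<noteq> {} \<and> J \<noteq> All"

definition sg :: "nat set" where
  "sg = All \<union> sym ` {J. proper J}"

definition ar :: "nat \<Rightarrow> nat" where
  "ar s = (if s < length es then length (es ! s) else length (bl (set_decode (s - length es))))"

text \<open>The symbol \<open>sym J\<close> stands for the primitive positive formula, in the boundary vertices of \<open>J\<close>,
  that says that the edges with index in \<open>J\<close> can be mapped homomorphically.\<close>

definition holds :: "interp \<Rightarrow> nat set \<Rightarrow> (nat \<Rightarrow> nat) \<Rightarrow> bool" where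
  "holds \<rho> J h \<longleftrightarrow> J = {} \<or> J \<noteq> All \<and> map h (bl J) \<in> \<rho> (sym J)"

text \<open>The two axioms follow the two ways of building a partial copy: single edges and unions
  of disjoint parts. There is no converse, so \<open>sym J\<close> may hold of further tuples. Since
  \<open>holds\<close> is false for \<open>All\<close>, the join axiom with
  \<open>J \<union> J' = All\<close> is the one that forbids the structure.\<close>

definition K :: "nat set \<Rightarrow> interp \<Rightarrow> bool" where
  "K D \<rho> \<longleftrightarrow>
     (\<forall>j h. j < length es \<longrightarrow> h ` set (es ! j) \<subseteq> D \<longrightarrow> map h (es ! j) \<in> \<rho> j \<longrightarrow> holds \<rho> {j} h) \<and>
     (\<forall>J J' h. J \<subseteq> All \<longrightarrow> J' \<subseteq> All \<longrightarrow> J \<inter> J' = {} \<longrightarrow> h ` (bd J \<union> bd J') \<subseteq> D \<longrightarrow>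
        holds \<rho> J h \<longrightarrow> holds \<rho> J' h \<longrightarrow> holds \<rho> (J \<union> J') h)"

lemma K_edge: "K D \<rho> \<Longrightarrow> j < length es \<Longrightarrow> h ` set (es ! j) \<subseteq> D \<Longrightarrow> map h (es ! j) \<in> \<rho> j \<Longrightarrow> holds \<rho> {j} h"
  by (simp add: K_def)

lemma K_join: "K D \<rho> \<Longrightarrow> J \<subseteq> All \<Longrightarrow> J' \<subseteq> All \<Longrightarrow> J \<inter> J' = {} \<Longrightarrow> h ` (bd J \<union> bd J') \<subseteq> D \<Longrightarrow>
    holds \<rho> J h \<Longrightarrow> holds \<rho> J' h \<Longrightarrow> holds \<rho> (J \<union> J') h"
  by (simp add: K_def)

lemma verts_Un: "verts (J \<union> J') = verts J \<union> verts J'"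
  by (auto simp: verts_def)

lemma verts_mono: "J \<subseteq> J' \<Longrightarrow> verts J \<subseteq> verts J'"
  by (auto simp: verts_def)

lemma finite_verts: "finite J \<Longrightarrow> finite (verts J)"
  by (simp add: verts_def)

lemma finite_bd: "finite (bd J)"
  by (simp add: bd_def finite_verts)

lemma set_bl [simp]: "set (bl J) = bd J"
  by (simp add: bl_def finite_bd)

lemma distinct_bl: "distinct (bl J)"
  by (simp add: bl_def)

lemma bd_Un: "bd (J \<union> J') \<subseteq> bd J \<union> bd J'"
  using verts_mono[of "All - (J \<union> J')" "All - J"] verts_mono[of "All - (J \<union> J')" "All - J'"]
  by (auto simp: bd_def verts_Un)

lemma bd_single: "bd {j} \<subseteq> set (es ! j)"
  by (auto simp: bd_def verts_def)

lemma bd_disjoint: "J' \<subseteq> All \<Longrightarrow> J \<inter> J' = {} \<Longrightarrow> verts J \<inter> verts J' \<subseteq> bd J"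
  using verts_mono[of J' "All - J"] by (auto simp: bd_def)

lemma bd_verts: "bd J \<subseteq> verts J"
  by (auto simp: bd_def)

text \<open>Connectedness enters here. It gives the symbols \<open>sym J\<close> positive
  arity.\<close>

lemma bd_ne: "proper J \<Longrightarrow> bd J \<noteq> {}"
  using connected[of J] by (simp add: proper_def bd_def verts_def)

lemma finite_sub: "J \<subseteq> All \<Longrightarrow> finite J"
  using finite_subset by blast

lemma decode_sym: "J \<subseteq> All \<Longrightarrow> set_decode (sym J - length es) = J"
  by (simp add: sym_def finite_sub)

lemma ar_sym: "J \<subseteq> All \<Longrightarrow> ar (sym J) = length (bl J)"
  using decode_sym by (simp add: ar_def sym_def)

lemma sym_sg: "proper J \<Longrightarrow> sym J \<in> sg"
  by (auto simp: sg_def)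

lemma holds_cong: "(\<And>v. v \<in> bd J \<Longrightarrow> h v = h' v) \<Longrightarrow> holds \<rho> J h \<longleftrightarrow> holds \<rho> J h'"
  by (auto simp: holds_def cong: map_cong)
    (metis (no_types, lifting) map_cong set_bl)+

lemma holds_agree:
  assumes "\<And>r t. r \<in> sg \<Longrightarrow> t \<in> tuples D (ar r) \<Longrightarrow> t \<in> \<rho> r \<longleftrightarrow> t \<in> \<rho>' r" "J \<subseteq> All" "h ` bd J \<subseteq> D"
  shows "holds \<rho> J h \<longleftrightarrow> holds \<rho>' J h"
proof (cases "proper J")
  case True
  have "map h (bl J) \<in> tuples D (ar (sym J))" using assms(2,3) by (auto simp: tuples_def ar_sym)
  then show ?thesis using assms(1)[OF sym_sg[OF True]] by (simp add: holds_def)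
qed (use assms in \<open>auto simp: holds_def proper_def\<close>)

lemma holds_pull: "holds (pull g \<rho>) J h \<longleftrightarrow> holds \<rho> J (g \<circ> h)"
  by (simp add: holds_def pull_def)

section \<open>Amalgamation\<close>

definition interp_of :: "interp \<Rightarrow> (nat set \<Rightarrow> (nat \<Rightarrow> nat) \<Rightarrow> bool) \<Rightarrow> interp" where
  "interp_of R Q s = (if s < length es then R s
     else {map h (bl (set_decode (s - length es))) | h. Q (set_decode (s - length es)) h})"

lemma interp_of_edge: "j < length es \<Longrightarrow> interp_of R Q j = R j"
  by (simp add: interp_of_def)

text \<open>The assumptions on \<open>{}\<close> and \<open>All\<close> match the conventions built
  into \<open>holds\<close>, and the last one says that \<open>Q J\<close> depends only on boundary
  values.\<close>

lemma holds_interp_of: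
  assumes "\<And>h. Q {} h" "\<And>h. \<not> Q All h" "J \<subseteq> All"
    "\<And>h h'. (\<And>v. v \<in> bd J \<Longrightarrow> h v = h' v) \<Longrightarrow> Q J h \<Longrightarrow> Q J h'"
  shows "holds (interp_of R Q) J h \<longleftrightarrow> Q J h"
proof -
  have "interp_of R Q (sym J) = {map h (bl J) | h. Q J h}"
    using decode_sym[OF assms(3)] by (simp add: interp_of_def sym_def)
  moreover have "Q J h" if "map h (bl J) = map h' (bl J)" "Q J h'" for h'
    using assms(4)[of h' h] that by (metis map_eq_conv set_bl)
  ultimately show ?thesis using assms(1,2) by (auto simp: holds_def)
qed

lemma ex_map: "length xs = length ts \<Longrightarrow> distinct xs \<Longrightarrow> \<exists>h. map h xs = ts"
proof (induction xs ts rule: list_induct2)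
  case (Cons x xs t ts)
  then obtain h where "map h xs = ts" by auto
  then show ?case using Cons.prems by (intro exI[of _ "h(x := t)"]) auto
qed simp

lemma boundary_tuple:
  assumes "r \<in> sg" "\<not> r < length es" "t \<in> tuples D (ar r)"
  shows "\<exists>J h. proper J \<and> r = sym J \<and> t = map h (bl J) \<and> h ` bd J \<subseteq> D"
proof -
  obtain J where J: "proper J" "r = sym J" using assms(1,2) by (auto simp: sg_def)
  then have "length (bl J) = length t" using assms(3) ar_sym[of J]
      by (auto simp: tuples_def proper_def)
  then obtain h where h: "map h (bl J) = t" using ex_map distinct_bl by blast
  then have "h ` bd J \<subseteq> D" using assms(3) by (auto simp: tuples_def simp flip: set_bl)
  then show ?thesis using J h by blast
qed

text \<open>A boundary vertex of \<open>J2\<close> lies in \<open>J1\<close>, and then in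
  \<open>bd J1\<close>, or else in \<open>bd (J1 \<union> J2)\<close>. Either way it is mapped into
  \<open>D\<close>. So the formula for \<open>J2\<close> speaks about \<open>D \<inter> E\<close>
  and can be read in \<open>\<rho>\<close>.\<close>

lemma join_from_other:
  assumes K: "K D \<rho>" and agr: "\<And>r t. r \<in> sg \<Longrightarrow> t \<in> tuples (D \<inter> E) (ar r) \<Longrightarrow> t \<in> \<rho> r \<longleftrightarrow> t \<in> \<sigma> r"
    and J: "J1 \<subseteq> All" "J2 \<subseteq> All" "J1 \<inter> J2 = {}" and g: "g ` bd J1 \<subseteq> D" "g ` bd J2 \<subseteq> E"
    and h: "holds \<rho> J1 g" "holds \<sigma> J2 g" and b: "g ` bd (J1 \<union> J2) \<subseteq> D"
  shows "holds \<rho> (J1 \<union> J2) g"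
proof -
  have *: "g v \<in> D" if v: "v \<in> bd J2" for v
  proof (cases "v \<in> verts J1")
    case True
    then have "v \<in> bd J1" using bd_disjoint[of J2 J1] v J bd_verts[of J2] by auto
    then show ?thesis using g by auto
  next
    case False
    have "All - J2 \<subseteq> J1 \<union> (All - (J1 \<union> J2))" by auto
    then have "verts (All - J2) \<subseteq> verts J1 \<union> verts (All - (J1 \<union> J2))"
      using verts_mono verts_Un by metis
    then have "v \<in> bd (J1 \<union> J2)" using v False by (auto simp: bd_def verts_Un)
    then show ?thesis using b by blast
  qed
  then have "holds \<rho> J2 g \<longleftrightarrow> holds \<sigma> J2 g" using agr J g by (intro holds_agree[of "D \<inter> E"]) auto
  then show ?thesis using J g h * by (intro K_join[OF K]) auto
qed

text \<open>In the amalgam, the edges in \<open>J\<close> are split into those mapped into the one factor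
    and those mapped
  into the other.\<close>

lemma K_amalg:
  assumes K1: "K D \<rho>" and K2: "K E \<sigma>"
    and agr: "\<And>r t. r \<in> sg \<Longrightarrow> t \<in> tuples (D \<inter> E) (ar r) \<Longrightarrow> t \<in> \<rho> r \<longleftrightarrow> t \<in> \<sigma> r"
  shows "\<exists>\<tau>. K (D \<union> E) \<tau> \<and> (\<forall>r\<in>sg. \<forall>t\<in>tuples D (ar r). t \<in> \<tau> r \<longleftrightarrow> t \<in> \<rho> r) \<and>
        (\<forall>r\<in>sg. \<forall>t\<in>tuples E (ar r). t \<in> \<tau> r \<longleftrightarrow> t \<in> \<sigma> r)"
proof -
  define split where "split J1 J2 g \<longleftrightarrow> J1 \<subseteq> All \<and> J2 \<subseteq> All \<and> J1 \<inter> J2 = {} \<and> g ` bd J1 \<subseteq> D \<and>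
      g ` bd J2 \<subseteq> E \<and>
     holds \<rho> J1 g \<and> holds \<sigma> J2 g" for J1 J2 g
  \<comment> \<open>\<open>g\<close> has to agree with \<open>h\<close> on the boundary only; its
    values at inner vertices are existentially quantified.\<close>
  define Q where "Q J h \<longleftrightarrow> (\<exists>J1 J2 g. J = J1 \<union> J2 \<and> split J1 J2 g \<and> (\<forall>v\<in>bd J. g v = h v))" for J h
  have Q_I: "Q J h" if "J = J1 \<union> J2" "split J1 J2 g" "\<And>v. v \<in> bd J \<Longrightarrow> g v = h v" for J J1 J2 g h
    using that unfolding Q_def by blast
  have Q_D: "holds \<rho> J h" if Q: "Q J h" and h: "h ` bd J \<subseteq> D" for J h
  proof -
    obtain J1 J2 g where J: "J = J1 \<union> J2" and s: "split J1 J2 g" and g: "\<And>v. v \<in> bd J \<Longrightarrow> g v = h v"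
      using Q unfolding Q_def by blast
    have "holds \<rho> (J1 \<union> J2) g"
      using agr s h g J by (intro join_from_other[OF K1, of E \<sigma>]) (auto simp: split_def)
    then show ?thesis using holds_cong[of J g h] g J by simp
  qed
  have Q_E: "holds \<sigma> J h" if Q: "Q J h" and h: "h ` bd J \<subseteq> E" for J h
  proof -
    obtain J1 J2 g where J: "J = J2 \<union> J1" and s: "split J1 J2 g" and g: "\<And>v. v \<in> bd J \<Longrightarrow> g v = h v"
      using Q unfolding Q_def by (metis Un_commute)
    have "holds \<sigma> (J2 \<union> J1) g"
      using agr s h g J by (intro join_from_other[OF K2, of D \<rho>]) (auto simp: split_def Int_commute)
    then show ?thesis using holds_cong[of J g h] g J by simp
  qed
  have Q_in: "Q J h" if "J \<subseteq> All" "h ` bd J \<subseteq> D" "holds \<rho> J h" for J h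
    by (rule Q_I[of J J "{}" h]) (use that in \<open>auto simp: split_def holds_def bd_def verts_def\<close>)
  have Q_in': "Q J h" if "J \<subseteq> All" "h ` bd J \<subseteq> E" "holds \<sigma> J h" for J h
    by (rule Q_I[of J "{}" J h]) (use that in \<open>auto simp: split_def holds_def bd_def verts_def\<close>)
  have bdAll: "bd All = {}" "bd {} = {}" by (auto simp: bd_def verts_def)
  have Q0: "Q {} h" for h by (rule Q_in) (auto simp: holds_def bdAll)
  \<comment> \<open>As \<open>bd All\<close> is empty, \<open>Q_D\<close> applies to every
    \<open>h\<close> and would make \<open>holds \<rho> All h\<close> true.\<close>
  have Q1: "\<not> Q All h" for h
    using Q_D[of All h] All_ne by (auto simp: holds_def bdAll)
  have Q_cong: "Q J h'" if "\<And>v. v \<in> bd J \<Longrightarrow> h v = h' v" "Q J h" for J h h'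
    using that unfolding Q_def by metis
  have Q_join: "Q (J \<union> L) h"
    if sub: "J \<subseteq> All" "L \<subseteq> All" "J \<inter> L = {}" and Q: "Q J h" "Q L h" for J L h
  proof -
    obtain J1 J2 g where J: "J = J1 \<union> J2" and s: "split J1 J2 g" and g: "\<And>v. v \<in> bd J \<Longrightarrow> g v = h v"
      using Q(1) unfolding Q_def by blast
    obtain L1 L2 k where L: "L = L1 \<union> L2" and t: "split L1 L2 k" and k: "\<And>v. v \<in> bd L \<Longrightarrow> k v = h v"
      using Q(2) unfolding Q_def by blast
    \<comment> \<open>A vertex common to \<open>J\<close> and \<open>L\<close> is on both
      boundaries, where \<open>g\<close> and \<open>k\<close> both equal \<open>h\<close>. Hence
      \<open>f\<close> agrees with \<open>g\<close> on \<open>J\<close> and with \<open>k\<close> on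
      \<open>L\<close>.\<close>
    define f where "f v = (if v \<in> verts J then g v else k v)" for v
    have fg: "f v = g v" if "v \<in> verts J" for v using that by (simp add: f_def)
    have fk: "f v = k v" if v: "v \<in> verts L" for v
    proof (cases "v \<in> verts J")
      case True
      then have "v \<in> bd J" "v \<in> bd L"
        using v bd_disjoint[of L J] bd_disjoint[of J L] sub by auto
      then show ?thesis using g k by (simp add: f_def)
    qed (simp add: f_def)
    have bJ: "bd J1 \<subseteq> verts J" "bd J2 \<subseteq> verts J" "bd L1 \<subseteq> verts L" "bd L2 \<subseteq> verts L"
      unfolding J L verts_Un using bd_verts by blast+
    have im: "f ` bd J1 \<subseteq> D" "f ` bd J2 \<subseteq> E" "f ` bd L1 \<subseteq> D" "f ` bd L2 \<subseteq> E"
      using s t fg fk bJ unfolding split_def by (auto simp: image_subset_iff subset_iff)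
    have hs: "holds \<rho> J1 f" "holds \<sigma> J2 f" "holds \<rho> L1 f" "holds \<sigma> L2 f"
      using s t holds_cong[of J1 f g \<rho>] holds_cong[of J2 f g \<sigma>] holds_cong[of L1 f k \<rho>]
          holds_cong[of L2 f k \<sigma>]
        fg fk bJ unfolding split_def by (auto simp: subset_iff)
    have "split (J1 \<union> L1) (J2 \<union> L2) f"
      unfolding split_def
    proof (intro conjI)
      show "holds \<rho> (J1 \<union> L1) f"
        using im hs s t sub J L by (intro K_join[OF K1]) (auto simp: split_def)
      show "holds \<sigma> (J2 \<union> L2) f"
        using im hs s t sub J L by (intro K_join[OF K2]) (auto simp: split_def)
      show "f ` bd (J1 \<union> L1) \<subseteq> D" "f ` bd (J2 \<union> L2) \<subseteq> E"
        using subset_trans[OF image_mono[OF bd_Un[of J1 L1], of f], of D]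
          subset_trans[OF image_mono[OF bd_Un[of J2 L2], of f], of E] im
        by (simp_all add: image_Un)
    qed (use s t sub J L in \<open>auto simp: split_def\<close>)
    moreover have "f v = h v" if v: "v \<in> bd (J \<union> L)" for v
    proof -
      have "v \<in> verts (All - J)" "v \<in> verts (All - L)"
        using v verts_mono[of "All - (J \<union> L)" "All - J"] verts_mono[of "All - (J \<union> L)" "All - L"]
        by (auto simp: bd_def)
      moreover have "v \<in> verts J \<or> v \<in> verts L" using v by (auto simp: bd_def verts_Un)
      ultimately show ?thesis using fg fk g k by (auto simp: bd_def)
    qed
    ultimately show ?thesis by (intro Q_I[of "J \<union> L" "J1 \<union> L1" "J2 \<union> L2" f h]) (use J L in auto)
  qed
  \<comment> \<open>The edge relations are amalgamated freely; only the symbols for parts can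
    acquire mixed tuples.\<close>
  define R where "R j = (\<rho> j \<inter> tuples D (ar j)) \<union> (\<sigma> j \<inter> tuples E (ar j))" for j
  let ?\<tau> = "interp_of R Q"
  have hQ: "holds ?\<tau> J h \<longleftrightarrow> Q J h" if "J \<subseteq> All" for J h
    by (rule holds_interp_of[OF Q0 Q1 that]) (rule Q_cong)
  have K_tau: "K (D \<union> E) ?\<tau>"
    unfolding K_def
  proof (intro conjI allI impI)
    fix j h assume j: "j < length es" and "map h (es ! j) \<in> ?\<tau> j"
    then have "map h (es ! j) \<in> \<rho> j \<inter> tuples D (ar j) \<or> map h (es ! j) \<in> \<sigma> j \<inter> tuples E (ar j)"
      by (simp add: interp_of_edge R_def)
    then have "Q {j} h"
    proof
      assume a: "map h (es ! j) \<in> \<rho> j \<inter> tuples D (ar j)"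
      then have "h ` set (es ! j) \<subseteq> D" by (auto simp: tuples_def)
      then show ?thesis using K_edge[OF K1 j _ ] a j bd_single[of j] by (intro Q_in) auto
    next
      assume a: "map h (es ! j) \<in> \<sigma> j \<inter> tuples E (ar j)"
      then have "h ` set (es ! j) \<subseteq> E" by (auto simp: tuples_def)
      then show ?thesis using K_edge[OF K2 j _ ] a j bd_single[of j] by (intro Q_in') auto
    qed
    then show "holds ?\<tau> {j} h" using hQ j by simp
  next
    fix J L h assume "J \<subseteq> All" "L \<subseteq> All" "J \<inter> L = {}" "holds ?\<tau> J h" "holds ?\<tau> L h"
    then show "holds ?\<tau> (J \<union> L) h" using hQ Q_join by simp
  qed
  have tau: "t \<in> ?\<tau> r \<longleftrightarrow> t \<in> \<alpha> r"
    if r: "r \<in> sg" and t: "t \<in> tuples C (ar r)" and R: "t \<in> R r \<longleftrightarrow> t \<in> \<alpha> r"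
      and Q: "\<And>J h. J \<subseteq> All \<Longrightarrow> h ` bd J \<subseteq> C \<Longrightarrow> Q J h \<longleftrightarrow> holds \<alpha> J h" for r t C \<alpha>
  proof (cases "r < length es")
    case True
    then show ?thesis using R by (simp add: interp_of_edge)
  next
    case False
    then obtain J h where J: "proper J" "r = sym J" "t = map h (bl J)" "h ` bd J \<subseteq> C"
      using boundary_tuple[OF r _ t] by blast
    then show ?thesis using hQ[of J h] Q[of J h] by (auto simp: holds_def proper_def)
  qed
  have "t \<in> ?\<tau> r \<longleftrightarrow> t \<in> \<rho> r" if r: "r \<in> sg" and t: "t \<in> tuples D (ar r)" for r t
  proof (rule tau[OF r t])
    show "t \<in> R r \<longleftrightarrow> t \<in> \<rho> r" using agr[OF r, of t] t by (auto simp: R_def tuples_def)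
  qed (use Q_D Q_in in blast)
  moreover have "t \<in> ?\<tau> r \<longleftrightarrow> t \<in> \<sigma> r" if r: "r \<in> sg" and t: "t \<in> tuples E (ar r)" for r t
  proof (rule tau[OF r t])
    show "t \<in> R r \<longleftrightarrow> t \<in> \<sigma> r" using agr[OF r, of t] t by (auto simp: R_def tuples_def)
  qed (use Q_E Q_in' in blast)
  ultimately show ?thesis using K_tau by blast
qed

lemma K_pull: "K (g ` D) \<rho> \<Longrightarrow> K D (pull g \<rho>)"
proof -
  assume k: "K (g ` D) \<rho>"
  show ?thesis
    unfolding K_def holds_pull
  proof (intro conjI allI impI)
    fix j h assume "j < length es" "h ` set (es ! j) \<subseteq> D" "map h (es ! j) \<in> pull g \<rho> j"
    then show "holds \<rho> {j} (g \<circ> h)" using K_edge[OF k, of j "g \<circ> h"] by (auto simp: pull_def)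
  next
    fix J J' h assume "J \<subseteq> All" "J' \<subseteq> All" "J \<inter> J' = {}" "h ` (bd J \<union> bd J') \<subseteq> D"
      "holds \<rho> J (g \<circ> h)" "holds \<rho> J' (g \<circ> h)"
    moreover from this have "(g \<circ> h) ` (bd J \<union> bd J') \<subseteq> g ` D" unfolding image_comp[symmetric]
        by blast
    ultimately show "holds \<rho> (J \<union> J') (g \<circ> h)" using K_join[OF k, of J J' "g \<circ> h"] by blast
  qed
qed

lemma K_cong:
  assumes "\<And>r t. r \<in> sg \<Longrightarrow> t \<in> tuples D (ar r) \<Longrightarrow> t \<in> \<rho> r \<longleftrightarrow> t \<in> \<rho>' r" "K D \<rho>"
  shows "K D \<rho>'"
  unfolding K_def
proof (intro conjI allI impI)
  fix j h assume j: "j < length es" and h: "h ` set (es ! j) \<subseteq> D" and m: "map h (es ! j) \<in> \<rho>' j"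
  have "map h (es ! j) \<in> tuples D (ar j)" "j \<in> sg" using j h
      by (auto simp: tuples_def ar_def sg_def)
  then have "map h (es ! j) \<in> \<rho> j" using assms(1) m by blast
  then have "holds \<rho> {j} h" using K_edge[OF assms(2) j h] by blast
  moreover have "h ` bd {j} \<subseteq> D" using image_mono[OF bd_single[of j], of h] h by simp
  ultimately show "holds \<rho>' {j} h"
    using holds_agree[of D \<rho> \<rho>' "{j}" h] assms(1) bd_single[of j] h j by auto
next
  fix J J' h assume J: "J \<subseteq> All" "J' \<subseteq> All" "J \<inter> J' = {}" "h ` (bd J \<union> bd J') \<subseteq> D"
    "holds \<rho>' J h" "holds \<rho>' J' h"
  have "h ` bd (J \<union> J') \<subseteq> D" using bd_Un[of J J'] J by blast
  moreover have "h ` bd J \<subseteq> D" "h ` bd J' \<subseteq> D" using J(4) by (simp_all add: image_Un)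
  ultimately show "holds \<rho>' (J \<union> J') h"
    using J K_join[OF assms(2), of J J' h] holds_agree[of D \<rho> \<rho>' J h] holds_agree[of D \<rho> \<rho>' J' h]
      holds_agree[of D \<rho> \<rho>' "J \<union> J'" h] assms(1) by auto
qed

text \<open>An instance of an axiom speaks about the image of a set of vertices, whence the bound
  \<open>card (verts All)\<close>. The image is nonempty because edges and boundaries of proper
  parts are.\<close>

lemma K_local:
  assumes "\<And>S. S \<subseteq> D \<Longrightarrow> S \<noteq> {} \<Longrightarrow> finite S \<Longrightarrow> card S \<le> card (verts All) \<Longrightarrow> K S \<rho>"
  shows "K D \<rho>"
proof -
  have *: "K (h ` X) \<rho>" if "h ` X \<subseteq> D" "X \<noteq> {}" "X \<subseteq> verts All" for h :: "nat \<Rightarrow> nat" and X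
  proof (rule assms)
    have fin: "finite X" using that(3) finite_verts[of All] finite_subset by blast
    then show "finite (h ` X)" by simp
    show "card (h ` X) \<le> card (verts All)"
      using card_image_le[OF fin, of h] card_mono[OF finite_verts[of All] that(3)] by simp
  qed (use that in auto)
  show ?thesis
    unfolding K_def
  proof (intro conjI allI impI)
    fix j h assume j: "j < length es" "h ` set (es ! j) \<subseteq> D" "map h (es ! j) \<in> \<rho> j"
    have "K (h ` set (es ! j)) \<rho>" using j edge_ne by (intro *) (auto simp: verts_def)
    from K_edge[OF this j(1) _ j(3)] show "holds \<rho> {j} h" by simp
  next
    fix J J' h assume J: "J \<subseteq> All" "J' \<subseteq> All" "J \<inter> J' = {}" "h ` (bd J \<union> bd J') \<subseteq> D"
      "holds \<rho> J h" "holds \<rho> J' h"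
    show "holds \<rho> (J \<union> J') h"
    proof (cases "proper J")
      case True
      have "K (h ` (bd J \<union> bd J')) \<rho>"
        using J(4) bd_ne[OF True] bd_verts[of J] bd_verts[of J'] verts_mono[OF J(1)] verts_mono[OF
            J(2)]
        by (intro *) auto
      from K_join[OF this J(1-3) _ J(5,6)] show ?thesis by simp
    qed (use J in \<open>auto simp: proper_def holds_def\<close>)
  qed
qed

lemma amalgamation_class: "amalgamation_class sg ar K (card (verts All))"
proof
  show "finite sg" by (auto simp: sg_def proper_def intro: finite_subset[of _ "Pow All"])
  show "1 \<le> ar r" if r: "r \<in> sg" for r
  proof (cases "r < length es")
    case True
    then show ?thesis using edge_ne[of r] by (cases "es ! r") (auto simp: ar_def)
  next
    case False
    then obtain J where J: "proper J" "r = sym J" using r by (auto simp: sg_def)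
    have "bl J \<noteq> []" using bd_ne[OF J(1)] set_bl[of J] by (metis set_empty)
    then show ?thesis using J ar_sym[of J] by (cases "bl J") (auto simp: proper_def)
  qed
  show "K D \<rho> \<Longrightarrow> E \<subseteq> D \<Longrightarrow> K E \<rho>" for D E \<rho>
    unfolding K_def by (meson subset_trans)
  show "K D (\<lambda>r. {})" for D
    by (auto simp: K_def holds_def)
  show "K D \<rho>'" if "\<And>r t. r \<in> sg \<Longrightarrow> t \<in> tuples D (ar r) \<Longrightarrow> t \<in> \<rho> r \<longleftrightarrow> t \<in> \<rho>' r" "K D \<rho>" for D \<rho> \<rho>'
    using that by (rule K_cong)
  show "K (g ` D) \<rho> \<Longrightarrow> K D (pull g \<rho>)" for g D \<rho>
    by (rule K_pull)
  show "K D \<rho>" if "\<And>S. S \<subseteq> D \<Longrightarrow> S \<noteq> {} \<Longrightarrow> finite S \<Longrightarrow> card S \<le> card (verts All) \<Longrightarrow> K S \<rho>" for D \<rho>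
    using that by (rule K_local)
  show "\<exists>\<tau>. K (D \<union> E) \<tau> \<and> (\<forall>r\<in>sg. \<forall>t\<in>tuples D (ar r). t \<in> \<tau> r \<longleftrightarrow> t \<in> \<rho> r) \<and>
        (\<forall>r\<in>sg. \<forall>t\<in>tuples E (ar r). t \<in> \<tau> r \<longleftrightarrow> t \<in> \<sigma> r)"
    if "K D \<rho>" "K E \<sigma>" "\<And>r t. r \<in> sg \<Longrightarrow> t \<in> tuples (D \<inter> E) (ar r) \<Longrightarrow> t \<in> \<rho> r \<longleftrightarrow> t \<in> \<sigma> r" for D E \<rho> \<sigma>
    using that by (rule K_amalg)
qed

sublocale amalgamation_class sg ar K "card (verts All)"
  by (rule amalgamation_class)

section \<open>The limit as a dual of the forbidden structure\<close>

lemma holds_subsets: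
  assumes "K D \<rho>" "\<And>j. j < length es \<Longrightarrow> map h (es ! j) \<in> \<rho> j" "h ` verts All \<subseteq> D" "J \<subseteq> All"
  shows "holds \<rho> J h"
  using finite_sub[OF assms(4)] assms(4)
proof (induction J rule: finite_induct)
  case (insert j J)
  have "holds \<rho> {j} h" using insert.prems assms(2,3)
      by (intro K_edge[OF assms(1)]) (auto simp: verts_def)
  moreover have "h ` (bd {j} \<union> bd J) \<subseteq> D"
    using assms(3) bd_verts[of "{j}"] bd_verts[of J] verts_mono[of
        "{j}" All] verts_mono[of J All] insert.prems
    by blast
  ultimately have "holds \<rho> ({j} \<union> J) h" using insert by (intro K_join[OF assms(1)]) auto
  then show ?case by simp
qed (simp add: holds_def)

text \<open>A copy of the structure would, one edge at a time, make \<open>holds\<close> true for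
  \<open>All\<close>.\<close>

lemma limit_free: "\<not> (\<exists>h. \<forall>j<length es. map h (es ! j) \<in> limit j)"
proof
  assume "\<exists>h. \<forall>j<length es. map h (es ! j) \<in> limit j"
  then obtain h where "\<And>j. j < length es \<Longrightarrow> map h (es ! j) \<in> limit j" by blast
  then have "holds limit All h"
    using limit_K[of "h ` verts All"] finite_verts[of All] by (intro holds_subsets) auto
  then show False using All_ne by (simp add: holds_def)
qed

text \<open>The relations \<open>R\<close> are expanded by the true meaning of the symbols: the
  boundary values extend to a homomorphism of the edges in \<open>J\<close>. Nothing holds for
  \<open>All\<close>, because there is no copy in \<open>R\<close>, so the expansion is in the class
  and embeds into the limit.\<close>

lemma limit_hom:
  fixes R :: interp
  assumes free: "\<not> (\<exists>h. \<forall>j<length es. map h (es ! j) \<in> R j)"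
    and len: "\<And>j t. j < length es \<Longrightarrow> t \<in> R j \<Longrightarrow> length t = length (es ! j)"
  shows "\<exists>g. \<forall>j<length es. \<forall>t\<in>R j. map g t \<in> limit j"
proof -
  define Q where "Q J h \<longleftrightarrow> (\<exists>h'. (\<forall>v\<in>bd J. h' v = h v) \<and> (\<forall>j\<in>J. map h' (es ! j) \<in> R j))" for J h
  have Q0: "Q {} h" for h by (auto simp: Q_def bd_def verts_def)
  have Q1: "\<not> Q All h" for h using free by (auto simp: Q_def)
  have Q_cong: "Q J h'" if "\<And>v. v \<in> bd J \<Longrightarrow> h v = h' v" "Q J h" for J h h'
    using that unfolding Q_def by metis
  let ?\<rho> = "interp_of R Q"
  have hQ: "holds ?\<rho> J h \<longleftrightarrow> Q J h" if "J \<subseteq> All" for J h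
    by (rule holds_interp_of[OF Q0 Q1 that]) (rule Q_cong)
  have "K D ?\<rho>" for D
    unfolding K_def
  proof (intro conjI allI impI)
    fix j h assume "j < length es" "map h (es ! j) \<in> ?\<rho> j"
    then show "holds ?\<rho> {j} h" using hQ[of "{j}" h] by (auto simp: interp_of_edge Q_def)
  next
    fix J L h assume JL: "J \<subseteq> All" "L \<subseteq> All" "J \<inter> L = {}" "holds ?\<rho> J h" "holds ?\<rho> L h"
    have "Q J h" using hQ[of J h] JL by simp
    then obtain h1 where h1: "\<forall>v\<in>bd J. h1 v = h v" "\<forall>j\<in>J. map h1 (es ! j) \<in> R j"
      unfolding Q_def by blast
    have "Q L h" using hQ[of L h] JL by simp
    then obtain h2 where h2: "\<forall>v\<in>bd L. h2 v = h v" "\<forall>j\<in>L. map h2 (es ! j) \<in> R j"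
      unfolding Q_def by blast
    define f where "f v = (if v \<in> verts J then h1 v else h2 v)" for v
    have f1: "f v = h1 v" if "v \<in> verts J" for v using that by (simp add: f_def)
    have f2: "f v = h2 v" if v: "v \<in> verts L" for v
    proof (cases "v \<in> verts J")
      case True
      then have "v \<in> bd J" "v \<in> bd L" using v bd_disjoint[of L J] bd_disjoint[of J L] JL by auto
      then show ?thesis using h1 h2 by (simp add: f_def)
    qed (simp add: f_def)
    have "map f (es ! j) \<in> R j" if "j \<in> J \<union> L" for j
    proof (cases "j \<in> J")
      case True
      then have "map f (es ! j) = map h1 (es ! j)" using f1 by (auto simp: verts_def)
      then show ?thesis using bspec[OF h1(2) True] by metis
    next
      case False
      then have j: "j \<in> L" using that by simp
      then have "map f (es ! j) = map h2 (es ! j)" using f2 by (auto simp: verts_def)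
      then show ?thesis using bspec[OF h2(2) j] by metis
    qed
    moreover have "f v = h v" if v: "v \<in> bd (J \<union> L)" for v
    proof -
      have "v \<in> bd J \<or> v \<in> bd L" using v bd_Un by blast
      then show ?thesis using f1 f2 h1(1) h2(1) bd_verts by (metis subsetD)
    qed
    ultimately have "Q (J \<union> L) h" unfolding Q_def by blast
    then show "holds ?\<rho> (J \<union> L) h" using hQ JL by simp
  qed
  then obtain g where g: "inj_on g UNIV"
    "\<And>r t. r \<in> sg \<Longrightarrow> t \<in> tuples UNIV (ar r) \<Longrightarrow> t \<in> ?\<rho> r \<longleftrightarrow> map g t \<in> limit r"
    by (rule limit_universal[of UNIV ?\<rho>]) blast
  have "map g t \<in> limit j" if "j < length es" "t \<in> R j" for j t
    using g(2)[of j t] len that by (auto simp: tuples_def sg_def ar_def interp_of_edge)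
  then show ?thesis by blast
qed

section \<open>The reduct to the edge relations\<close>

definition edge_struct :: "(nat, nat) rel_struct" where
  "edge_struct = \<lparr>universe = UNIV, sig = All, arity = (\<lambda>j. length (es ! j)), rel = limit\<rparr>"

lemma edge_struct_simps:
  "universe edge_struct = UNIV" "sig edge_struct = All" "arity edge_struct j = length (es ! j)"
  "rel edge_struct = limit"
  by (simp_all add: edge_struct_def)

lemma limit_edge: "j < length es \<Longrightarrow> limit j \<subseteq> tuples UNIV (length (es ! j))"
  using limit_tuples[of j] by (simp add: ar_def)

lemma is_structure_edge_struct: "is_structure edge_struct"
  using es_ne edge_ne limit_edge by (auto simp: is_structure_def edge_struct_simps Suc_le_eq)

text \<open>The reduct merely forgets the symbols for parts, so atoms serve as definitions.\<close>

lemma fo_reduct_edge_struct: "fo_reduct edge_struct limit_struct"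
  unfolding fo_reduct_def fo_definable_def
proof (intro conjI ballI)
  fix j assume j: "j \<in> sig edge_struct"
  let ?k = "length (es ! j)"
  have j': "j < length es" using j by (simp add: edge_struct_simps)
  have "map ((!) t) [0..<?k] = t" if "length t = ?k" for t :: "nat list" using map_nth[of t] that
      by simp
  then have lim: "limit j = {t \<in> tuples UNIV ?k. map ((!) t) [0..<?k] \<in> limit j}"
    using limit_edge[OF j'] by (auto simp: tuples_def)
  show "\<exists>p. formula_wf limit_struct p \<and> free_vars p \<subseteq> {..<arity edge_struct j} \<and>
      rel edge_struct j = {t \<in> tuples (universe limit_struct) (arity edge_struct j).
        formula_holds limit_struct (\<lambda>i. t ! i) p}"
  proof (intro exI[of _ "Atom (ARel j [0..<?k])"] conjI)
    show "formula_wf limit_struct (Atom (ARel j [0..<?k]))"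
      unfolding formula_wf.simps atom_wf.simps limit_struct_def rel_struct.simps
      using j' by (simp add: sg_def ar_def)
    show "free_vars (Atom (ARel j [0..<?k])) \<subseteq> {..<arity edge_struct j}"
      by (auto simp: edge_struct_simps)
    show "rel edge_struct j = {t \<in> tuples (universe limit_struct) (arity edge_struct j).
        formula_holds limit_struct (\<lambda>i. t ! i) (Atom (ARel j [0..<?k]))}"
      unfolding edge_struct_simps limit_struct_def rel_struct.simps formula_holds.simps
          atom_holds.simps
      by (rule lim)
  qed
qed (simp add: edge_struct_def limit_struct_def)

lemma csp_poly_time_edge_struct:
  assumes "verts All = {..<N}"
  shows "csp_poly_time edge_struct"
proof (rule csp_poly_time_forbidden[of es N])
  show "(\<Union>j<length es. set (es ! j)) = {..<N}" using assms by (simp add: verts_def)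
  show "\<not> (\<exists>h. \<forall>j<length es. map h (es ! j) \<in> rel edge_struct j)"
    unfolding edge_struct_simps by (rule limit_free)
  show "\<exists>g. \<forall>j<length es. \<forall>t\<in>R j. map g t \<in> rel edge_struct j"
    if "\<not> (\<exists>h. \<forall>j<length es. map h (es ! j) \<in> R j)"
      "\<And>j t. j < length es \<Longrightarrow> t \<in> R j \<Longrightarrow> length t = length (es ! j)" for R :: interp
    unfolding edge_struct_simps using that by (rule limit_hom)
qed (simp_all add: edge_struct_simps)

end

section \<open>Height 1 conditions\<close>

lemma satisfiesE:
  assumes "satisfies D \<A> \<Sigma>"
  obtains I where "\<And>f. f \<in> lhs_sym ` \<Sigma> \<union> rhs_sym ` \<Sigma> \<Longrightarrow> I f \<in> \<A> (snd f)"
    "\<And>e s. e \<in> \<Sigma> \<Longrightarrow> range s \<subseteq> D \<Longrightarrow>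
      I (lhs_sym e) (map s (lhs_vars e)) = I (rhs_sym e) (map s (rhs_vars e))"
proof -
  from assms obtain I where 1: "\<forall>f \<in> lhs_sym ` \<Sigma> \<union> rhs_sym ` \<Sigma>. I f \<in> \<A> (snd f)"
    and 2: "\<forall>e\<in>\<Sigma>. \<forall>s. range s \<subseteq> D \<longrightarrow>
      I (lhs_sym e) (map s (lhs_vars e)) = I (rhs_sym e) (map s (rhs_vars e))"
    unfolding satisfies_def by (elim exE conjE)
  show thesis by (rule that[OF bspec[OF 1] 2[rule_format]])
qed

lemma satisfiesI:
  assumes "\<And>f. f \<in> lhs_sym ` \<Sigma> \<union> rhs_sym ` \<Sigma> \<Longrightarrow> I f \<in> \<A> (snd f)"
    "\<And>e s. e \<in> \<Sigma> \<Longrightarrow> range s \<subseteq> D \<Longrightarrow>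
      I (lhs_sym e) (map s (lhs_vars e)) = I (rhs_sym e) (map s (rhs_vars e))"
  shows "satisfies D \<A> \<Sigma>"
  unfolding satisfies_def by (intro exI[of _ I] conjI ballI allI impI) (fact assms)+

lemma satisfies_subset:
  assumes "satisfies D \<A> \<Sigma>" "\<Sigma>' \<subseteq> \<Sigma>"
  shows "satisfies D \<A> \<Sigma>'"
  using assms(1)
proof (rule satisfiesE)
  fix I assume "\<And>f. f \<in> lhs_sym ` \<Sigma> \<union> rhs_sym ` \<Sigma> \<Longrightarrow> I f \<in> \<A> (snd f)"
    "\<And>e s. e \<in> \<Sigma> \<Longrightarrow> range s \<subseteq> D \<Longrightarrow>
      I (lhs_sym e) (map s (lhs_vars e)) = I (rhs_sym e) (map s (rhs_vars e))"
  then show ?thesis using assms(2) by (intro satisfiesI[of _ I]) blast+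
qed

text \<open>The two sides of an identity are minors of a common arity \<open>k\<close>, and
  \<open>\<xi>\<close> commutes with minors.\<close>

lemma satisfies_minion_homomorphism:
  assumes xi: "minion_homomorphism D \<A> E \<B> \<xi>" and h: "height1_condition \<Sigma>"
      and sat: "satisfies D \<A> \<Sigma>"
  shows "satisfies E \<B> \<Sigma>"
proof -
  obtain I where I: "\<And>f. f \<in> lhs_sym ` \<Sigma> \<union> rhs_sym ` \<Sigma> \<Longrightarrow> I f \<in> \<A> (snd f)"
    and eqs: "\<And>e s. e \<in> \<Sigma> \<Longrightarrow> range s \<subseteq> D \<Longrightarrow>
      I (lhs_sym e) (map s (lhs_vars e)) = I (rhs_sym e) (map s (rhs_vars e))"
    using sat by (rule satisfiesE) blast
  have ar: "1 \<le> snd f" if "f \<in> lhs_sym ` \<Sigma> \<union> rhs_sym ` \<Sigma>" for f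
    using h that by (auto simp: height1_condition_def h1_identity_wf_def)
  have mem: "\<xi> (snd f) (I f) \<in> \<B> (snd f)" if "f \<in> lhs_sym ` \<Sigma> \<union> rhs_sym ` \<Sigma>" for f
    using xi I[OF that] ar[OF that] unfolding minion_homomorphism_def by blast
  have "\<xi> (snd (lhs_sym e)) (I (lhs_sym e)) (map s (lhs_vars e)) =
      \<xi> (snd (rhs_sym e)) (I (rhs_sym e)) (map s (rhs_vars e))"
    if e: "e \<in> \<Sigma>" and s: "range s \<subseteq> E" for e s
  proof -
    let ?f = "lhs_sym e" and ?g = "rhs_sym e"
    have l: "length (lhs_vars e) = snd ?f" "length (rhs_vars e) = snd ?g"
      using h e by (auto simp: height1_condition_def h1_identity_wf_def)
    obtain k where k: "\<And>v. v \<in> set (lhs_vars e) \<union> set (rhs_vars e) \<Longrightarrow> v < k"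
      using finite_nat_set_iff_bounded[of "set (lhs_vars e) \<union> set (rhs_vars e)"] by auto
    have "lhs_vars e \<noteq> []" using l ar[of ?f] e by auto
    then have k1: "1 \<le> k" using k[of "hd (lhs_vars e)"] by simp
    have mm: "map (\<lambda>i. xs ! (vs ! i)) [0..<length vs] = map ((!) xs) vs" for xs :: "'x list" and vs
      by (rule nth_equalityI) auto
    have "minor D (snd ?f) k ((!) (lhs_vars e)) (I ?f) =
        minor D (snd ?g) k ((!) (rhs_vars e)) (I ?g)"
    proof
      fix xs
      show "minor D (snd ?f) k ((!) (lhs_vars e)) (I ?f) xs =
          minor D (snd ?g) k ((!) (rhs_vars e)) (I ?g) xs"
      proof (cases "xs \<in> tuples D k")
        case True
        \<comment> \<open>The variables of the identity are below \<open>k\<close>; the value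
          \<open>xs ! 0\<close> elsewhere keeps the assignment inside \<open>D\<close>.\<close>
        define u where "u v = (if v < k then xs ! v else xs ! 0)" for v
        have "xs ! 0 \<in> D" using True k1 by (cases xs) (auto simp: tuples_def)
        then have "range u \<subseteq> D" using True by (auto simp: u_def tuples_def)
        then have "I ?f (map u (lhs_vars e)) = I ?g (map u (rhs_vars e))" by (rule eqs[OF e])
        moreover have "map ((!) xs) (lhs_vars e) = map u (lhs_vars e)"
            "map ((!) xs) (rhs_vars e) = map u (rhs_vars e)"
          using k by (auto simp: u_def)
        moreover have "minor D (length vs) k ((!) vs) f xs = f (map ((!) xs) vs)" for vs f
          using True by (simp add: minor_def mm)
        ultimately show ?thesis using l by metis
      qed (simp add: minor_def)
    qed
    moreover have "(!) (lhs_vars e) \<in> {..<snd ?f} \<rightarrow> {..<k}"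
        "(!) (rhs_vars e) \<in> {..<snd ?g} \<rightarrow> {..<k}"
      using k l nth_mem by fastforce+
    ultimately have "minor E (snd ?f) k ((!) (lhs_vars e)) (\<xi> (snd ?f) (I ?f)) =
        minor E (snd ?g) k ((!) (rhs_vars e)) (\<xi> (snd ?g) (I ?g))"
      using xi I[of ?f] I[of ?g] ar[of ?f] ar[of ?g] e k1 unfolding minion_homomorphism_def
      by (metis UnI1 UnI2 imageI)
    from fun_cong[OF this, of "map s [0..<k]"]
    have "\<xi> (snd ?f) (I ?f) (map ((!) (map s [0..<k])) (lhs_vars e)) =
        \<xi> (snd ?g) (I ?g) (map ((!) (map s [0..<k])) (rhs_vars e))"
      using image_subset_iff[of s "{0..<k}" E] s
          by (auto simp: minor_def tuples_def mm simp flip: l)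
    moreover have "map ((!) (map s [0..<k])) vs = map s vs"
        if "set vs \<subseteq> set (lhs_vars e) \<union> set (rhs_vars e)" for vs
      using k that by (auto simp: subset_iff)
    ultimately show ?thesis by simp
  qed
  then show ?thesis using mem by (intro satisfiesI[of _ "\<lambda>f. \<xi> (snd f) (I f)"])
qed

text \<open>The Hagemann--Mitschke identities for \<open>n\<close>-permutability, without idempotence.\<close>

definition hm_condition :: "nat \<Rightarrow> h1_identity set" where
  "hm_condition L = {H1 (0, 3) [0, 0, 1] (0, 3) [1, 1, 1], H1 (L - 1, 3) [0, 1, 1] (L - 1, 3) [0, 0,
    0]} \<union>
     (\<lambda>m. H1 (m, 3) [0, 1, 1] (Suc m, 3) [0, 0, 1]) ` {m. Suc m < L}"

lemma height1_hm: "height1_condition (hm_condition L)"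
proof -
  have "finite {m. Suc m < L}" by (rule finite_subset[of _ "{..<L}"]) auto
  then show ?thesis by (auto simp: hm_condition_def height1_condition_def h1_identity_wf_def)
qed

text \<open>The first identity leaves only the third projection for symbol 0, the linking identities
  pass this on along the chain, and the last identity rejects it.\<close>

lemma nontrivial_hm:
  assumes "1 \<le> L"
  shows "\<not> trivial_condition (hm_condition L)"
proof
  assume "trivial_condition (hm_condition L)"
  then obtain I where I: "\<And>f. f \<in> lhs_sym ` hm_condition L \<union> rhs_sym ` hm_condition L \<Longrightarrow>
      I f \<in> proj_clone (snd f)"
    and eqs: "\<And>e s. e \<in> hm_condition L \<Longrightarrow> range s \<subseteq> {0, 1} \<Longrightarrow>
      I (lhs_sym e) (map s (lhs_vars e)) = I (rhs_sym e) (map s (rhs_vars e))"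
    unfolding trivial_condition_def by (rule satisfiesE) blast
  define s where "s x = (if x = 1 then 1 else 0 :: nat)" for x :: nat
  have s: "range s \<subseteq> {0, 1}" by (auto simp: s_def)
  have pr: "\<exists>i<3. \<forall>vs. length vs = 3 \<longrightarrow> I (m, 3) (map s vs) = s (vs ! i)"
    if m: "(m, 3) \<in> lhs_sym ` hm_condition L \<union> rhs_sym ` hm_condition L" for m
  proof -
    obtain i where "i < 3" "I (m, 3) = proj {0, 1} 3 i" using I[OF m]
        by (auto simp: projections_def)
    then show ?thesis using proj_map[OF _ _ s, of i 3] by auto
  qed
  have third: "I (m, 3) (map s [0, 1, 1]) = 1 \<and>
      (m, 3) \<in> lhs_sym ` hm_condition L \<union> rhs_sym ` hm_condition L"
    if "m < L" for m
    using that
  proof (induction m)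
    case 0
    have e: "H1 (0, 3) [0, 0, 1] (0, 3) [1, 1, 1] \<in> hm_condition L" by (simp add: hm_condition_def)
    have m: "(0, 3) \<in> lhs_sym ` hm_condition L \<union> rhs_sym ` hm_condition L"
      using imageI[OF e, of lhs_sym] by simp
    obtain i where i: "i < 3" "\<And>vs. length vs = 3 \<Longrightarrow> I (0, 3) (map s vs) = s (vs ! i)" using pr[OF m]
        by blast
    have "s ([0, 0, 1] ! i) = s ([1, 1, 1] ! i)"
        using eqs[OF e s] i(2)[of "[0, 0, 1]"] i(2)[of "[1, 1, 1]"] by simp
    then have "i = 2" using i(1) by (auto simp: s_def less_Suc_eq numeral_3_eq_3)
    then show ?case using i(2)[of "[0, 1, 1]"] m by (simp add: s_def)
  next
    case (Suc m)
    have e: "H1 (m, 3) [0, 1, 1] (Suc m, 3) [0, 0, 1] \<in> hm_condition L" using Suc.prems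
        by (simp add: hm_condition_def)
    have m: "(Suc m, 3) \<in> lhs_sym ` hm_condition L \<union> rhs_sym ` hm_condition L"
      using imageI[OF e, of rhs_sym] by simp
    obtain i where i: "i < 3" "\<And>vs. length vs = 3 \<Longrightarrow> I (Suc m, 3) (map s vs) = s (vs ! i)"
        using pr[OF m] by blast
    have "1 = s ([0, 0, 1] ! i)" using eqs[OF e s] i(2)[of "[0, 0, 1]"] Suc by simp
    then have "i = 2" using i(1) by (auto simp: s_def less_Suc_eq numeral_3_eq_3)
    then show ?case using i(2)[of "[0, 1, 1]"] m by (simp add: s_def)
  qed
  have t: "I (L - 1, 3) (map s [0, 1, 1]) = 1"
      "(L - 1, 3) \<in> lhs_sym ` hm_condition L \<union> rhs_sym ` hm_condition L"
    using third[of "L - 1"] assms by auto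
  obtain i where i: "i < 3" "\<And>vs. length vs = 3 \<Longrightarrow> I (L - 1, 3) (map s vs) = s (vs ! i)"
      using pr[OF t(2)] by blast
  have "H1 (L - 1, 3) [0, 1, 1] (L - 1, 3) [0, 0, 0] \<in> hm_condition L"
      by (simp add: hm_condition_def)
  from eqs[OF this s] have "1 = s ([0, 0, 0] ! i)" using t(1) i(2)[of "[0, 0, 0]"] by simp
  then show False using i(1) by (auto simp: s_def less_Suc_eq numeral_3_eq_3)
qed

text \<open>Normal forms of the terms \<open>f\<^sub>m(x, y, z)\<close> modulo the identities of \<open>hm_condition L\<close>.\<close>

definition hm_nf :: "nat \<Rightarrow> nat \<Rightarrow> nat \<Rightarrow> nat \<Rightarrow> nat \<Rightarrow> nat list" where
  "hm_nf L m x y z =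
     (if x = y \<and> y = z then [x]
      else if x = y then (if m = 0 then [z] else [m, x, z])
      else if y = z then (if Suc m = L then [x] else [Suc m, x, z])
      else [m, x, y, z])"

text \<open>The evaluation of normal forms that interprets \<open>f\<^sub>k\<close> by the third projection for \<open>k < m\<close> and
    by the
  first projection for \<open>k > m\<close>; no projection works for \<open>f\<^sub>m\<close>.\<close>

definition hm_eval :: "nat \<Rightarrow> nat list \<Rightarrow> nat" where
  "hm_eval m c =
     (if length c = 1 then c ! 0
      else if length c = 3 then (if c ! 0 \<le> m then c ! 2 else c ! 1)
      else (if c ! 0 < m then c ! 3 else c ! 1))"

text \<open>The normal form \<open>[c, x, z]\<close> stands for both the symbol \<open>c\<close> at
  \<open>(x, x, z)\<close> and the symbol \<open>c - 1\<close> at \<open>(x, z, z)\<close>. For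
  \<open>c \<le> m\<close> the symbols other than \<open>m\<close> among these two are third
  projections, for \<open>c > m\<close> they are first projections; hence the threshold
  \<open>c ! 0 \<le> m\<close> in \<open>hm_eval\<close>.\<close>

lemma hm_eval_nf: "k < L \<Longrightarrow> m < L \<Longrightarrow> k \<noteq> m \<Longrightarrow> hm_eval m (hm_nf L k x y z) = (if k < m then z else x)"
  by (auto simp: hm_eval_def hm_nf_def)

section \<open>Polymorphisms of the reduct\<close>

context forbidden
begin

lemma Pol_edge_struct_I:
  assumes "1 \<le> n" and "\<And>j ts. j < length es \<Longrightarrow> length ts = length (es ! j) \<Longrightarrow> set ts \<subseteq> tuples UNIV n \<Longrightarrow>
      (\<And>i. i < n \<Longrightarrow> map (\<lambda>t. t ! i) ts \<in> limit j) \<Longrightarrow> map f ts \<in> limit j"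
  shows "restrict f (tuples UNIV n) \<in> Pol edge_struct n"
proof -
  have "map (restrict f (tuples UNIV n)) ts \<in> limit j"
    if j: "j < length es" and ts: "ts \<in> rel (power_struct n edge_struct) j" for j ts
  proof -
    have t: "length ts = length (es ! j)" "set ts \<subseteq> tuples UNIV n"
        "\<And>i. i < n \<Longrightarrow> map (\<lambda>t. t ! i) ts \<in> limit j"
      using ts by (auto simp: power_struct_def edge_struct_simps tuples_def)
    have "map (restrict f (tuples UNIV n)) ts = map f ts" using t(2) by auto
    then show ?thesis using assms(2)[OF j t] by metis
  qed
  then have "homomorphism (power_struct n edge_struct) edge_struct (restrict f (tuples UNIV n))"
    unfolding homomorphism_def by (simp add: same_signature_def power_struct_def edge_struct_simps)
  then show ?thesis
    using assms(1) unfolding Pol_def operations_def by (auto simp: edge_struct_simps)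
qed

lemma Pol_edge_struct_D:
  assumes "f \<in> Pol edge_struct n" "j < length es" "length ts = length (es ! j)"
      "set ts \<subseteq> tuples UNIV n"
    "\<And>i. i < n \<Longrightarrow> map (\<lambda>t. t ! i) ts \<in> limit j"
  shows "map f ts \<in> limit j"
  using assms unfolding Pol_def homomorphism_def power_struct_def
  by (auto simp: edge_struct_simps tuples_def)

lemma satisfies_hm:
  "satisfies UNIV (Pol edge_struct) (hm_condition (Suc (length es)))"
proof -
  let ?L = "Suc (length es)"
  define c where "c k t = to_nat (hm_nf ?L k (t ! 0) (t ! 1) (t ! 2))" for k and t :: "nat list"
  \<comment> \<open>The free structure: a tuple of its relation arises by applying one symbol
    \<open>k\<close> to three tuples of the relation in the limit.\<close>
  define R where "R j = {map (c k) ts | k ts. k < ?L \<and> length ts = length (es ! j) \<and>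
      set ts \<subseteq> tuples UNIV 3 \<and>
      (\<forall>i<3. map (\<lambda>t. t ! i) ts \<in> limit j)}" for j
  have "\<exists>g. \<forall>j<length es. \<forall>t\<in>R j. map g t \<in> limit j"
  proof (rule limit_hom)
    show "\<not> (\<exists>h. \<forall>j<length es. map h (es ! j) \<in> R j)"
    proof
      assume "\<exists>h. \<forall>j<length es. map h (es ! j) \<in> R j"
      then obtain h where h: "\<forall>j<length es. map h (es ! j) \<in> R j" by blast
      have "\<forall>j<length es. \<exists>k ts. map h (es ! j) = map (c k) ts \<and> k < ?L \<and>
          (\<forall>i<3. map (\<lambda>t. t ! i) ts \<in> limit j)"
        using h unfolding R_def by blast
      then obtain k ts where kt: "\<And>j. j < length es \<Longrightarrow> map h (es ! j) = map (c (k j)) (ts j) \<and>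
          k j < ?L \<and>
          (\<forall>i<3. map (\<lambda>t. t ! i) (ts j) \<in> limit j)" by metis
      have "card (k ` All) < card {..<?L}" using card_image_le[of All k] by simp
      then have "\<not> {..<?L} \<subseteq> k ` All" using card_mono[of "k ` All" "{..<?L}"] by auto
      then obtain m where m: "m < ?L" "m \<notin> k ` All" by blast
      have "map (hm_eval m \<circ> from_nat \<circ> h) (es ! j) \<in> limit j" if j: "j < length es" for j
      proof -
        have "map (hm_eval m \<circ> from_nat \<circ> h) (es ! j) = map (hm_eval m \<circ> from_nat) (map h (es ! j))"
            by simp
        then have "map (hm_eval m \<circ> from_nat \<circ> h) (es ! j) =
            map (hm_eval m \<circ> from_nat \<circ> c (k j)) (ts j)"
          using kt[OF j] by simp
        moreover have "k j \<noteq> m" using m(2) j by auto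
        \<comment> \<open>Evaluation turns each edge into the third or the first of its three
          tuples, which lie in the limit relation.\<close>
        ultimately have "map (hm_eval m \<circ> from_nat \<circ> h) (es ! j) =
            map (\<lambda>t. t ! (if k j < m then 2 else 0)) (ts j)"
          using hm_eval_nf[of "k j" ?L m] m(1) kt[OF j] by (auto simp: c_def)
        then show ?thesis using kt[OF j] by auto
      qed
      then show False using limit_free by blast
    qed
    show "length t = length (es ! j)" if "t \<in> R j" for j t using that by (auto simp: R_def)
  qed
  then obtain g where g: "\<And>j t. j < length es \<Longrightarrow> t \<in> R j \<Longrightarrow> map g t \<in> limit j" by blast
  define I :: "fsym \<Rightarrow> nat list \<Rightarrow> nat" where "I f = restrict (g \<circ> c (fst f)) (tuples UNIV 3)" for f
  have sym: "snd f = 3 \<and> fst f < ?L" if "f \<in> lhs_sym ` hm_condition ?L \<union> rhs_sym ` hm_condition ?L"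
      for f
    using that by (auto simp: hm_condition_def)
  have "I f \<in> Pol edge_struct (snd f)" if "f \<in> lhs_sym ` hm_condition ?L \<union> rhs_sym ` hm_condition
      ?L" for f
  proof -
    have f: "snd f = 3" "fst f < ?L" using sym[OF that] by auto
    have "restrict (g \<circ> c (fst f)) (tuples UNIV 3) \<in> Pol edge_struct 3"
    proof (rule Pol_edge_struct_I)
      fix j ts assume j: "j < length es" "length ts = length (es ! j)" "set ts \<subseteq> tuples UNIV 3"
        "\<And>i. i < 3 \<Longrightarrow> map (\<lambda>t. t ! i) ts \<in> limit j"
      then have "map (c (fst f)) ts \<in> R j" using f unfolding R_def by blast
      then show "map (g \<circ> c (fst f)) ts \<in> limit j" using g[OF j(1)] by fastforce
    qed simp
    then show ?thesis by (simp add: I_def f)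
  qed
  moreover have "I (lhs_sym e) (map s (lhs_vars e)) = I (rhs_sym e) (map s (rhs_vars e))"
    if e: "e \<in> hm_condition ?L" for e and s :: "nat \<Rightarrow> nat"
  proof -
    have Ic: "I (m, 3) (map s [x, y, z]) = g (to_nat (hm_nf ?L m (s x) (s y) (s z)))" for m x y z
      by (simp add: I_def tuples_def c_def)
    consider "e = H1 (0, 3) [0, 0, 1] (0, 3) [1, 1, 1]" |
        "e = H1 (?L - 1, 3) [0, 1, 1] (?L - 1, 3) [0, 0, 0]"
      | m where "Suc m < ?L" "e = H1 (m, 3) [0, 1, 1] (Suc m, 3) [0, 0, 1]"
      using e by (auto simp: hm_condition_def)
    then show ?thesis by cases (simp_all only: h1_identity.sel Ic, simp_all add: hm_nf_def)
  qed
  ultimately show ?thesis by (intro satisfiesI[of _ I])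
qed

end

section \<open>The structure associated with a condition\<close>

lemma minimal_nontrivial:
  assumes "finite \<Sigma>" "\<not> trivial_condition \<Sigma>"
  shows "\<exists>\<Sigma>'\<subseteq>\<Sigma>. \<not> trivial_condition \<Sigma>' \<and> (\<forall>\<Sigma>''. \<Sigma>'' \<subset> \<Sigma>' \<longrightarrow> trivial_condition \<Sigma>'')"
  using assms
proof (induction \<Sigma> rule: finite_psubset_induct)
  case (psubset \<Sigma>)
  then show ?case by (cases "\<forall>\<Sigma>''. \<Sigma>'' \<subset> \<Sigma> \<longrightarrow> trivial_condition \<Sigma>''") (blast, meson
      psubset_imp_subset subset_trans)
qed

locale minimal_condition =
  fixes \<Sigma> :: "h1_identity set"
  assumes h1: "height1_condition \<Sigma>" and nontrivial: "\<not> trivial_condition \<Sigma>"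
    and minimal: "\<Sigma>' \<subset> \<Sigma> \<Longrightarrow> trivial_condition \<Sigma>'"
begin

definition symbols :: "fsym set" where
  "symbols = lhs_sym ` \<Sigma> \<union> rhs_sym ` \<Sigma>"

definition fs :: "fsym list" where
  "fs = (SOME fs. set fs = symbols \<and> distinct fs)"

lemma set_fs: "set fs = symbols" and distinct_fs: "distinct fs"
proof -
  have "finite symbols" using h1 by (simp add: symbols_def height1_condition_def)
  then have "set fs = symbols \<and> distinct fs"
    unfolding fs_def by (rule someI_ex[OF finite_distinct_list])
  then show "set fs = symbols" "distinct fs" by auto
qed

lemma wf:
  assumes "e \<in> \<Sigma>"
  shows "length (lhs_vars e) = snd (lhs_sym e)" "length (rhs_vars e) = snd (rhs_sym e)"
    "lhs_sym e \<in> symbols" "rhs_sym e \<in> symbols"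
  using h1 assms by (auto simp: height1_condition_def h1_identity_wf_def symbols_def)

definition args :: "fsym \<Rightarrow> nat list list" where
  "args f = List.n_lists (snd f) [0, 1]"

lemma set_args: "a \<in> set (args f) \<longleftrightarrow> length a = snd f \<and> set a \<subseteq> {0, 1}"
  by (auto simp: set_n_lists args_def)

lemma args_ne: "args f \<noteq> []"
  using length_n_lists[of "snd f" "[0, 1 :: nat]"] by (auto simp: args_def)

section \<open>Vertices as classes of terms\<close>

definition terms :: "(fsym \<times> nat list) set" where
  "terms = (SIGMA f:symbols. set (args f))"

definition instances :: "((fsym \<times> nat list) \<times> (fsym \<times> nat list)) set" where
  "instances = {((lhs_sym e, map s (lhs_vars e)), (rhs_sym e, map s (rhs_vars e))) | e s.
     e \<in> \<Sigma> \<and> range s \<subseteq> {0, 1}}"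

definition eqv :: "((fsym \<times> nat list) \<times> (fsym \<times> nat list)) set" where
  "eqv = (instances \<union> instances\<inverse>)\<^sup>*"

lemma eqv_sym: "(t, u) \<in> eqv \<Longrightarrow> (u, t) \<in> eqv"
proof -
  have "sym (instances \<union> instances\<inverse>)" by (auto simp: sym_def)
  then show "(t, u) \<in> eqv \<Longrightarrow> (u, t) \<in> eqv" unfolding eqv_def by (metis sym_def sym_rtrancl)
qed

lemma eqv_trans: "(t, u) \<in> eqv \<Longrightarrow> (u, v) \<in> eqv \<Longrightarrow> (t, v) \<in> eqv"
  unfolding eqv_def by (rule rtrancl_trans)

lemma eqv_refl: "(t, t) \<in> eqv"
  by (simp add: eqv_def)

text \<open>This is how a valuation of terms descends to the vertices.\<close>

lemma eqv_invariant:
  assumes "\<And>e s. e \<in> \<Sigma> \<Longrightarrow> range s \<subseteq> {0, 1} \<Longrightarrow>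
    F (lhs_sym e, map s (lhs_vars e)) = F (rhs_sym e, map s (rhs_vars e))"
    and "(t, u) \<in> eqv"
  shows "F t = F u"
  using assms(2) unfolding eqv_def
  by (induction rule: rtrancl_induct) (use assms(1) in \<open>auto simp: instances_def\<close>)

lemma finite_terms: "finite terms"
  unfolding terms_def using set_fs by (intro finite_SigmaI) (metis List.finite_set, simp)

definition vnum :: nat where
  "vnum = card ((\<lambda>t. eqv `` {t}) ` terms)"

text \<open>The classes are numbered so that the vertices form the initial segment required by the
  search.\<close>

definition cls :: "fsym \<times> nat list \<Rightarrow> nat" where
  "cls t = (SOME b. bij_betw b ((\<lambda>t. eqv `` {t}) ` terms) {0..<vnum}) (eqv `` {t})"

lemma cls_image: "cls ` terms = {..<vnum}"
  and cls_eq: "t \<in> terms \<Longrightarrow> u \<in> terms \<Longrightarrow> cls t = cls u \<longleftrightarrow> (t, u) \<in> eqv"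
proof -
  define b where "b = (SOME b. bij_betw b ((\<lambda>t. eqv `` {t}) ` terms) {0..<vnum})"
  have b: "bij_betw b ((\<lambda>t. eqv `` {t}) ` terms) {0..<vnum}"
    unfolding b_def vnum_def by (rule someI_ex[OF ex_bij_betw_finite_nat]) (simp add: finite_terms)
  have c: "cls t = b (eqv `` {t})" for t by (simp add: cls_def b_def)
  show "cls ` terms = {..<vnum}" using b by (simp add: c bij_betw_def image_image lessThan_atLeast0)
  assume tu: "t \<in> terms" "u \<in> terms"
  have "cls t = cls u \<longleftrightarrow> eqv `` {t} = eqv `` {u}"
    unfolding c using b tu by (intro inj_on_eq_iff[of b]) (auto simp: bij_betw_def)
  also have "\<dots> \<longleftrightarrow> (t, u) \<in> eqv"
    using eqv_sym eqv_trans eqv_refl by blast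
  finally show "cls t = cls u \<longleftrightarrow> (t, u) \<in> eqv" .
qed

section \<open>The forbidden structure and its connectedness\<close>

definition es :: "nat list list" where
  "es = map (\<lambda>f. map (\<lambda>a. cls (f, a)) (args f)) fs"

lemma length_es: "length es = length fs"
  by (simp add: es_def)

lemma nth_es: "j < length fs \<Longrightarrow> es ! j = map (\<lambda>a. cls (fs ! j, a)) (args (fs ! j))"
  by (simp add: es_def)

lemma instance_terms:
  assumes "e \<in> \<Sigma>" "range s \<subseteq> {0, 1}"
  shows "(lhs_sym e, map s (lhs_vars e)) \<in> terms" "(rhs_sym e, map s (rhs_vars e)) \<in> terms"
    "cls (lhs_sym e, map s (lhs_vars e)) = cls (rhs_sym e, map s (rhs_vars e))"
proof -
  show t: "(lhs_sym e, map s (lhs_vars e)) \<in> terms" "(rhs_sym e, map s (rhs_vars e)) \<in> terms"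
    using wf[OF assms(1)] assms(2) unfolding terms_def by (auto simp: set_args image_subset_iff)
  have "((lhs_sym e, map s (lhs_vars e)), (rhs_sym e, map s (rhs_vars e))) \<in> eqv"
    unfolding eqv_def using assms by (intro r_into_rtrancl) (auto simp: instances_def)
  then show "cls (lhs_sym e, map s (lhs_vars e)) = cls (rhs_sym e, map s (rhs_vars e))"
    using cls_eq[OF t] by blast
qed

lemma trivial_glue:
  assumes "trivial_condition {e \<in> \<Sigma>. lhs_sym e \<in> F}" "trivial_condition {e \<in> \<Sigma>. lhs_sym e \<notin> F}"
    and F: "\<And>e. e \<in> \<Sigma> \<Longrightarrow> lhs_sym e \<in> F \<longleftrightarrow> rhs_sym e \<in> F"
  shows "trivial_condition \<Sigma>"
proof -
  let ?A = "{e \<in> \<Sigma>. lhs_sym e \<in> F}" and ?B = "{e \<in> \<Sigma>. lhs_sym e \<notin> F}"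
  obtain I where I: "\<And>f. f \<in> lhs_sym ` ?A \<union> rhs_sym ` ?A \<Longrightarrow> I f \<in> proj_clone (snd f)"
    "\<And>e s. e \<in> ?A \<Longrightarrow> range s \<subseteq> {0, 1} \<Longrightarrow>
      I (lhs_sym e) (map s (lhs_vars e)) = I (rhs_sym e) (map s (rhs_vars e))"
    using assms(1) unfolding trivial_condition_def by (rule satisfiesE) blast
  obtain I' where I': "\<And>f. f \<in> lhs_sym ` ?B \<union> rhs_sym ` ?B \<Longrightarrow> I' f \<in> proj_clone (snd f)"
    "\<And>e s. e \<in> ?B \<Longrightarrow> range s \<subseteq> {0, 1} \<Longrightarrow>
      I' (lhs_sym e) (map s (lhs_vars e)) = I' (rhs_sym e) (map s (rhs_vars e))"
    using assms(2) unfolding trivial_condition_def by (rule satisfiesE) blast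
  show ?thesis
    unfolding trivial_condition_def
  proof (rule satisfiesI[of _ "\<lambda>f. if f \<in> F then I f else I' f"])
    fix f assume "f \<in> lhs_sym ` \<Sigma> \<union> rhs_sym ` \<Sigma>"
    then obtain e where e: "e \<in> \<Sigma>" "f = lhs_sym e \<or> f = rhs_sym e" by blast
    show "(if f \<in> F then I f else I' f) \<in> proj_clone (snd f)"
    proof (cases "f \<in> F")
      case True
      then have "e \<in> ?A" using e F by auto
      then have "f \<in> lhs_sym ` ?A \<union> rhs_sym ` ?A" using e by blast
      then show ?thesis using I(1) True by simp
    next
      case False
      then have "e \<in> ?B" using e F by auto
      then have "f \<in> lhs_sym ` ?B \<union> rhs_sym ` ?B" using e by blast
      then show ?thesis using I'(1) False by simp
    qed
  next
    fix e and s :: "nat \<Rightarrow> nat" assume "e \<in> \<Sigma>" "range s \<subseteq> {0, 1}"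
    then show "(if lhs_sym e \<in> F then I (lhs_sym e) else I' (lhs_sym e)) (map s (lhs_vars e)) =
        (if rhs_sym e \<in> F then I (rhs_sym e) else I' (rhs_sym e)) (map s (rhs_vars e))"
      using I(2)[of e s] I'(2)[of e s] F[of e] by simp
  qed
qed

text \<open>Suppose the edges in \<open>J\<close> share no vertex with the others. The two sides of
  an identity, with all variables set to 0, are one vertex, so both symbols have their index in
  \<open>J\<close> or both do not. The condition thus splits into two proper subsets, trivial by
  minimality, whose solutions can be glued.\<close>

lemma forbidden_es: "forbidden es"
proof
  have "\<Sigma> \<noteq> {}"
  proof
    assume "\<Sigma> = {}"
    then have "trivial_condition \<Sigma>" by (simp add: trivial_condition_def satisfies_def)
    then show False using nontrivial by blast
  qed
  then have "fs \<noteq> []" using set_fs by (auto simp: symbols_def)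
  then show "es \<noteq> []" by (simp add: es_def)
  show "es ! j \<noteq> []" if "j < length es" for j
    using that by (simp add: length_es nth_es args_ne)
  fix J assume J: "J \<subseteq> {..<length es}" "J \<noteq> {}" "J \<noteq> {..<length es}"
  show "(\<Union>j\<in>J. set (es ! j)) \<inter> (\<Union>j\<in>{..<length es} - J. set (es ! j)) \<noteq> {}"
  proof
    assume dis: "(\<Union>j\<in>J. set (es ! j)) \<inter> (\<Union>j\<in>{..<length es} - J. set (es ! j)) = {}"
    define F where "F = (!) fs ` J"
    have inF: "fs ! j \<in> F \<longleftrightarrow> j \<in> J" if "j < length fs" for j
      using that J(1) distinct_fs nth_eq_iff_index_eq[OF distinct_fs]
          by (auto simp: F_def length_es)
    have cF: "cls t \<in> (\<Union>j\<in>J. set (es ! j))" if t: "t \<in> terms" "fst t \<in> F" for t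
    proof -
      obtain j where j: "j \<in> J" "fst t = fs ! j" using t(2) by (auto simp: F_def)
      have "cls (fs ! j, snd t) \<in> set (es ! j)"
        using t j J(1) by (auto simp: nth_es length_es terms_def subset_iff)
      then show ?thesis using j by (metis UN_I prod.collapse)
    qed
    have cF': "cls t \<in> (\<Union>j\<in>{..<length es} - J. set (es ! j))" if "t \<in> terms" "fst t \<notin> F" for t
    proof -
      have "fst t \<in> set fs" using that by (auto simp: terms_def set_fs)
      then obtain j where j: "j < length fs" "fst t = fs ! j" by (metis in_set_conv_nth)
      have "cls (fs ! j, snd t) \<in> set (es ! j)" using that j by (auto simp: nth_es terms_def)
      moreover have "j \<notin> J" using inF j that by auto
      ultimately show ?thesis using j length_es by (metis DiffI UN_I lessThan_iff prod.collapse)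
    qed
    have F: "lhs_sym e \<in> F \<longleftrightarrow> rhs_sym e \<in> F" if e: "e \<in> \<Sigma>" for e
    proof -
      let ?t = "(lhs_sym e, map (\<lambda>_. 0) (lhs_vars e))"
          and ?u = "(rhs_sym e, map (\<lambda>_. 0) (rhs_vars e))"
      have t: "?t \<in> terms" "?u \<in> terms" and c: "cls ?t = cls ?u"
        using instance_terms[OF e, of "\<lambda>_. 0"] by auto
      show ?thesis
        using cF[OF t(1)] cF[OF t(2)] cF'[OF t(1)] cF'[OF t(2)] dis unfolding c fst_conv by blast
    qed
    have "\<exists>e\<in>\<Sigma>. lhs_sym e \<in> F"
    proof -
      obtain j where "j \<in> J" using J by blast
      then have "fs ! j \<in> F" "fs ! j \<in> symbols" using J(1) set_fs
          by (auto simp: F_def length_es subset_iff)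
      then show ?thesis using F by (auto simp: symbols_def)
    qed
    moreover have "\<exists>e\<in>\<Sigma>. lhs_sym e \<notin> F"
    proof -
      obtain j where "j < length fs" "j \<notin> J" using J by (auto simp: length_es)
      then have "fs ! j \<notin> F" "fs ! j \<in> symbols" using inF set_fs by auto
      then show ?thesis using F by (auto simp: symbols_def)
    qed
    ultimately have "{e \<in> \<Sigma>. lhs_sym e \<in> F} \<subset> \<Sigma>" "{e \<in> \<Sigma>. lhs_sym e \<notin> F} \<subset> \<Sigma>" by blast+
    then show False using trivial_glue[OF minimal minimal F] nontrivial by blast
  qed
qed

sublocale forbidden es
  by (rule forbidden_es)

section \<open>The condition fails in the limit\<close>

lemma verts_All: "verts All = {..<vnum}"
proof -
  have "verts All = (\<Union>j<length fs. (\<lambda>a. cls (fs ! j, a)) ` set (args (fs ! j)))"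
    unfolding verts_def length_es by (rule SUP_cong) (auto simp: nth_es)
  also have "\<dots> = (\<Union>f\<in>set fs. (\<lambda>a. cls (f, a)) ` set (args f))"
  proof -
    have "set fs = (!) fs ` {..<length fs}" by (auto simp: set_conv_nth)
    then show ?thesis by simp
  qed
  also have "\<dots> = cls ` terms" by (auto simp: set_fs terms_def)
  finally show ?thesis using cls_image by simp
qed

text \<open>A homomorphism to the projection tables would choose a coordinate \<open>i f\<close> for
  each symbol. Vertices are classes modulo the identities, so the chosen projections would satisfy
  the condition.\<close>

lemma projection_tables:
  obtains g where "\<And>j i. j < length fs \<Longrightarrow> i < snd (fs ! j) \<Longrightarrow>
      map (\<lambda>a. g (a ! i)) (args (fs ! j)) \<in> limit j"
proof -
  define R where "R j = {map (\<lambda>a. a ! i) (args (fs ! j)) | i. i < snd (fs ! j)}" for j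
  have "\<exists>g. \<forall>j<length es. \<forall>t\<in>R j. map g t \<in> limit j"
  proof (rule limit_hom)
    show "\<not> (\<exists>h. \<forall>j<length es. map h (es ! j) \<in> R j)"
    proof
      assume "\<exists>h. \<forall>j<length es. map h (es ! j) \<in> R j"
      then obtain h where h: "\<forall>j<length es. map h (es ! j) \<in> R j" by blast
      have "\<exists>i<snd f. \<forall>a\<in>set (args f). h (cls (f, a)) = a ! i" if f: "f \<in> symbols" for f
      proof -
        obtain j where j: "j < length fs" "f = fs ! j" using f set_fs by (metis in_set_conv_nth)
        then have "map h (es ! j) \<in> R j" using h length_es by simp
        then obtain i where "i < snd f" "map (\<lambda>a. h (cls (f, a))) (args f) =
            map (\<lambda>a. a ! i) (args f)"
          using j by (auto simp: R_def nth_es comp_def)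
        then show ?thesis by (metis (no_types, lifting) map_eq_conv)
      qed
      then obtain i where i: "\<And>f. f \<in> symbols \<Longrightarrow> i f < snd f \<and>
          (\<forall>a\<in>set (args f). h (cls (f, a)) = a ! i f)"
        by metis
      have "satisfies {0, 1} proj_clone \<Sigma>"
      proof (rule satisfiesI[of _ "\<lambda>f. proj {0, 1} (snd f) (i f)"])
        show "proj {0, 1} (snd f) (i f) \<in> proj_clone (snd f)" if "f \<in> lhs_sym ` \<Sigma> \<union> rhs_sym ` \<Sigma>"
            for f
          using i[of f] that unfolding symbols_def projections_def by blast
        fix e and s :: "nat \<Rightarrow> nat" assume e: "e \<in> \<Sigma>" and s: "range s \<subseteq> {0, 1}"
        note t = instance_terms[OF e s]
        have "proj {0, 1} (snd f) (i f) a = h (cls (f, a))" if "(f, a) \<in> terms" for f a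
          using i[of f] that by (auto simp: terms_def proj_def tuples_def set_args)
        then show "proj {0, 1} (snd (lhs_sym e)) (i (lhs_sym e)) (map s (lhs_vars e)) =
            proj {0, 1} (snd (rhs_sym e)) (i (rhs_sym e)) (map s (rhs_vars e))"
          using t by metis
      qed
      then show False using nontrivial by (simp add: trivial_condition_def)
    qed
    show "length t = length (es ! j)" if "j < length es" "t \<in> R j" for j t
      using that by (auto simp: R_def nth_es length_es)
  qed
  then obtain g where g: "\<And>j t. j < length es \<Longrightarrow> t \<in> R j \<Longrightarrow> map g t \<in> limit j" by blast
  have "map (\<lambda>a. g (a ! i)) (args (fs ! j)) \<in> limit j" if "j < length fs" "i < snd (fs ! j)" for i j
  proof -
    have "map (\<lambda>a. a ! i) (args (fs ! j)) \<in> R j" using that by (auto simp: R_def)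
    from g[OF _ this] have "map g (map (\<lambda>a. a ! i) (args (fs ! j))) \<in> limit j" using that length_es
        by simp
    then show ?thesis by (simp add: comp_def)
  qed
  then show thesis by (rule that)
qed

lemma not_satisfies: "\<not> satisfies UNIV (Pol edge_struct) \<Sigma>"
proof
  assume "satisfies UNIV (Pol edge_struct) \<Sigma>"
  then obtain I where I: "\<And>f. f \<in> symbols \<Longrightarrow> I f \<in> Pol edge_struct (snd f)"
    "\<And>e s. e \<in> \<Sigma> \<Longrightarrow> range s \<subseteq> UNIV \<Longrightarrow>
      I (lhs_sym e) (map s (lhs_vars e)) = I (rhs_sym e) (map s (rhs_vars e))"
    unfolding symbols_def by (rule satisfiesE) blast
  obtain g where g: "\<And>j i. j < length fs \<Longrightarrow> i < snd (fs ! j) \<Longrightarrow>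
      map (\<lambda>a. g (a ! i)) (args (fs ! j)) \<in> limit j"
    by (rule projection_tables) blast
  \<comment> \<open>Terms over \<open>{0, 1}\<close> are evaluated with \<open>g 0\<close> and
    \<open>g 1\<close> in place of 0 and 1; the identities make the value depend on the class
    only.\<close>
  define val where "val t = I (fst t) (map g (snd t))" for t
  have val_eqv: "val t = val u" if "(t, u) \<in> eqv" for t u
    using _ that
  proof (rule eqv_invariant)
    show "val (lhs_sym e, map s (lhs_vars e)) = val (rhs_sym e, map s (rhs_vars e))" if "e \<in> \<Sigma>"
        for e s
      using I(2)[OF that, of "g \<circ> s"] by (simp add: val_def)
  qed
  define h where "h v = val (SOME t. t \<in> terms \<and> cls t = v)" for v
  have h: "h (cls t) = val t" if "t \<in> terms" for t
  proof -
    let ?u = "SOME u. u \<in> terms \<and> cls u = cls t"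
    have "?u \<in> terms \<and> cls ?u = cls t" using that
        by (intro someI[of "\<lambda>u. u \<in> terms \<and> cls u = cls t"]) simp
    then have "(?u, t) \<in> eqv" using cls_eq that by blast
    then show ?thesis unfolding h_def by (rule val_eqv)
  qed
  have "map h (es ! j) \<in> limit j" if j: "j < length es" for j
  proof -
    have j': "j < length fs" using j length_es by simp
    let ?f = "fs ! j"
    have f: "?f \<in> symbols" using j' set_fs nth_mem by blast
    have "map h (es ! j) = map (\<lambda>a. h (cls (?f, a))) (args ?f)" using j' by (simp add: nth_es)
    also have "\<dots> = map (\<lambda>a. val (?f, a)) (args ?f)"
      using f by (intro map_cong refl h) (auto simp: terms_def)
    also have "\<dots> = map (I ?f) (map (map g) (args ?f))" by (simp add: val_def)
    finally have e: "map h (es ! j) = map (I ?f) (map (map g) (args ?f))" .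
    have "map (I ?f) (map (map g) (args ?f)) \<in> limit j"
    proof (rule Pol_edge_struct_D[OF I(1)[OF f] j])
      show "length (map (map g) (args ?f)) = length (es ! j)" using j' by (simp add: nth_es)
      show "set (map (map g) (args ?f)) \<subseteq> tuples UNIV (snd ?f)" by (auto simp: tuples_def set_args)
      \<comment> \<open>Column \<open>i\<close> of the arguments is the image under \<open>g\<close>
        of the table of the projection to coordinate \<open>i\<close>, hence a tuple of the
        relation.\<close>
      fix i assume i: "i < snd ?f"
      have "map (\<lambda>t. t ! i) (map (map g) (args ?f)) = map (\<lambda>a. g (a ! i)) (args ?f)"
        using i by (auto simp: set_args)
      then show "map (\<lambda>t. t ! i) (map (map g) (args ?f)) \<in> limit j" using g[OF j' i] by metis
    qed
    then show ?thesis using e by metis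
  qed
  then show False using limit_free by blast
qed

end

theorem theorem1p3:
  fixes \<Sigma> :: "h1_identity set"
  assumes "height1_condition \<Sigma>"
    and "\<not> trivial_condition \<Sigma>"
  shows "\<exists>B :: (nat, nat) rel_struct. is_structure B \<and>
    (\<exists>A :: (nat, nat) rel_struct.
       is_structure A \<and> finitely_bounded A \<and> homogeneous A \<and> fo_reduct B A) \<and>
    \<not> satisfies (universe B) (Pol B) \<Sigma> \<and>
    (\<exists>\<Sigma>'. height1_condition \<Sigma>' \<and> \<not> trivial_condition \<Sigma>' \<and>
       satisfies (universe B) (Pol B) \<Sigma>') \<and>
    \<not> (\<exists>\<xi>. minion_homomorphism (universe B) (Pol B) {0, 1} proj_clone \<xi>) \<and>
    csp_poly_time B"
proof -
  have fin: "finite \<Sigma>" using assms(1) by (simp add: height1_condition_def)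
  \<comment> \<open>Satisfaction is inherited by subsets, so refuting a minimal nontrivial subset
    refutes the whole condition.\<close>
  obtain \<Sigma>0 where S: "\<Sigma>0 \<subseteq> \<Sigma>" "\<not> trivial_condition \<Sigma>0" "\<And>\<Sigma>'. \<Sigma>' \<subset> \<Sigma>0 \<Longrightarrow> trivial_condition \<Sigma>'"
    using minimal_nontrivial[OF fin assms(2)] by blast
  have "height1_condition \<Sigma>0"
    using assms(1) S(1) finite_subset by (auto simp: height1_condition_def)
  then interpret minimal_condition \<Sigma>0 using S by unfold_locales
  let ?B = edge_struct and ?S = "hm_condition (Suc (length es))"
  have sat: "satisfies (universe ?B) (Pol ?B) ?S" using satisfies_hm
      by (simp add: edge_struct_simps)
  have nt: "\<not> trivial_condition ?S" by (rule nontrivial_hm) simp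
  have "\<not> minion_homomorphism (universe ?B) (Pol ?B) {0, 1} proj_clone \<xi>" for \<xi>
    using satisfies_minion_homomorphism[OF _ height1_hm sat] nt unfolding trivial_condition_def
        by blast
  moreover have "\<not> satisfies (universe ?B) (Pol ?B) \<Sigma>"
    using not_satisfies satisfies_subset[OF _ S(1)] unfolding edge_struct_simps by blast
  ultimately show ?thesis
    using is_structure_edge_struct is_structure_limit finitely_bounded_limit homogeneous_limit
      fo_reduct_edge_struct height1_hm nt sat csp_poly_time_edge_struct[OF verts_All]
    by (intro exI[of _ ?B] conjI exI[of _ limit_struct] exI[of _ ?S]) auto
qed

end
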